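(* Let $\mathcal{C}$ be a closed symmetric monoidal category such that (i) each pair of morphisms $X\rightrightarrows Y$ in $\mathcal{C}$ with a common left inverse admits an equaliser, and (ii) each pair of morphisms $X\rightrightarrows Y$ in $\mathcal{C}$ with a common right inverse admits a coequaliser. Let $C$ be a comonoid in $\mathcal{C}$. Then the functors $L$ and $R$ between the $\mathcal{C}$-enriched categories of $C$-contramodules and $C$-comodules form a $\mathcal{C}$-enriched adjoint pair of $\mathcal{C}$-enriched functors $$(L\dashv R),\qquad L:\mathcal{C}^C\rightleftarrows\mathcal{C}_C:R.$$
   Context: $\mathcal{C}$ has tensor product $\otimes$, unit $I$ and internal hom $[X,-]$, right adjoint to $-\otimes X$. Let $(C,\Delta,\varepsilon)$ be a comonoid; write $TX=X\otimes C$ (a comonad) and $FX=[C,X]$ (a monad), so $T\dashv F$. A (right) $C$-comodule is an object $X$ with $\rho_X:X\to X\otimes C$ such that $(\rho_X\otimes 1)\rho_X=(1\otimes\Delta)\rho_X$ and $(1\otimes\varepsilon)\rho_X=\mathrm{id}$ (modulo associators and unitors). A $C$-contramodule is an object $Y$ with $\theta_Y:[C,Y]\to Y$ such that $\theta_Y\circ[C,\theta_Y]=\theta_Y\circ[\Delta,Y]$ under $[C,[C,Y]]\cong[C\otimes C,Y]$, and $Y\cong[I,Y]\xrightarrow{[\varepsilon,Y]}[C,Y]\xrightarrow{\theta_Y}Y$ is the identity. Morphisms are morphisms of $\mathcal{C}$ commuting with structure maps; the categories are $\mathcal{C}_C$ (comodules) and $\mathcal{C}^C$ (contramodules). Enrichment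 in $\mathcal{C}$: for comodules $X,Y$ the hom object $[X,Y]_C$ is the equaliser of $[X,Y]\xrightarrow{[X,\rho_Y]}[X,TY]$ and $[X,Y]\to[TX,TY]\xrightarrow{[\rho_X,TY]}[X,TY]$. For contramodules $X,Y$ the hom object $[X,Y]^C$ is the equaliser of $[X,Y]\to[FX,FY]\xrightarrow{[FX,\theta_Y]}[FX,Y]$ and $[X,Y]\xrightarrow{[\theta_X,Y]}[FX,Y]$. (These equalisers are of pairs with common left inverses.) Functor $R$: $R(X)=[C,X]_C$, where $C$ is a comodule via $\Delta$, with the contramodule structure for which $R(X)\to[C,X]$ is a contramodule map to the free contramodule $FX$. Functor $L$: $L(Y)$ is the coequaliser of the two maps $[C,Y]\otimes C\rightrightarrows Y\otimes C$ given by $\theta_Y\otimes 1$ and by $[C,Y]\otimes C\xrightarrow{1\otimes\Delta}[C,Y]\otimes C\otimes C\xrightarrow{\mathrm{ev}\otimes 1}Y\otimes C$, with the comodule structure for which $Y\otimes C\to L(Y)$ is a comodule map from the cofree comodule $TY$. An adjunction is $\mathcal{C}$-enriched if it is given by a $\mathcal{C}$-natural isomorphism $[LX,Y]_C\cong[X,RY]^C$ in $\mathcal{C}$. *)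

theory Defs
  imports Main
begin

section \<open>Categories\<close>

text \<open>
  Objects and arrows form sets inside types, so that a category need not exhaust a type; all
  operations are total in HOL and are only constrained on arguments of the right kind.
  Composition is written in applicative order: \<open>g \<cdot> f\<close> is \<open>f\<close> followed by \<open>g\<close>.
\<close>

record ('o, 'a) category =
  Obj :: "'o set"
  Arr :: "'a set"
  src :: "'a \<Rightarrow> 'o"
  trg :: "'a \<Rightarrow> 'o"
  ident :: "'o \<Rightarrow> 'a"  ("\<one>\<index>")
  cmp :: "'a \<Rightarrow> 'a \<Rightarrow> 'a"  (infixr "\<cdot>\<index>" 55)

definition hom_set :: "('o, 'a, 'm) category_scheme \<Rightarrow> 'o \<Rightarrow> 'o \<Rightarrow> 'a set"  ("hom\<index>")
  where "hom_set M X Y = {f \<in> Arr M. src M f = X \<and> trg M f = Y}"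

locale category =
  fixes M (structure)
  assumes src_in: "f \<in> Arr M \<Longrightarrow> src M f \<in> Obj M"
    and trg_in: "f \<in> Arr M \<Longrightarrow> trg M f \<in> Obj M"
    and ident_in: "X \<in> Obj M \<Longrightarrow> \<one> X \<in> hom X X"
    and cmp_in: "\<lbrakk>f \<in> hom X Y; g \<in> hom Y Z\<rbrakk> \<Longrightarrow> g \<cdot> f \<in> hom X Z"
    and cmp_assoc: "\<lbrakk>f \<in> hom X Y; g \<in> hom Y Z; h \<in> hom Z W\<rbrakk> \<Longrightarrow> (h \<cdot> g) \<cdot> f = h \<cdot> (g \<cdot> f)"
    and ident_left: "f \<in> hom X Y \<Longrightarrow> \<one> Y \<cdot> f = f"
    and ident_right: "f \<in> hom X Y \<Longrightarrow> f \<cdot> \<one> X = f"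

context
  fixes M :: "('o, 'a, 'm) category_scheme" (structure)
begin

definition inverse_arrows :: "'a \<Rightarrow> 'a \<Rightarrow> bool"
  where "inverse_arrows f g \<longleftrightarrow>
    f \<in> hom (src M f) (trg M f) \<and> g \<in> hom (trg M f) (src M f) \<and>
    g \<cdot> f = \<one> (src M f) \<and> f \<cdot> g = \<one> (trg M f)"

definition iso_arrow :: "'a \<Rightarrow> bool"
  where "iso_arrow f \<longleftrightarrow> (\<exists>g. inverse_arrows f g)"

definition inverse_arrow :: "'a \<Rightarrow> 'a"
  where "inverse_arrow f = (THE g. inverse_arrows f g)"

definition is_equaliser :: "'a \<Rightarrow> 'a \<Rightarrow> 'a \<Rightarrow> bool"
  where "is_equaliser f g e \<longleftrightarrow>
    e \<in> hom (src M e) (src M f) \<and> f \<cdot> e = g \<cdot> e \<and>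
    (\<forall>Z. \<forall>h \<in> hom Z (src M f). f \<cdot> h = g \<cdot> h \<longrightarrow> (\<exists>!k. k \<in> hom Z (src M e) \<and> e \<cdot> k = h))"

definition is_coequaliser :: "'a \<Rightarrow> 'a \<Rightarrow> 'a \<Rightarrow> bool"
  where "is_coequaliser f g q \<longleftrightarrow>
    q \<in> hom (trg M f) (trg M q) \<and> q \<cdot> f = q \<cdot> g \<and>
    (\<forall>Z. \<forall>h \<in> hom (trg M f) Z. h \<cdot> f = h \<cdot> g \<longrightarrow> (\<exists>!k. k \<in> hom (trg M q) Z \<and> k \<cdot> q = h))"

text \<open>
  The chosen (co)equaliser is an arrow; the (co)equaliser object is its source (target).
\<close>

definition equaliser :: "'a \<Rightarrow> 'a \<Rightarrow> 'a"
  where "equaliser f g = (SOME e. is_equaliser f g e)"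

definition coequaliser :: "'a \<Rightarrow> 'a \<Rightarrow> 'a"
  where "coequaliser f g = (SOME q. is_coequaliser f g q)"

text \<open>The unique factorisation of \<open>f\<close> through an arrow \<open>m\<close> (used for monic \<open>m\<close>).\<close>

definition factor_through :: "'a \<Rightarrow> 'a \<Rightarrow> 'a"
  where "factor_through m f = (THE h. h \<in> hom (src M f) (src M m) \<and> m \<cdot> h = f)"

end


section \<open>Closed symmetric monoidal categories\<close>

text \<open>The tensor product is \<open>\<otimes>\<close> on objects and \<open>\<odot>\<close> on arrows.\<close>

record ('o, 'a) symmetric_monoidal = "('o, 'a) category" +
  tensor :: "'o \<Rightarrow> 'o \<Rightarrow> 'o"  (infixr "\<otimes>\<index>" 70)
  tensor_arr :: "'a \<Rightarrow> 'a \<Rightarrow> 'a"  (infixr "\<odot>\<index>" 70)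
  unit :: "'o"  ("\<I>\<index>")
  asc :: "'o \<Rightarrow> 'o \<Rightarrow> 'o \<Rightarrow> 'a"
  lun :: "'o \<Rightarrow> 'a"
  run :: "'o \<Rightarrow> 'a"
  swap :: "'o \<Rightarrow> 'o \<Rightarrow> 'a"

locale symmetric_monoidal_category = category M for M (structure) +
  assumes tensor_in: "\<lbrakk>X \<in> Obj M; Y \<in> Obj M\<rbrakk> \<Longrightarrow> X \<otimes> Y \<in> Obj M"
    and tensor_arr_in:
      "\<lbrakk>f \<in> hom X X'; g \<in> hom Y Y'\<rbrakk> \<Longrightarrow> f \<odot> g \<in> hom (X \<otimes> Y) (X' \<otimes> Y')"
    and tensor_ident: "\<lbrakk>X \<in> Obj M; Y \<in> Obj M\<rbrakk> \<Longrightarrow> \<one> X \<odot> \<one> Y = \<one> (X \<otimes> Y)"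
    and tensor_cmp:
      "\<lbrakk>f \<in> hom X X'; f' \<in> hom X' X''; g \<in> hom Y Y'; g' \<in> hom Y' Y''\<rbrakk>
        \<Longrightarrow> (f' \<cdot> f) \<odot> (g' \<cdot> g) = (f' \<odot> g') \<cdot> (f \<odot> g)"
    and unit_in: "\<I> \<in> Obj M"
    and asc_in:
      "\<lbrakk>X \<in> Obj M; Y \<in> Obj M; Z \<in> Obj M\<rbrakk> \<Longrightarrow> asc M X Y Z \<in> hom ((X \<otimes> Y) \<otimes> Z) (X \<otimes> (Y \<otimes> Z))"
    and asc_iso: "\<lbrakk>X \<in> Obj M; Y \<in> Obj M; Z \<in> Obj M\<rbrakk> \<Longrightarrow> iso_arrow M (asc M X Y Z)"
    and asc_natural:
      "\<lbrakk>f \<in> hom X X'; g \<in> hom Y Y'; h \<in> hom Z Z'\<rbrakk>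
        \<Longrightarrow> asc M X' Y' Z' \<cdot> ((f \<odot> g) \<odot> h) = (f \<odot> (g \<odot> h)) \<cdot> asc M X Y Z"
    and lun_in: "X \<in> Obj M \<Longrightarrow> lun M X \<in> hom (\<I> \<otimes> X) X"
    and lun_iso: "X \<in> Obj M \<Longrightarrow> iso_arrow M (lun M X)"
    and lun_natural: "f \<in> hom X Y \<Longrightarrow> lun M Y \<cdot> (\<one> \<I> \<odot> f) = f \<cdot> lun M X"
    and run_in: "X \<in> Obj M \<Longrightarrow> run M X \<in> hom (X \<otimes> \<I>) X"
    and run_iso: "X \<in> Obj M \<Longrightarrow> iso_arrow M (run M X)"
    and run_natural: "f \<in> hom X Y \<Longrightarrow> run M Y \<cdot> (f \<odot> \<one> \<I>) = f \<cdot> run M X"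
    and pentagon:
      "\<lbrakk>W \<in> Obj M; X \<in> Obj M; Y \<in> Obj M; Z \<in> Obj M\<rbrakk>
        \<Longrightarrow> asc M W X (Y \<otimes> Z) \<cdot> asc M (W \<otimes> X) Y Z
          = (\<one> W \<odot> asc M X Y Z) \<cdot> asc M W (X \<otimes> Y) Z \<cdot> (asc M W X Y \<odot> \<one> Z)"
    and triangle:
      "\<lbrakk>X \<in> Obj M; Y \<in> Obj M\<rbrakk> \<Longrightarrow> (\<one> X \<odot> lun M Y) \<cdot> asc M X \<I> Y = run M X \<odot> \<one> Y"
    and swap_in: "\<lbrakk>X \<in> Obj M; Y \<in> Obj M\<rbrakk> \<Longrightarrow> swap M X Y \<in> hom (X \<otimes> Y) (Y \<otimes> X)"
    and swap_natural:
      "\<lbrakk>f \<in> hom X X'; g \<in> hom Y Y'\<rbrakk> \<Longrightarrow> swap M X' Y' \<cdot> (f \<odot> g) = (g \<odot> f) \<cdot> swap M X Y"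
    and swap_swap: "\<lbrakk>X \<in> Obj M; Y \<in> Obj M\<rbrakk> \<Longrightarrow> swap M Y X \<cdot> swap M X Y = \<one> (X \<otimes> Y)"
    and hexagon:
      "\<lbrakk>X \<in> Obj M; Y \<in> Obj M; Z \<in> Obj M\<rbrakk>
        \<Longrightarrow> asc M Y Z X \<cdot> swap M X (Y \<otimes> Z) \<cdot> asc M X Y Z
          = (\<one> Y \<odot> swap M X Z) \<cdot> asc M Y X Z \<cdot> (swap M X Y \<odot> \<one> Z)"

text \<open>
  The internal hom \<open>\<lbrakk>X, Y\<rbrakk>\<close> is given, as right adjoint to \<open>- \<otimes> X\<close>, by the universal
  arrow \<open>ev X Y : \<lbrakk>X, Y\<rbrakk> \<otimes> X \<rightarrow> Y\<close>.
\<close>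

record ('o, 'a) closed_symmetric_monoidal = "('o, 'a) symmetric_monoidal" +
  ihom :: "'o \<Rightarrow> 'o \<Rightarrow> 'o"  ("\<lbrakk>_,/ _\<rbrakk>\<index>")
  ev :: "'o \<Rightarrow> 'o \<Rightarrow> 'a"

locale closed_symmetric_monoidal_category = symmetric_monoidal_category M for M (structure) +
  assumes ihom_in: "\<lbrakk>X \<in> Obj M; Y \<in> Obj M\<rbrakk> \<Longrightarrow> \<lbrakk>X, Y\<rbrakk> \<in> Obj M"
    and ev_in: "\<lbrakk>X \<in> Obj M; Y \<in> Obj M\<rbrakk> \<Longrightarrow> ev M X Y \<in> hom (\<lbrakk>X, Y\<rbrakk> \<otimes> X) Y"
    and ev_universal:
      "\<lbrakk>X \<in> Obj M; Y \<in> Obj M; Z \<in> Obj M; f \<in> hom (Z \<otimes> X) Y\<rbrakk>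
        \<Longrightarrow> \<exists>!g. g \<in> hom Z \<lbrakk>X, Y\<rbrakk> \<and> ev M X Y \<cdot> (g \<odot> \<one> X) = f"

context
  fixes M :: "('o, 'a, 'm) closed_symmetric_monoidal_scheme" (structure)
begin

text \<open>The transpose \<open>Z \<rightarrow> \<lbrakk>X, Y\<rbrakk>\<close> of \<open>f : Z \<otimes> X \<rightarrow> Y\<close>.\<close>

definition transpose :: "'o \<Rightarrow> 'o \<Rightarrow> 'o \<Rightarrow> 'a \<Rightarrow> 'a"
  where "transpose Z X Y f = (THE g. g \<in> hom Z \<lbrakk>X, Y\<rbrakk> \<and> ev M X Y \<cdot> (g \<odot> \<one> X) = f)"

text \<open>
  For \<open>g : Y \<rightarrow> Y'\<close> and \<open>f : X' \<rightarrow> X\<close>, these are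
  \<open>\<lbrakk>X, g\<rbrakk> : \<lbrakk>X, Y\<rbrakk> \<rightarrow> \<lbrakk>X, Y'\<rbrakk>\<close> and \<open>\<lbrakk>f, Y\<rbrakk> : \<lbrakk>X, Y\<rbrakk> \<rightarrow> \<lbrakk>X', Y\<rbrakk>\<close>.
\<close>

definition ihom_post :: "'o \<Rightarrow> 'a \<Rightarrow> 'a"
  where "ihom_post X g =
    transpose \<lbrakk>X, src M g\<rbrakk> X (trg M g) (g \<cdot> ev M X (src M g))"

definition ihom_pre :: "'a \<Rightarrow> 'o \<Rightarrow> 'a"
  where "ihom_pre f Y =
    transpose \<lbrakk>trg M f, Y\<rbrakk> (src M f) Y (ev M (trg M f) Y \<cdot> (\<one> \<lbrakk>trg M f, Y\<rbrakk> \<odot> f))"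

definition ihom_ident :: "'o \<Rightarrow> 'a"
  where "ihom_ident X = transpose \<I> X X (lun M X)"

definition ihom_cmp :: "'o \<Rightarrow> 'o \<Rightarrow> 'o \<Rightarrow> 'a"
  where "ihom_cmp X Y Z =
    transpose (\<lbrakk>Y, Z\<rbrakk> \<otimes> \<lbrakk>X, Y\<rbrakk>) X Z
      (ev M Y Z \<cdot> (\<one> \<lbrakk>Y, Z\<rbrakk> \<odot> ev M X Y) \<cdot> asc M \<lbrakk>Y, Z\<rbrakk> \<lbrakk>X, Y\<rbrakk> X)"

text \<open>The canonical isomorphisms \<open>\<lbrakk>X, \<lbrakk>Y, Z\<rbrakk>\<rbrakk> \<rightarrow> \<lbrakk>X \<otimes> Y, Z\<rbrakk>\<close> and \<open>Y \<rightarrow> \<lbrakk>\<I>, Y\<rbrakk>\<close>.\<close>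

definition ihom_uncurry :: "'o \<Rightarrow> 'o \<Rightarrow> 'o \<Rightarrow> 'a"
  where "ihom_uncurry X Y Z =
    transpose \<lbrakk>X, \<lbrakk>Y, Z\<rbrakk>\<rbrakk> (X \<otimes> Y) Z
      (ev M Y Z \<cdot> (ev M X \<lbrakk>Y, Z\<rbrakk> \<odot> \<one> Y) \<cdot> inverse_arrow M (asc M \<lbrakk>X, \<lbrakk>Y, Z\<rbrakk>\<rbrakk> X Y))"

definition ihom_unit :: "'o \<Rightarrow> 'a"
  where "ihom_unit Y = transpose Y \<I> Y (run M Y)"

end


section \<open>Enriched categories, functors and adjunctions\<close>

record ('x, 'o, 'a) enriched =
  eobj :: "'x set"
  ehom :: "'x \<Rightarrow> 'x \<Rightarrow> 'o"
  eident :: "'x \<Rightarrow> 'a"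
  ecmp :: "'x \<Rightarrow> 'x \<Rightarrow> 'x \<Rightarrow> 'a"

record ('x, 'y, 'a) efunctor =
  fobj :: "'x \<Rightarrow> 'y"
  fhom :: "'x \<Rightarrow> 'x \<Rightarrow> 'a"

context
  fixes M :: "('o, 'a, 'm) symmetric_monoidal_scheme" (structure)
begin

definition enriched_category :: "('x, 'o, 'a) enriched \<Rightarrow> bool"
  where "enriched_category A \<longleftrightarrow>
    (\<forall>X \<in> eobj A. \<forall>Y \<in> eobj A. ehom A X Y \<in> Obj M) \<and>
    (\<forall>X \<in> eobj A. eident A X \<in> hom \<I> (ehom A X X)) \<and>
    (\<forall>X \<in> eobj A. \<forall>Y \<in> eobj A. \<forall>Z \<in> eobj A.
      ecmp A X Y Z \<in> hom (ehom A Y Z \<otimes> ehom A X Y) (ehom A X Z)) \<and>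
    (\<forall>W \<in> eobj A. \<forall>X \<in> eobj A. \<forall>Y \<in> eobj A. \<forall>Z \<in> eobj A.
      ecmp A W X Z \<cdot> (ecmp A X Y Z \<odot> \<one> (ehom A W X))
      = ecmp A W Y Z \<cdot> (\<one> (ehom A Y Z) \<odot> ecmp A W X Y)
          \<cdot> asc M (ehom A Y Z) (ehom A X Y) (ehom A W X)) \<and>
    (\<forall>X \<in> eobj A. \<forall>Y \<in> eobj A.
      ecmp A X Y Y \<cdot> (eident A Y \<odot> \<one> (ehom A X Y)) = lun M (ehom A X Y) \<and>
      ecmp A X X Y \<cdot> (\<one> (ehom A X Y) \<odot> eident A X) = run M (ehom A X Y))"

definition enriched_functor ::
    "('x, 'o, 'a) enriched \<Rightarrow> ('y, 'o, 'a) enriched \<Rightarrow> ('x, 'y, 'a) efunctor \<Rightarrow> bool"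
  where "enriched_functor A B F \<longleftrightarrow>
    enriched_category A \<and> enriched_category B \<and>
    (\<forall>X \<in> eobj A. fobj F X \<in> eobj B) \<and>
    (\<forall>X \<in> eobj A. \<forall>Y \<in> eobj A.
      fhom F X Y \<in> hom (ehom A X Y) (ehom B (fobj F X) (fobj F Y))) \<and>
    (\<forall>X \<in> eobj A. fhom F X X \<cdot> eident A X = eident B (fobj F X)) \<and>
    (\<forall>X \<in> eobj A. \<forall>Y \<in> eobj A. \<forall>Z \<in> eobj A.
      fhom F X Z \<cdot> ecmp A X Y Z
      = ecmp B (fobj F X) (fobj F Y) (fobj F Z) \<cdot> (fhom F Y Z \<odot> fhom F X Y))"

text \<open>
  A family \<open>\<phi> X Y : B(L X, Y) \<rightarrow> A(X, R Y)\<close> is enriched natural if it commutes with the actions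
  of \<open>B(Y, Y')\<close> and \<open>A(X', X)\<close> on both sides.  These two squares are the transposes of the
  naturality squares for the enriched functors with values in the base category that
  \<open>B(L -, -)\<close> and \<open>A(-, R -)\<close> induce in each variable.
\<close>

definition enriched_hom_natural ::
    "('x, 'o, 'a) enriched \<Rightarrow> ('y, 'o, 'a) enriched \<Rightarrow> ('x, 'y, 'a) efunctor \<Rightarrow>
      ('y, 'x, 'a) efunctor \<Rightarrow> ('x \<Rightarrow> 'y \<Rightarrow> 'a) \<Rightarrow> bool"
  where "enriched_hom_natural A B L R \<phi> \<longleftrightarrow>
    (\<forall>X \<in> eobj A. \<forall>Y \<in> eobj B.
      \<phi> X Y \<in> hom (ehom B (fobj L X) Y) (ehom A X (fobj R Y))) \<and>
    (\<forall>X \<in> eobj A. \<forall>Y \<in> eobj B. \<forall>Y' \<in> eobj B.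
      \<phi> X Y' \<cdot> ecmp B (fobj L X) Y Y'
      = ecmp A X (fobj R Y) (fobj R Y') \<cdot> (fhom R Y Y' \<odot> \<phi> X Y)) \<and>
    (\<forall>X \<in> eobj A. \<forall>X' \<in> eobj A. \<forall>Y \<in> eobj B.
      \<phi> X' Y \<cdot> ecmp B (fobj L X') (fobj L X) Y \<cdot> (\<one> (ehom B (fobj L X) Y) \<odot> fhom L X' X)
      = ecmp A X' X (fobj R Y) \<cdot> (\<phi> X Y \<odot> \<one> (ehom A X' X)))"

definition enriched_adjunction ::
    "('x, 'o, 'a) enriched \<Rightarrow> ('y, 'o, 'a) enriched \<Rightarrow> ('x, 'y, 'a) efunctor \<Rightarrow>
      ('y, 'x, 'a) efunctor \<Rightarrow> bool"
  where "enriched_adjunction A B L R \<longleftrightarrow>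
    enriched_functor A B L \<and> enriched_functor B A R \<and>
    (\<exists>\<phi>. enriched_hom_natural A B L R \<phi> \<and>
      (\<forall>X \<in> eobj A. \<forall>Y \<in> eobj B. iso_arrow M (\<phi> X Y)))"

end


section \<open>Comodules and contramodules over a comonoid\<close>

record ('o, 'a) comonoid =
  carr :: 'o
  comult :: 'a
  counit :: 'a

text \<open>
  A comodule or contramodule is a pair of an object and its structure arrow.
\<close>

context
  fixes M :: "('o, 'a, 'm) closed_symmetric_monoidal_scheme" (structure)
    and C :: "('o, 'a) comonoid"
begin

definition comonoid :: bool
  where "comonoid \<longleftrightarrow>
    carr C \<in> Obj M \<and>
    comult C \<in> hom (carr C) (carr C \<otimes> carr C) \<and>
    counit C \<in> hom (carr C) \<I> \<and>
    asc M (carr C) (carr C) (carr C) \<cdot> (comult C \<odot> \<one> (carr C)) \<cdot> comult C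
      = (\<one> (carr C) \<odot> comult C) \<cdot> comult C \<and>
    lun M (carr C) \<cdot> (counit C \<odot> \<one> (carr C)) \<cdot> comult C = \<one> (carr C) \<and>
    run M (carr C) \<cdot> (\<one> (carr C) \<odot> counit C) \<cdot> comult C = \<one> (carr C)"

definition comodule :: "'o \<times> 'a \<Rightarrow> bool"
  where "comodule = (\<lambda>(X, \<rho>).
    X \<in> Obj M \<and> \<rho> \<in> hom X (X \<otimes> carr C) \<and>
    asc M X (carr C) (carr C) \<cdot> (\<rho> \<odot> \<one> (carr C)) \<cdot> \<rho> = (\<one> X \<odot> comult C) \<cdot> \<rho> \<and>
    run M X \<cdot> (\<one> X \<odot> counit C) \<cdot> \<rho> = \<one> X)"

definition comodule_map :: "'o \<times> 'a \<Rightarrow> 'o \<times> 'a \<Rightarrow> 'a \<Rightarrow> bool"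
  where "comodule_map = (\<lambda>(X, \<rho>) (Y, \<sigma>) f. f \<in> hom X Y \<and> \<sigma> \<cdot> f = (f \<odot> \<one> (carr C)) \<cdot> \<rho>)"

definition contramodule :: "'o \<times> 'a \<Rightarrow> bool"
  where "contramodule = (\<lambda>(Y, \<theta>).
    Y \<in> Obj M \<and> \<theta> \<in> hom \<lbrakk>carr C, Y\<rbrakk> Y \<and>
    \<theta> \<cdot> ihom_post M (carr C) \<theta>
      = \<theta> \<cdot> ihom_pre M (comult C) Y \<cdot> ihom_uncurry M (carr C) (carr C) Y \<and>
    \<theta> \<cdot> ihom_pre M (counit C) Y \<cdot> ihom_unit M Y = \<one> Y)"

definition contramodule_map :: "'o \<times> 'a \<Rightarrow> 'o \<times> 'a \<Rightarrow> 'a \<Rightarrow> bool"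
  where "contramodule_map = (\<lambda>(X, \<theta>) (Y, \<pi>) f.
    f \<in> hom X Y \<and> f \<cdot> \<theta> = \<pi> \<cdot> ihom_post M (carr C) f)"

definition cofree_comodule :: "'o \<Rightarrow> 'o \<times> 'a"
  where "cofree_comodule X =
    (X \<otimes> carr C, inverse_arrow M (asc M X (carr C) (carr C)) \<cdot> (\<one> X \<odot> comult C))"

definition free_contramodule :: "'o \<Rightarrow> 'o \<times> 'a"
  where "free_contramodule X =
    (\<lbrakk>carr C, X\<rbrakk>, ihom_pre M (comult C) X \<cdot> ihom_uncurry M (carr C) (carr C) X)"

text \<open>
  The enriched actions \<open>\<lbrakk>X, Y\<rbrakk> \<rightarrow> \<lbrakk>T X, T Y\<rbrakk>\<close> and \<open>\<lbrakk>X, Y\<rbrakk> \<rightarrow> \<lbrakk>F X, F Y\<rbrakk>\<close> of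
  \<open>T X = X \<otimes> C\<close> and \<open>F X = \<lbrakk>C, X\<rbrakk>\<close>.
\<close>

definition T_act :: "'o \<Rightarrow> 'o \<Rightarrow> 'a"
  where "T_act X Y = transpose M \<lbrakk>X, Y\<rbrakk> (X \<otimes> carr C) (Y \<otimes> carr C)
    ((ev M X Y \<odot> \<one> (carr C)) \<cdot> inverse_arrow M (asc M \<lbrakk>X, Y\<rbrakk> X (carr C)))"

definition F_act :: "'o \<Rightarrow> 'o \<Rightarrow> 'a"
  where "F_act X Y =
    transpose M \<lbrakk>X, Y\<rbrakk> \<lbrakk>carr C, X\<rbrakk> \<lbrakk>carr C, Y\<rbrakk> (ihom_cmp M (carr C) X Y)"

text \<open>
  The equaliser arrows \<open>\<lbrakk>X, Y\<rbrakk>\<^sub>C \<rightarrow> \<lbrakk>X, Y\<rbrakk>\<close> and \<open>\<lbrakk>X, Y\<rbrakk>\<^sup>C \<rightarrow> \<lbrakk>X, Y\<rbrakk>\<close>; the enriched hom objects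
  are their sources.
\<close>

definition comod_incl :: "'o \<times> 'a \<Rightarrow> 'o \<times> 'a \<Rightarrow> 'a"
  where "comod_incl = (\<lambda>(X, \<rho>) (Y, \<sigma>).
    equaliser M (ihom_post M X \<sigma>) (ihom_pre M \<rho> (Y \<otimes> carr C) \<cdot> T_act X Y))"

definition contra_incl :: "'o \<times> 'a \<Rightarrow> 'o \<times> 'a \<Rightarrow> 'a"
  where "contra_incl = (\<lambda>(X, \<theta>) (Y, \<pi>).
    equaliser M (ihom_post M \<lbrakk>carr C, X\<rbrakk> \<pi> \<cdot> F_act X Y) (ihom_pre M \<theta> Y))"

definition comod_hom :: "'o \<times> 'a \<Rightarrow> 'o \<times> 'a \<Rightarrow> 'o"
  where "comod_hom X Y = src M (comod_incl X Y)"

definition contra_hom :: "'o \<times> 'a \<Rightarrow> 'o \<times> 'a \<Rightarrow> 'o"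
  where "contra_hom X Y = src M (contra_incl X Y)"

text \<open>Identities and composition are those of the internal hom, restricted to the subobjects.\<close>

definition comod_cat :: "('o \<times> 'a, 'o, 'a) enriched"
  where "comod_cat =
    \<lparr>eobj = {X. comodule X},
     ehom = comod_hom,
     eident = (\<lambda>X. factor_through M (comod_incl X X) (ihom_ident M (fst X))),
     ecmp = (\<lambda>X Y Z. factor_through M (comod_incl X Z)
       (ihom_cmp M (fst X) (fst Y) (fst Z) \<cdot> (comod_incl Y Z \<odot> comod_incl X Y)))\<rparr>"

definition contra_cat :: "('o \<times> 'a, 'o, 'a) enriched"
  where "contra_cat =
    \<lparr>eobj = {X. contramodule X},
     ehom = contra_hom,
     eident = (\<lambda>X. factor_through M (contra_incl X X) (ihom_ident M (fst X))),
     ecmp = (\<lambda>X Y Z. factor_through M (contra_incl X Z)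
       (ihom_cmp M (fst X) (fst Y) (fst Z) \<cdot> (contra_incl Y Z \<odot> contra_incl X Y)))\<rparr>"


subsection \<open>The functors\<close>

definition R_incl :: "'o \<times> 'a \<Rightarrow> 'a"
  where "R_incl X = comod_incl (carr C, comult C) X"

definition R_obj :: "'o \<times> 'a \<Rightarrow> 'o \<times> 'a"
  where "R_obj X =
    (src M (R_incl X),
     THE \<theta>. contramodule (src M (R_incl X), \<theta>) \<and>
       contramodule_map (src M (R_incl X), \<theta>) (free_contramodule (fst X)) (R_incl X))"

definition L_proj :: "'o \<times> 'a \<Rightarrow> 'a"
  where "L_proj = (\<lambda>(Y, \<theta>).
    coequaliser M (\<theta> \<odot> \<one> (carr C))
      ((ev M (carr C) Y \<odot> \<one> (carr C)) \<cdot> inverse_arrow M (asc M \<lbrakk>carr C, Y\<rbrakk> (carr C) (carr C))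
        \<cdot> (\<one> \<lbrakk>carr C, Y\<rbrakk> \<odot> comult C)))"

definition L_obj :: "'o \<times> 'a \<Rightarrow> 'o \<times> 'a"
  where "L_obj Y =
    (trg M (L_proj Y),
     THE \<rho>. comodule (trg M (L_proj Y), \<rho>) \<and>
       comodule_map (cofree_comodule (fst Y)) (trg M (L_proj Y), \<rho>) (L_proj Y))"

text \<open>
  The action of \<open>R\<close> on hom objects is the restriction of \<open>\<lbrakk>X, Y\<rbrakk> \<rightarrow> \<lbrakk>F X, F Y\<rbrakk>\<close> along
  \<open>R X \<rightarrow> F X\<close> and \<open>R Y \<rightarrow> F Y\<close>: the composites
  \<open>\<lbrakk>X, Y\<rbrakk>\<^sub>C \<rightarrow> \<lbrakk>R X, R Y\<rbrakk>\<^sup>C \<rightarrow> \<lbrakk>R X, R Y\<rbrakk> \<rightarrow> \<lbrakk>R X, F Y\<rbrakk>\<close> and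
  \<open>\<lbrakk>X, Y\<rbrakk>\<^sub>C \<rightarrow> \<lbrakk>X, Y\<rbrakk> \<rightarrow> \<lbrakk>F X, F Y\<rbrakk> \<rightarrow> \<lbrakk>R X, F Y\<rbrakk>\<close> agree.  Dually, the action of \<open>L\<close> is induced
  by \<open>\<lbrakk>X, Y\<rbrakk> \<rightarrow> \<lbrakk>T X, T Y\<rbrakk>\<close> along \<open>T X \<rightarrow> L X\<close> and \<open>T Y \<rightarrow> L Y\<close>.
\<close>

definition R_hom :: "'o \<times> 'a \<Rightarrow> 'o \<times> 'a \<Rightarrow> 'a"
  where "R_hom X Y =
    (THE h. h \<in> hom (comod_hom X Y) (contra_hom (R_obj X) (R_obj Y)) \<and>
      ihom_post M (fst (R_obj X)) (R_incl Y) \<cdot> contra_incl (R_obj X) (R_obj Y) \<cdot> h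
      = ihom_pre M (R_incl X) \<lbrakk>carr C, fst Y\<rbrakk> \<cdot> F_act (fst X) (fst Y) \<cdot> comod_incl X Y)"

definition L_hom :: "'o \<times> 'a \<Rightarrow> 'o \<times> 'a \<Rightarrow> 'a"
  where "L_hom X Y =
    (THE h. h \<in> hom (contra_hom X Y) (comod_hom (L_obj X) (L_obj Y)) \<and>
      ihom_pre M (L_proj X) (fst (L_obj Y)) \<cdot> comod_incl (L_obj X) (L_obj Y) \<cdot> h
      = ihom_post M (fst X \<otimes> carr C) (L_proj Y) \<cdot> T_act (fst X) (fst Y) \<cdot> contra_incl X Y)"

definition R_functor :: "('o \<times> 'a, 'o \<times> 'a, 'a) efunctor"
  where "R_functor = \<lparr>fobj = R_obj, fhom = R_hom\<rparr>"

definition L_functor :: "('o \<times> 'a, 'o \<times> 'a, 'a) efunctor"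
  where "L_functor = \<lparr>fobj = L_obj, fhom = L_hom\<rparr>"

end

end

(*
  An arrow Z -> [X, Y] is a parametrised map Z * X -> Y, so an arrow into a hom object of
  comodules or of contramodules is a parametrised map compatible with the structure arrows.
  All identities between arrows into hom objects can therefore be tested on parametrised maps.

  Write TX = X * C.  A parametrised comodule map Z * L x -> y is, by precomposition with the
  coequaliser TX -> L x (preserved by Z * -, which is a left adjoint), a comodule map
  u : T(Z * X) -> y from the cofree comodule that is compatible with the contra-action of x.  A
  parametrised contramodule map Z * x -> R y is, by transposing Z * X -> R y -> [C, Y], also a
  comodule map u : T(Z * X) -> y, and the compatibility of u with the contra-action is literally
  the same equation ("balanced" below).  The bijection is natural in Z, hence comes from an
  isomorphism of hom objects; the functors L and R and the naturality squares are likewise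
  determined by their effect on u.
*)
theory Submission
  imports Defs
begin

section \<open>Closed symmetric monoidal categories\<close>

text \<open>Parameters stand on the left of a tensor product and C on the right. Hence
  \<open>Z \<otimes> T X\<close> and \<open>T (Z \<otimes> X)\<close> differ by an associator, and
  \<open>Z \<otimes> x\<close> is again a comodule. For F there is only a one-way strength
  \<open>Z \<otimes> F X \<rightarrow> F (Z \<otimes> X)\<close>, so \<open>Z \<otimes> x\<close>
  has no evident contramodule structure; this asymmetry is why parametrised contramodule maps into
  \<open>R y\<close> are studied through u. Equalisers and coequalisers are available only for pairs
  with a common one-sided inverse: the counit of T supplies it for comodule homs, the unit of F for
  contramodule homs and for L. The structure arrows of \<open>L x\<close> and \<open>R y\<close> and
  the actions on hom objects are definite descriptions, so existence and uniqueness must be settled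
  before they can be used; uniqueness comes from cancelling a coequaliser or an equaliser. Under
  uncurrying, the monad laws of F become comonad laws of its left adjoint T, and the enriched axioms
  become coherence of associators and unitors.\<close>

context category
begin

text \<open>The objects at both ends belong to the right-hand side, so unfolding a typing hypothesis
  also yields the side conditions of the simplification rules below.\<close>

lemma hom_iff:
  "f \<in> hom X Y \<longleftrightarrow> f \<in> Arr M \<and> src M f = X \<and> trg M f = Y \<and> X \<in> Obj M \<and> Y \<in> Obj M"
  using src_in trg_in by (auto simp: hom_set_def)

lemma arr_hom: "f \<in> Arr M \<Longrightarrow> f \<in> hom (src M f) (trg M f)"
  by (simp add: hom_set_def)

lemma ident_simps [simp]:
  assumes "X \<in> Obj M"
  shows "\<one> X \<in> Arr M" "src M (\<one> X) = X" "trg M (\<one> X) = X"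
  using ident_in[OF assms] by (auto simp: hom_set_def)

lemma cmp_simps [simp]:
  assumes "f \<in> Arr M" "g \<in> Arr M" "src M g = trg M f"
  shows "g \<cdot> f \<in> Arr M" "src M (g \<cdot> f) = src M f" "trg M (g \<cdot> f) = trg M g"
  using cmp_in[of f "src M f" "trg M f" g "trg M g"] assms by (auto simp: hom_set_def)

lemma src_trg_in [simp]:
  assumes "f \<in> Arr M" shows "src M f \<in> Obj M" "trg M f \<in> Obj M"
  using assms src_in trg_in by auto

lemma cmp_assoc' [simp]:
  "\<lbrakk>f \<in> Arr M; g \<in> Arr M; h \<in> Arr M; src M g = trg M f; src M h = trg M g\<rbrakk>
    \<Longrightarrow> (h \<cdot> g) \<cdot> f = h \<cdot> g \<cdot> f"
  by (rule cmp_assoc) (auto simp: hom_set_def)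

lemma ident_cmp [simp]:
  "\<lbrakk>f \<in> Arr M; trg M f = X\<rbrakk> \<Longrightarrow> \<one> X \<cdot> f = f"
  "\<lbrakk>f \<in> Arr M; src M f = X\<rbrakk> \<Longrightarrow> f \<cdot> \<one> X = f"
  using ident_left[of f "src M f" X] ident_right[of f X "trg M f"] by (auto simp: hom_set_def)

text \<open>The simplifier nests composites to the right, where a two-factor equation followed by a
  further arrow is no longer a subterm. This restores the equation in that position; rules such as
  \<open>asc_nat_post\<close> are variants of this kind.\<close>

lemma cmp_cong_post:
  assumes "f \<cdot> g = f' \<cdot> g'" "f \<in> Arr M" "g \<in> Arr M" "f' \<in> Arr M" "g' \<in> Arr M" "h \<in> Arr M"
    "src M f = trg M g" "src M f' = trg M g'" "src M g = trg M h" "src M g' = trg M h"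
  shows "f \<cdot> g \<cdot> h = f' \<cdot> g' \<cdot> h"
  using assms by (metis cmp_assoc')

lemma inverse_arrows_unique:
  assumes "inverse_arrows M f g" "inverse_arrows M f g'"
  shows "g' = g"
proof -
  have g: "g \<in> hom (trg M f) (src M f)" "g' \<in> hom (trg M f) (src M f)" "f \<in> hom (src M f) (trg M f)"
    using assms by (auto simp: inverse_arrows_def)
  have "g' = g' \<cdot> f \<cdot> g"
    using assms g by (simp add: inverse_arrows_def hom_iff)
  also have "\<dots> = (g' \<cdot> f) \<cdot> g"
    using g by (simp add: hom_iff)
  also have "\<dots> = g"
    using assms g by (simp add: inverse_arrows_def hom_iff)
  finally show ?thesis .
qed

lemma inverse_arrow:
  assumes "iso_arrow M f"
  shows "inverse_arrows M f (inverse_arrow M f)"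
proof -
  obtain g where "inverse_arrows M f g"
    using assms by (auto simp: iso_arrow_def)
  then show ?thesis
    unfolding inverse_arrow_def using inverse_arrows_unique by (metis theI)
qed

lemma iso_arrowI:
  assumes "f \<in> hom X Y" "g \<in> hom Y X" "g \<cdot> f = \<one> X" "f \<cdot> g = \<one> Y"
  shows "iso_arrow M f"
  using assms by (auto simp: iso_arrow_def inverse_arrows_def hom_set_def)

lemma iso_arrow_monic:
  assumes "iso_arrow M f" "f \<in> hom X Y" "g \<in> hom Z X" "h \<in> hom Z X" "f \<cdot> g = f \<cdot> h"
  shows "g = h"
proof -
  let ?f = "inverse_arrow M f"
  have f: "?f \<in> hom Y X" "?f \<cdot> f = \<one> X"
    using inverse_arrow[OF assms(1)] assms(2) by (auto simp: inverse_arrows_def hom_iff)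
  have "?f \<cdot> f \<cdot> g = ?f \<cdot> f \<cdot> h"
    using assms by simp
  then show ?thesis
    using f assms(2-4) by (simp add: hom_iff flip: cmp_assoc')
qed

lemma iso_arrow_epic:
  assumes "iso_arrow M f" "f \<in> hom X Y" "g \<in> hom Y Z" "h \<in> hom Y Z" "g \<cdot> f = h \<cdot> f"
  shows "g = h"
proof -
  let ?f = "inverse_arrow M f"
  have f: "?f \<in> hom Y X" "f \<cdot> ?f = \<one> Y"
    using inverse_arrow[OF assms(1)] assms(2) by (auto simp: inverse_arrows_def hom_iff)
  have "(g \<cdot> f) \<cdot> ?f = (h \<cdot> f) \<cdot> ?f"
    using assms by simp
  then show ?thesis
    using f assms(2-4) by (simp add: hom_iff)
qed

lemma factor_through:
  assumes "m \<in> hom Y X" "f \<in> hom Z X" "\<exists>h \<in> hom Z Y. m \<cdot> h = f"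
    and mono: "\<And>h h'. \<lbrakk>h \<in> hom Z Y; h' \<in> hom Z Y; m \<cdot> h = m \<cdot> h'\<rbrakk> \<Longrightarrow> h = h'"
  shows "factor_through M m f \<in> hom Z Y" "m \<cdot> factor_through M m f = f"
proof -
  have s: "src M m = Y" "src M f = Z"
    using assms by (auto simp: hom_iff)
  have "\<exists>!h. h \<in> hom Z Y \<and> m \<cdot> h = f"
    using assms(3) mono by (metis (no_types))
  from theI'[OF this] show "factor_through M m f \<in> hom Z Y" "m \<cdot> factor_through M m f = f"
    unfolding factor_through_def s by auto
qed

lemma equaliser_monic:
  assumes "is_equaliser M f g e" "f \<in> hom X Y" "g \<in> hom X Y"
    "h \<in> hom Z (src M e)" "h' \<in> hom Z (src M e)" "e \<cdot> h = e \<cdot> h'"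
  shows "h = h'"
proof -
  have e: "e \<in> hom (src M e) X" "f \<cdot> e = g \<cdot> e"
    using assms by (auto simp: is_equaliser_def hom_iff)
  have "f \<cdot> e \<cdot> h' = g \<cdot> e \<cdot> h'"
    by (rule cmp_cong_post) (use e assms in \<open>auto simp: hom_iff\<close>)
  moreover have "e \<cdot> h' \<in> hom Z (src M f)"
    using e assms by (simp add: hom_iff)
  ultimately have "\<exists>!k. k \<in> hom Z (src M e) \<and> e \<cdot> k = e \<cdot> h'"
    using assms(1) unfolding is_equaliser_def by blast
  then show ?thesis
    using assms(4-6) by metis
qed

lemma equaliser_factor:
  assumes "is_equaliser M f g e" "f \<in> hom X Y" "h \<in> hom Z X" "f \<cdot> h = g \<cdot> h"
  shows "\<exists>k \<in> hom Z (src M e). e \<cdot> k = h"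
proof -
  have "src M f = X"
    using assms(2) by (simp add: hom_iff)
  then show ?thesis
    using assms unfolding is_equaliser_def by blast
qed

lemma coequaliser_factor:
  assumes "is_coequaliser M f g q" "f \<in> hom X Y" "h \<in> hom Y Z" "h \<cdot> f = h \<cdot> g"
  shows "\<exists>k \<in> hom (trg M q) Z. k \<cdot> q = h"
proof -
  have "trg M f = Y"
    using assms(2) by (simp add: hom_iff)
  then show ?thesis
    using assms unfolding is_coequaliser_def by blast
qed

lemma coequaliser_epic:
  assumes "is_coequaliser M f g q" "f \<in> hom X Y" "g \<in> hom X Y"
    "h \<in> hom (trg M q) Z" "h' \<in> hom (trg M q) Z" "h \<cdot> q = h' \<cdot> q"
  shows "h = h'"
proof -
  have q: "q \<in> hom Y (trg M q)" "q \<cdot> f = q \<cdot> g"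
    using assms by (auto simp: is_coequaliser_def hom_iff)
  have "(h' \<cdot> q) \<cdot> f = (h' \<cdot> q) \<cdot> g"
    using q assms by (simp add: hom_iff)
  moreover have "h' \<cdot> q \<in> hom (trg M f) Z"
    using q assms by (simp add: hom_iff)
  ultimately have "\<exists>!k. k \<in> hom (trg M q) Z \<and> k \<cdot> q = h' \<cdot> q"
    using assms(1) unfolding is_coequaliser_def by blast
  then show ?thesis
    using assms(4-6) by metis
qed

end

section \<open>Monoidal coherence: naturality, unitors of tensor products, the inverse
  pentagon\<close>

context symmetric_monoidal_category
begin

abbreviation asc' :: "'a \<Rightarrow> 'a \<Rightarrow> 'a \<Rightarrow> 'b"
  where "asc' X Y Z \<equiv> inverse_arrow M (asc M X Y Z)"

lemma tensor_Obj [simp]: "\<lbrakk>X \<in> Obj M; Y \<in> Obj M\<rbrakk> \<Longrightarrow> X \<otimes> Y \<in> Obj M"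
  by (rule tensor_in)

lemma unit_Obj [simp]: "\<I> \<in> Obj M"
  by (rule unit_in)

lemma tensor_simps [simp]:
  assumes "f \<in> Arr M" "g \<in> Arr M"
  shows "f \<odot> g \<in> Arr M" "src M (f \<odot> g) = src M f \<otimes> src M g" "trg M (f \<odot> g) = trg M f \<otimes> trg M g"
  using tensor_arr_in[OF arr_hom[OF assms(1)] arr_hom[OF assms(2)]] by (auto simp: hom_set_def)

lemma tensor_ident' [simp]: "\<lbrakk>X \<in> Obj M; Y \<in> Obj M\<rbrakk> \<Longrightarrow> \<one> X \<odot> \<one> Y = \<one> (X \<otimes> Y)"
  by (rule tensor_ident)

text \<open>The interchange law, oriented so that composites of tensors collapse into a tensor of
  composites; chains that display the factors separately agree after normalisation.\<close>

lemma tensor_merge [simp]: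
  assumes "f \<in> Arr M" "f' \<in> Arr M" "g \<in> Arr M" "g' \<in> Arr M" "src M f' = trg M f" "src M g' = trg M g"
  shows "(f' \<odot> g') \<cdot> (f \<odot> g) = (f' \<cdot> f) \<odot> (g' \<cdot> g)"
  by (rule tensor_cmp[symmetric]) (use assms in \<open>auto simp: hom_set_def\<close>)

lemma tensor_merge_post [simp]:
  assumes "f \<in> Arr M" "f' \<in> Arr M" "g \<in> Arr M" "g' \<in> Arr M" "src M f' = trg M f" "src M g' = trg M g"
    "k \<in> Arr M" "trg M k = src M f \<otimes> src M g"
  shows "(f' \<odot> g') \<cdot> (f \<odot> g) \<cdot> k = ((f' \<cdot> f) \<odot> (g' \<cdot> g)) \<cdot> k"
  using assms by (simp flip: cmp_assoc')

lemma asc_simps [simp]: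
  assumes "X \<in> Obj M" "Y \<in> Obj M" "Z \<in> Obj M"
  shows "asc M X Y Z \<in> Arr M" "src M (asc M X Y Z) = (X \<otimes> Y) \<otimes> Z"
    "trg M (asc M X Y Z) = X \<otimes> Y \<otimes> Z"
  using asc_in[OF assms] by (auto simp: hom_set_def)

lemma asc'_simps [simp]:
  assumes "X \<in> Obj M" "Y \<in> Obj M" "Z \<in> Obj M"
  shows "asc' X Y Z \<in> Arr M" "src M (asc' X Y Z) = X \<otimes> Y \<otimes> Z"
    "trg M (asc' X Y Z) = (X \<otimes> Y) \<otimes> Z"
    "asc M X Y Z \<cdot> asc' X Y Z = \<one> (X \<otimes> Y \<otimes> Z)"
    "asc' X Y Z \<cdot> asc M X Y Z = \<one> ((X \<otimes> Y) \<otimes> Z)"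
  using inverse_arrow[OF asc_iso[OF assms]] assms by (auto simp: inverse_arrows_def hom_set_def)

lemma asc'_post [simp]:
  assumes "X \<in> Obj M" "Y \<in> Obj M" "Z \<in> Obj M" "k \<in> Arr M"
  shows "trg M k = X \<otimes> Y \<otimes> Z \<Longrightarrow> asc M X Y Z \<cdot> asc' X Y Z \<cdot> k = k"
    "trg M k = (X \<otimes> Y) \<otimes> Z \<Longrightarrow> asc' X Y Z \<cdot> asc M X Y Z \<cdot> k = k"
  using assms by (simp_all flip: cmp_assoc')

lemma lun_simps [simp]:
  assumes "X \<in> Obj M"
  shows "lun M X \<in> Arr M" "src M (lun M X) = \<I> \<otimes> X" "trg M (lun M X) = X"
  using lun_in[OF assms] by (auto simp: hom_set_def)

lemma run_simps [simp]:
  assumes "X \<in> Obj M"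
  shows "run M X \<in> Arr M" "src M (run M X) = X \<otimes> \<I>" "trg M (run M X) = X"
  using run_in[OF assms] by (auto simp: hom_set_def)

lemma swap_simps [simp]:
  assumes "X \<in> Obj M" "Y \<in> Obj M"
  shows "swap M X Y \<in> Arr M" "src M (swap M X Y) = X \<otimes> Y" "trg M (swap M X Y) = Y \<otimes> X"
  using swap_in[OF assms] by (auto simp: hom_set_def)

lemma asc_nat:
  assumes "f \<in> Arr M" "g \<in> Arr M" "h \<in> Arr M" "trg M f = X" "trg M g = Y" "trg M h = Z"
  shows "asc M X Y Z \<cdot> ((f \<odot> g) \<odot> h) = (f \<odot> g \<odot> h) \<cdot> asc M (src M f) (src M g) (src M h)"
  using asc_natural[OF arr_hom arr_hom arr_hom] assms by blast

lemma asc_nat_post: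
  assumes "f \<in> Arr M" "g \<in> Arr M" "h \<in> Arr M" "trg M f = X" "trg M g = Y" "trg M h = Z"
    "k \<in> Arr M" "trg M k = (src M f \<otimes> src M g) \<otimes> src M h"
  shows "asc M X Y Z \<cdot> ((f \<odot> g) \<odot> h) \<cdot> k
    = (f \<odot> g \<odot> h) \<cdot> asc M (src M f) (src M g) (src M h) \<cdot> k"
  by (rule cmp_cong_post[OF asc_nat]) (use assms in auto)

lemma asc'_nat:
  assumes "f \<in> Arr M" "g \<in> Arr M" "h \<in> Arr M" "trg M f = X" "trg M g = Y" "trg M h = Z"
  shows "asc' X Y Z \<cdot> (f \<odot> g \<odot> h) = ((f \<odot> g) \<odot> h) \<cdot> asc' (src M f) (src M g) (src M h)"
proof -
  have X: "X \<in> Obj M" "Y \<in> Obj M" "Z \<in> Obj M"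
    using assms by auto
  have "asc' X Y Z \<cdot> (f \<odot> g \<odot> h)
      = asc' X Y Z \<cdot> (f \<odot> g \<odot> h) \<cdot> asc M (src M f) (src M g) (src M h)
          \<cdot> asc' (src M f) (src M g) (src M h)"
    using assms X by simp
  also have "\<dots> = asc' X Y Z \<cdot> asc M X Y Z \<cdot> ((f \<odot> g) \<odot> h) \<cdot> asc' (src M f) (src M g) (src M h)"
    using assms X by (subst asc_nat_post) simp_all
  also have "\<dots> = ((f \<odot> g) \<odot> h) \<cdot> asc' (src M f) (src M g) (src M h)"
    using assms X by simp
  finally show ?thesis .
qed

lemma asc'_nat_post:
  assumes "f \<in> Arr M" "g \<in> Arr M" "h \<in> Arr M" "trg M f = X" "trg M g = Y" "trg M h = Z"
    "k \<in> Arr M" "trg M k = src M f \<otimes> src M g \<otimes> src M h"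
  shows "asc' X Y Z \<cdot> (f \<odot> g \<odot> h) \<cdot> k
    = ((f \<odot> g) \<odot> h) \<cdot> asc' (src M f) (src M g) (src M h) \<cdot> k"
  by (rule cmp_cong_post[OF asc'_nat]) (use assms in auto)

text \<open>Instances in which an identity of a tensor product hides the tensor structure.\<close>

lemma asc_nat_ident:
  assumes "X \<in> Obj M" "Y \<in> Obj M" "h \<in> Arr M" "trg M h = Z"
  shows "asc M X Y Z \<cdot> (\<one> (X \<otimes> Y) \<odot> h) = (\<one> X \<odot> \<one> Y \<odot> h) \<cdot> asc M X Y (src M h)"
  using asc_nat[of "\<one> X" "\<one> Y" h X Y Z] assms by simp

lemma asc_nat_ident_post:
  assumes "X \<in> Obj M" "Y \<in> Obj M" "h \<in> Arr M" "trg M h = Z" "k \<in> Arr M" "trg M k = (X \<otimes> Y) \<otimes> src M h"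
  shows "asc M X Y Z \<cdot> (\<one> (X \<otimes> Y) \<odot> h) \<cdot> k = (\<one> X \<odot> \<one> Y \<odot> h) \<cdot> asc M X Y (src M h) \<cdot> k"
  by (rule cmp_cong_post[OF asc_nat_ident]) (use assms in auto)

lemma asc'_nat_ident:
  assumes "f \<in> Arr M" "trg M f = X" "Y \<in> Obj M" "Z \<in> Obj M"
  shows "asc' X Y Z \<cdot> (f \<odot> \<one> (Y \<otimes> Z)) = ((f \<odot> \<one> Y) \<odot> \<one> Z) \<cdot> asc' (src M f) Y Z"
  using asc'_nat[of f "\<one> Y" "\<one> Z" X Y Z] assms by simp

lemma asc'_nat_ident_post:
  assumes "f \<in> Arr M" "trg M f = X" "Y \<in> Obj M" "Z \<in> Obj M" "k \<in> Arr M" "trg M k = src M f \<otimes> Y \<otimes> Z"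
  shows "asc' X Y Z \<cdot> (f \<odot> \<one> (Y \<otimes> Z)) \<cdot> k = ((f \<odot> \<one> Y) \<odot> \<one> Z) \<cdot> asc' (src M f) Y Z \<cdot> k"
  by (rule cmp_cong_post[OF asc'_nat_ident]) (use assms in auto)

lemmas asc_nats = asc_nat asc_nat_post asc'_nat asc'_nat_post
  asc_nat_ident asc_nat_ident_post asc'_nat_ident asc'_nat_ident_post

lemma lun_nat: "\<lbrakk>f \<in> Arr M; trg M f = Y\<rbrakk> \<Longrightarrow> lun M Y \<cdot> (\<one> \<I> \<odot> f) = f \<cdot> lun M (src M f)"
  using lun_natural[OF arr_hom] by blast

lemma lun_nat_post:
  assumes "f \<in> Arr M" "trg M f = Y" "k \<in> Arr M" "trg M k = \<I> \<otimes> src M f"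
  shows "lun M Y \<cdot> (\<one> \<I> \<odot> f) \<cdot> k = f \<cdot> lun M (src M f) \<cdot> k"
  by (rule cmp_cong_post[OF lun_nat]) (use assms in auto)

lemma run_nat: "\<lbrakk>f \<in> Arr M; trg M f = Y\<rbrakk> \<Longrightarrow> run M Y \<cdot> (f \<odot> \<one> \<I>) = f \<cdot> run M (src M f)"
  using run_natural[OF arr_hom] by blast

lemma run_nat_post:
  assumes "f \<in> Arr M" "trg M f = Y" "k \<in> Arr M" "trg M k = src M f \<otimes> \<I>"
  shows "run M Y \<cdot> (f \<odot> \<one> \<I>) \<cdot> k = f \<cdot> run M (src M f) \<cdot> k"
  by (rule cmp_cong_post[OF run_nat]) (use assms in auto)

text \<open>The unitor makes \<open>\<I> \<otimes> -\<close> naturally isomorphic to the identity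
  functor, so tensoring with the unit object can be cancelled.\<close>

lemma lun_faithful:
  assumes "f \<in> hom X Y" "g \<in> hom X Y" "\<one> \<I> \<odot> f = \<one> \<I> \<odot> g"
  shows "f = g"
proof (rule iso_arrow_epic[OF lun_iso lun_in])
  show "f \<cdot> lun M X = g \<cdot> lun M X"
    using assms lun_natural by metis
qed (use assms in \<open>auto simp: hom_iff\<close>)

lemma run_faithful:
  assumes "f \<in> hom X Y" "g \<in> hom X Y" "f \<odot> \<one> \<I> = g \<odot> \<one> \<I>"
  shows "f = g"
proof (rule iso_arrow_epic[OF run_iso run_in])
  show "f \<cdot> run M X = g \<cdot> run M X"
    using assms run_natural by metis
qed (use assms in \<open>auto simp: hom_iff\<close>)

lemma asc_epic:
  assumes "f \<in> hom (X \<otimes> Y \<otimes> Z) V" "g \<in> hom (X \<otimes> Y \<otimes> Z) V" "f \<cdot> asc M X Y Z = g \<cdot> asc M X Y Z"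
    "X \<in> Obj M" "Y \<in> Obj M" "Z \<in> Obj M"
  shows "f = g"
  using iso_arrow_epic[OF asc_iso asc_in] assms by blast

lemma asc_tensor_epic:
  assumes "f \<in> hom ((X \<otimes> Y \<otimes> Z) \<otimes> W) V" "g \<in> hom ((X \<otimes> Y \<otimes> Z) \<otimes> W) V"
    "f \<cdot> (asc M X Y Z \<odot> \<one> W) = g \<cdot> (asc M X Y Z \<odot> \<one> W)"
    "X \<in> Obj M" "Y \<in> Obj M" "Z \<in> Obj M" "W \<in> Obj M"
  shows "f = g"
proof -
  have "f \<cdot> (asc M X Y Z \<odot> \<one> W) \<cdot> (asc' X Y Z \<odot> \<one> W) = g \<cdot> (asc M X Y Z \<odot> \<one> W) \<cdot> (asc' X Y Z \<odot> \<one> W)"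
    by (rule cmp_cong_post) (use assms in \<open>auto simp: hom_iff\<close>)
  then show ?thesis
    using assms by (simp add: hom_iff)
qed

lemma triangle_post:
  assumes "X \<in> Obj M" "Y \<in> Obj M" "k \<in> Arr M" "trg M k = (X \<otimes> \<I>) \<otimes> Y"
  shows "(\<one> X \<odot> lun M Y) \<cdot> asc M X \<I> Y \<cdot> k = (run M X \<odot> \<one> Y) \<cdot> k"
  using assms by (simp add: triangle flip: cmp_assoc')

text \<open>Kelly's coherence law for the left unitor. It is tested after tensoring with
  \<open>\<I>\<close> on the left and precomposing with two invertible associators; both sides then
  reduce to one arrow by the pentagon for \<open>\<I>, \<I>, X, Y\<close> and the triangle.\<close>

lemma lun_tensor:
  assumes X: "X \<in> Obj M" and Y: "Y \<in> Obj M"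
  shows "lun M (X \<otimes> Y) \<cdot> asc M \<I> X Y = lun M X \<odot> \<one> Y"
proof (rule lun_faithful)
  show "\<one> \<I> \<odot> (lun M (X \<otimes> Y) \<cdot> asc M \<I> X Y) = \<one> \<I> \<odot> (lun M X \<odot> \<one> Y)"
  proof (rule asc_epic)
    show "(\<one> \<I> \<odot> (lun M (X \<otimes> Y) \<cdot> asc M \<I> X Y)) \<cdot> asc M \<I> (\<I> \<otimes> X) Y
        = (\<one> \<I> \<odot> (lun M X \<odot> \<one> Y)) \<cdot> asc M \<I> (\<I> \<otimes> X) Y"
    proof (rule asc_tensor_epic)
      have "((\<one> \<I> \<odot> (lun M (X \<otimes> Y) \<cdot> asc M \<I> X Y)) \<cdot> asc M \<I> (\<I> \<otimes> X) Y) \<cdot> (asc M \<I> \<I> X \<odot> \<one> Y)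
          = (\<one> \<I> \<odot> lun M (X \<otimes> Y)) \<cdot> (\<one> \<I> \<odot> asc M \<I> X Y) \<cdot> asc M \<I> (\<I> \<otimes> X) Y \<cdot> (asc M \<I> \<I> X \<odot> \<one> Y)"
        using X Y by simp
      also have "\<dots> = (\<one> \<I> \<odot> lun M (X \<otimes> Y)) \<cdot> asc M \<I> \<I> (X \<otimes> Y) \<cdot> asc M (\<I> \<otimes> \<I>) X Y"
        using X Y by (simp add: pentagon)
      also have "\<dots> = (run M \<I> \<odot> \<one> (X \<otimes> Y)) \<cdot> asc M (\<I> \<otimes> \<I>) X Y"
        using X Y by (simp add: triangle_post)
      also have "\<dots> = asc M \<I> X Y \<cdot> ((run M \<I> \<odot> \<one> X) \<odot> \<one> Y)"
        using X Y by (simp add: asc_nat)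
      also have "\<dots> = asc M \<I> X Y \<cdot> (((\<one> \<I> \<odot> lun M X) \<cdot> asc M \<I> \<I> X) \<odot> (\<one> Y \<cdot> \<one> Y))"
        using X Y by (simp add: triangle)
      also have "\<dots> = asc M \<I> X Y \<cdot> ((\<one> \<I> \<odot> lun M X) \<odot> \<one> Y) \<cdot> (asc M \<I> \<I> X \<odot> \<one> Y)"
        using X Y by (subst tensor_merge) simp_all
      also have "\<dots> = ((\<one> \<I> \<odot> (lun M X \<odot> \<one> Y)) \<cdot> asc M \<I> (\<I> \<otimes> X) Y) \<cdot> (asc M \<I> \<I> X \<odot> \<one> Y)"
        using X Y by (subst asc_nat_post) simp_all
      finally show "((\<one> \<I> \<odot> (lun M (X \<otimes> Y) \<cdot> asc M \<I> X Y)) \<cdot> asc M \<I> (\<I> \<otimes> X) Y) \<cdot> (asc M \<I> \<I> X \<odot> \<one> Y)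
        = ((\<one> \<I> \<odot> (lun M X \<odot> \<one> Y)) \<cdot> asc M \<I> (\<I> \<otimes> X) Y) \<cdot> (asc M \<I> \<I> X \<odot> \<one> Y)" .
    qed (use X Y in \<open>auto simp: hom_iff\<close>)
  qed (use X Y in \<open>auto simp: hom_iff\<close>)
qed (use X Y in \<open>auto simp: hom_iff\<close>)

text \<open>The mirror image: tensor with \<open>\<I>\<close> on the right, postcompose with an
  associator, and apply the pentagon for \<open>X, Y, \<I>, \<I>\<close> together with two
  triangles.\<close>

lemma run_tensor:
  assumes X: "X \<in> Obj M" and Y: "Y \<in> Obj M"
  shows "(\<one> X \<odot> run M Y) \<cdot> asc M X Y \<I> = run M (X \<otimes> Y)"
proof (rule run_faithful)
  show "((\<one> X \<odot> run M Y) \<cdot> asc M X Y \<I>) \<odot> \<one> \<I> = run M (X \<otimes> Y) \<odot> \<one> \<I>"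
  proof (rule iso_arrow_monic[OF asc_iso asc_in])
    have "asc M X Y \<I> \<cdot> (((\<one> X \<odot> run M Y) \<cdot> asc M X Y \<I>) \<odot> \<one> \<I>)
        = asc M X Y \<I> \<cdot> ((\<one> X \<odot> run M Y) \<odot> \<one> \<I>) \<cdot> (asc M X Y \<I> \<odot> \<one> \<I>)"
      using X Y by simp
    also have "\<dots> = (\<one> X \<odot> (run M Y \<odot> \<one> \<I>)) \<cdot> asc M X (Y \<otimes> \<I>) \<I> \<cdot> (asc M X Y \<I> \<odot> \<one> \<I>)"
      using X Y by (subst asc_nat_post) simp_all
    also have "\<dots> = (\<one> X \<odot> ((\<one> Y \<odot> lun M \<I>) \<cdot> asc M Y \<I> \<I>)) \<cdot> asc M X (Y \<otimes> \<I>) \<I> \<cdot> (asc M X Y \<I> \<odot> \<one> \<I>)"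
      using X Y by (simp add: triangle)
    also have "\<dots> = (\<one> X \<odot> \<one> Y \<odot> lun M \<I>) \<cdot> (\<one> X \<odot> asc M Y \<I> \<I>) \<cdot> asc M X (Y \<otimes> \<I>) \<I> \<cdot> (asc M X Y \<I> \<odot> \<one> \<I>)"
      using X Y by simp
    also have "\<dots> = (\<one> X \<odot> \<one> Y \<odot> lun M \<I>) \<cdot> asc M X Y (\<I> \<otimes> \<I>) \<cdot> asc M (X \<otimes> Y) \<I> \<I>"
      using X Y by (simp only: pentagon unit_Obj)
    also have "\<dots> = asc M X Y \<I> \<cdot> (\<one> (X \<otimes> Y) \<odot> lun M \<I>) \<cdot> asc M (X \<otimes> Y) \<I> \<I>"
      using X Y by (simp add: asc_nats)
    also have "\<dots> = asc M X Y \<I> \<cdot> (run M (X \<otimes> Y) \<odot> \<one> \<I>)"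
      using X Y by (simp add: triangle)
    finally show "asc M X Y \<I> \<cdot> (((\<one> X \<odot> run M Y) \<cdot> asc M X Y \<I>) \<odot> \<one> \<I>)
        = asc M X Y \<I> \<cdot> (run M (X \<otimes> Y) \<odot> \<one> \<I>)" .
  qed (use X Y in \<open>auto simp: hom_iff\<close>)
qed (use X Y in \<open>auto simp: hom_iff\<close>)

text \<open>One side of the pentagon is inserted between the two composites of inverses; read in one
  way it cancels the left composite, read in the other way the right one.\<close>

lemma pentagon':
  assumes "W \<in> Obj M" "X \<in> Obj M" "Y \<in> Obj M" "Z \<in> Obj M"
  shows "asc' (W \<otimes> X) Y Z \<cdot> asc' W X (Y \<otimes> Z)
    = (asc' W X Y \<odot> \<one> Z) \<cdot> asc' W (X \<otimes> Y) Z \<cdot> (\<one> W \<odot> asc' X Y Z)"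
proof -
  let ?l = "asc' (W \<otimes> X) Y Z \<cdot> asc' W X (Y \<otimes> Z)"
  let ?r = "(asc' W X Y \<odot> \<one> Z) \<cdot> asc' W (X \<otimes> Y) Z \<cdot> (\<one> W \<odot> asc' X Y Z)"
  have "?l = ?r \<cdot> ((\<one> W \<odot> asc M X Y Z) \<cdot> asc M W (X \<otimes> Y) Z \<cdot> (asc M W X Y \<odot> \<one> Z)) \<cdot> ?l"
    using assms by simp
  also have "\<dots> = ?r \<cdot> (asc M W X (Y \<otimes> Z) \<cdot> asc M (W \<otimes> X) Y Z) \<cdot> ?l"
    using assms by (simp only: pentagon)
  also have "\<dots> = ?r"
    using assms by simp
  finally show ?thesis .
qed

end

section \<open>Uncurrying calculus for the internal hom\<close>

context closed_symmetric_monoidal_category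
begin

text \<open>Uncurrying, the inverse of \<open>transpose\<close>. The parameter object is not an
  argument, since it is the source of \<open>p\<close>.\<close>

definition flat :: "'a \<Rightarrow> 'a \<Rightarrow> 'b \<Rightarrow> 'b"
  where "flat X Y p = ev M X Y \<cdot> (p \<odot> \<one> X)"

lemma ihom_Obj [simp]: "\<lbrakk>X \<in> Obj M; Y \<in> Obj M\<rbrakk> \<Longrightarrow> \<lbrakk>X, Y\<rbrakk> \<in> Obj M"
  by (rule ihom_in)

lemma ev_simps [simp]:
  assumes "X \<in> Obj M" "Y \<in> Obj M"
  shows "ev M X Y \<in> Arr M" "src M (ev M X Y) = \<lbrakk>X, Y\<rbrakk> \<otimes> X" "trg M (ev M X Y) = Y"
  using ev_in[OF assms] by (auto simp: hom_set_def)

lemma flat_simps [simp]: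
  assumes "X \<in> Obj M" "Y \<in> Obj M" "p \<in> Arr M" "trg M p = \<lbrakk>X, Y\<rbrakk>"
  shows "flat X Y p \<in> Arr M" "src M (flat X Y p) = src M p \<otimes> X" "trg M (flat X Y p) = Y"
  using assms by (auto simp: flat_def)

lemma transpose_simps [simp]:
  assumes "X \<in> Obj M" "Z \<in> Obj M" "f \<in> Arr M" "src M f = Z \<otimes> X" "trg M f = Y"
  shows "transpose M Z X Y f \<in> Arr M" "src M (transpose M Z X Y f) = Z"
    "trg M (transpose M Z X Y f) = \<lbrakk>X, Y\<rbrakk>" "flat X Y (transpose M Z X Y f) = f"
proof -
  have "f \<in> hom (Z \<otimes> X) Y"
    using assms by (auto simp: hom_iff)
  then have "\<exists>!g. g \<in> hom Z \<lbrakk>X, Y\<rbrakk> \<and> ev M X Y \<cdot> (g \<odot> \<one> X) = f"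
    using ev_universal[OF assms(1) _ assms(2), of Y f] by (simp add: hom_iff)
  from theI'[OF this] show "transpose M Z X Y f \<in> Arr M" "src M (transpose M Z X Y f) = Z"
      "trg M (transpose M Z X Y f) = \<lbrakk>X, Y\<rbrakk>" "flat X Y (transpose M Z X Y f) = f"
    unfolding transpose_def flat_def by (auto simp: hom_iff)
qed

lemma flat_inj:
  assumes "flat X Y p = flat X Y p'" "p \<in> hom Z \<lbrakk>X, Y\<rbrakk>" "p' \<in> hom Z \<lbrakk>X, Y\<rbrakk>" "X \<in> Obj M" "Y \<in> Obj M"
  shows "p = p'"
proof -
  have "flat X Y p \<in> hom (Z \<otimes> X) Y"
    using assms(2,4,5) by (simp add: hom_iff)
  moreover have "Z \<in> Obj M"
    using assms(2) by (simp add: hom_iff)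
  ultimately have "\<exists>!g. g \<in> hom Z \<lbrakk>X, Y\<rbrakk> \<and> flat X Y g = flat X Y p"
    unfolding flat_def using ev_universal[of X Y Z] assms(4,5) by blast
  then show ?thesis
    using assms(1-3) by metis
qed

lemma flat_cmp:
  assumes "X \<in> Obj M" "Y \<in> Obj M" "p \<in> Arr M" "trg M p = \<lbrakk>X, Y\<rbrakk>" "z \<in> Arr M" "trg M z = src M p"
  shows "flat X Y (p \<cdot> z) = flat X Y p \<cdot> (z \<odot> \<one> X)"
  using assms by (simp add: flat_def)

lemma flat_ident [simp]: "\<lbrakk>X \<in> Obj M; Y \<in> Obj M\<rbrakk> \<Longrightarrow> flat X Y (\<one> \<lbrakk>X, Y\<rbrakk>) = ev M X Y"
  by (simp add: flat_def)

lemma transpose_flat [simp]: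
  assumes "X \<in> Obj M" "Y \<in> Obj M" "p \<in> Arr M" "src M p = Z" "trg M p = \<lbrakk>X, Y\<rbrakk>"
  shows "transpose M Z X Y (flat X Y p) = p"
  by (rule flat_inj[of X Y _ _ Z]) (use assms in \<open>auto simp: hom_iff\<close>)

lemma ihom_post_simps [simp]:
  assumes "X \<in> Obj M" "g \<in> Arr M"
  shows "ihom_post M X g \<in> Arr M" "src M (ihom_post M X g) = \<lbrakk>X, src M g\<rbrakk>"
    "trg M (ihom_post M X g) = \<lbrakk>X, trg M g\<rbrakk>"
    "flat X (trg M g) (ihom_post M X g) = g \<cdot> ev M X (src M g)"
  using assms by (auto simp: ihom_post_def)

lemma ihom_pre_simps [simp]:
  assumes "Y \<in> Obj M" "f \<in> Arr M"
  shows "ihom_pre M f Y \<in> Arr M" "src M (ihom_pre M f Y) = \<lbrakk>trg M f, Y\<rbrakk>"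
    "trg M (ihom_pre M f Y) = \<lbrakk>src M f, Y\<rbrakk>"
    "flat (src M f) Y (ihom_pre M f Y) = ev M (trg M f) Y \<cdot> (\<one> \<lbrakk>trg M f, Y\<rbrakk> \<odot> f)"
  using assms by (auto simp: ihom_pre_def)

lemma ihom_ident_simps [simp]:
  assumes "X \<in> Obj M"
  shows "ihom_ident M X \<in> Arr M" "src M (ihom_ident M X) = \<I>"
    "trg M (ihom_ident M X) = \<lbrakk>X, X\<rbrakk>" "flat X X (ihom_ident M X) = lun M X"
  using assms by (auto simp: ihom_ident_def)

lemma ihom_cmp_simps [simp]:
  assumes "X \<in> Obj M" "Y \<in> Obj M" "Z \<in> Obj M"
  shows "ihom_cmp M X Y Z \<in> Arr M" "src M (ihom_cmp M X Y Z) = \<lbrakk>Y, Z\<rbrakk> \<otimes> \<lbrakk>X, Y\<rbrakk>"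
    "trg M (ihom_cmp M X Y Z) = \<lbrakk>X, Z\<rbrakk>"
    "flat X Z (ihom_cmp M X Y Z)
      = ev M Y Z \<cdot> (\<one> \<lbrakk>Y, Z\<rbrakk> \<odot> ev M X Y) \<cdot> asc M \<lbrakk>Y, Z\<rbrakk> \<lbrakk>X, Y\<rbrakk> X"
  using assms by (auto simp: ihom_cmp_def)

lemma ihom_uncurry_simps [simp]:
  assumes "X \<in> Obj M" "Y \<in> Obj M" "Z \<in> Obj M"
  shows "ihom_uncurry M X Y Z \<in> Arr M" "src M (ihom_uncurry M X Y Z) = \<lbrakk>X, \<lbrakk>Y, Z\<rbrakk>\<rbrakk>"
    "trg M (ihom_uncurry M X Y Z) = \<lbrakk>X \<otimes> Y, Z\<rbrakk>"
    "flat (X \<otimes> Y) Z (ihom_uncurry M X Y Z)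
      = ev M Y Z \<cdot> (ev M X \<lbrakk>Y, Z\<rbrakk> \<odot> \<one> Y) \<cdot> asc' \<lbrakk>X, \<lbrakk>Y, Z\<rbrakk>\<rbrakk> X Y"
  using assms by (auto simp: ihom_uncurry_def)

lemma ihom_unit_simps [simp]:
  assumes "Y \<in> Obj M"
  shows "ihom_unit M Y \<in> Arr M" "src M (ihom_unit M Y) = Y" "trg M (ihom_unit M Y) = \<lbrakk>\<I>, Y\<rbrakk>"
    "flat \<I> Y (ihom_unit M Y) = run M Y"
  using assms by (auto simp: ihom_unit_def)

text \<open>This and the next three lemmas allow an arbitrary \<open>p\<close> instead of an
  identity. Operations on internal homs thereby become plain compositions of parametrised maps,
  which is how all later identities between arrows into homs are checked.\<close>

lemma flat_post:
  assumes "X \<in> Obj M" "g \<in> Arr M" "trg M g = Y" "p \<in> Arr M" "trg M p = \<lbrakk>X, src M g\<rbrakk>"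
  shows "flat X Y (ihom_post M X g \<cdot> p) = g \<cdot> flat X (src M g) p"
  using assms flat_cmp[of X Y "ihom_post M X g" p] by (auto simp: flat_def[of _ _ p])

lemma flat_pre:
  assumes "Y \<in> Obj M" "f \<in> Arr M" "src M f = X" "p \<in> Arr M" "trg M p = \<lbrakk>trg M f, Y\<rbrakk>"
  shows "flat X Y (ihom_pre M f Y \<cdot> p) = flat (trg M f) Y p \<cdot> (\<one> (src M p) \<odot> f)"
  using assms flat_cmp[of X Y "ihom_pre M f Y" p] by (auto simp: flat_def[of _ _ p])

lemma flat_ihom_cmp:
  assumes "X \<in> Obj M" "Y \<in> Obj M" "Z \<in> Obj M"
    "p \<in> Arr M" "q \<in> Arr M" "trg M p = \<lbrakk>Y, Z\<rbrakk>" "trg M q = \<lbrakk>X, Y\<rbrakk>"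
  shows "flat X Z (ihom_cmp M X Y Z \<cdot> (p \<odot> q))
    = flat Y Z p \<cdot> (\<one> (src M p) \<odot> flat X Y q) \<cdot> asc M (src M p) (src M q) X"
  using assms by (simp add: flat_cmp asc_nats flat_def[of _ _ p] flat_def[of _ _ q])

lemma flat_uncurry:
  assumes "X \<in> Obj M" "Y \<in> Obj M" "Z \<in> Obj M" "p \<in> Arr M" "trg M p = \<lbrakk>X, \<lbrakk>Y, Z\<rbrakk>\<rbrakk>"
  shows "flat (X \<otimes> Y) Z (ihom_uncurry M X Y Z \<cdot> p) = flat Y Z (flat X \<lbrakk>Y, Z\<rbrakk> p) \<cdot> asc' (src M p) X Y"
  using assms by (simp add: flat_cmp asc_nats flat_def[of _ _ p] flat_def[of _ _ "ev M X \<lbrakk>Y, Z\<rbrakk>"])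

text \<open>The internal hom is right adjoint to \<open>- \<otimes> Z\<close>, while the parameter
  stands on the left; the symmetry moves it across. The map is transposed to an arrow out of
  \<open>Y\<close>, factored there through \<open>q\<close>, and transposed back.\<close>

lemma tensor_coequaliser_factor:
  assumes q: "is_coequaliser M f g q" and f: "f \<in> hom X Y" "g \<in> hom X Y"
    and h: "h \<in> hom (Z \<otimes> Y) V" "h \<cdot> (\<one> Z \<odot> f) = h \<cdot> (\<one> Z \<odot> g)" and Z: "Z \<in> Obj M"
  shows "\<exists>k \<in> hom (Z \<otimes> trg M q) V. k \<cdot> (\<one> Z \<odot> q) = h"
proof -
  have q': "q \<in> hom Y (trg M q)"
    using q f by (simp add: is_coequaliser_def hom_iff)
  \<comment> \<open>The adjunct of \<open>h\<close> with the roles of the factors exchanged; it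
    coequalises \<open>f\<close> and \<open>g\<close> because \<open>h\<close> coequalises their
    tensors with \<open>Z\<close>.\<close>
  let ?t = "transpose M Y Z V (h \<cdot> swap M Y Z)"
  have t: "?t \<in> hom Y \<lbrakk>Z, V\<rbrakk>" "flat Z V ?t = h \<cdot> swap M Y Z"
    using f h(1) Z by (simp_all add: hom_iff)
  have fl: "flat Z V (?t \<cdot> e) = (h \<cdot> (\<one> Z \<odot> e)) \<cdot> swap M X Z" if "e \<in> hom X Y" for e
    using that t h(1) Z swap_natural[OF that ident_in[OF Z]] by (simp add: flat_cmp hom_iff)
  have "?t \<cdot> f = ?t \<cdot> g"
  proof (rule flat_inj[of Z V _ _ X])
    show "flat Z V (?t \<cdot> f) = flat Z V (?t \<cdot> g)"
      unfolding fl[OF f(1)] fl[OF f(2)] h(2) ..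
  qed (use f h(1) t(1) Z in \<open>simp_all add: hom_iff\<close>)
  from coequaliser_factor[OF q f(1) t(1) this]
  obtain k where k: "k \<in> hom (trg M q) \<lbrakk>Z, V\<rbrakk>" "k \<cdot> q = ?t"
    by blast
  have "(flat Z V k \<cdot> swap M Z (trg M q)) \<cdot> (\<one> Z \<odot> q) = flat Z V k \<cdot> (q \<odot> \<one> Z) \<cdot> swap M Z Y"
    using k(1) q' Z h(1) swap_natural[OF ident_in[OF Z] q'] by (simp add: hom_iff)
  also have "\<dots> = flat Z V (k \<cdot> q) \<cdot> swap M Z Y"
    using k(1) q' Z h(1) by (simp add: flat_cmp hom_iff)
  also have "\<dots> = h"
    unfolding k(2) t(2) using h(1) f Z by (simp add: hom_iff swap_swap)
  finally show ?thesis
    using k(1) Z h(1) q' by (intro bexI[of _ "flat Z V k \<cdot> swap M Z (trg M q)"]) (simp_all add: hom_iff)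
qed

text \<open>The same transposition turns both competing arrows into arrows out of the coequaliser
  object, where \<open>q\<close> can be cancelled; the swap is then removed by its inverse.\<close>

lemma tensor_coequaliser_epic:
  assumes q: "is_coequaliser M f g q" and f: "f \<in> hom X Y" "g \<in> hom X Y"
    and k: "k \<in> hom (Z \<otimes> trg M q) V" "k' \<in> hom (Z \<otimes> trg M q) V" and Z: "Z \<in> Obj M"
    and eq: "k \<cdot> (\<one> Z \<odot> q) = k' \<cdot> (\<one> Z \<odot> q)"
  shows "k = k'"
proof -
  let ?L = "trg M q"
  have q': "q \<in> hom Y ?L"
    using q f by (simp add: is_coequaliser_def hom_iff)
  let ?t = "\<lambda>k. transpose M ?L Z V (k \<cdot> swap M ?L Z)"
  have t: "?t k \<in> hom ?L \<lbrakk>Z, V\<rbrakk>" "flat Z V (?t k) = k \<cdot> swap M ?L Z"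
    "flat Z V (?t k \<cdot> q) = (k \<cdot> (\<one> Z \<odot> q)) \<cdot> swap M Y Z" if "k \<in> hom (Z \<otimes> ?L) V" for k
    using that q' Z swap_natural[OF q' ident_in[OF Z]] by (simp_all add: hom_iff flat_cmp)
  have "?t k \<cdot> q = ?t k' \<cdot> q"
    by (rule flat_inj[of Z V _ _ Y])
      (use t[OF k(1)] t[OF k(2)] eq q' k Z in \<open>simp_all add: hom_iff\<close>)
  then have "?t k = ?t k'"
    using coequaliser_epic[OF q f t(1)[OF k(1)] t(1)[OF k(2)]] by blast
  then have s: "k \<cdot> swap M ?L Z = k' \<cdot> swap M ?L Z"
    using t(2)[OF k(1)] t(2)[OF k(2)] by metis
  have "k \<cdot> swap M ?L Z \<cdot> swap M Z ?L = k' \<cdot> swap M ?L Z \<cdot> swap M Z ?L"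
    by (rule cmp_cong_post[OF s]) (use k q' Z in \<open>simp_all add: hom_iff\<close>)
  then show ?thesis
    using k q' Z by (simp add: hom_iff swap_swap)
qed

end

section \<open>Enriched categories of parametrised maps\<close>

text \<open>
  Arrows \<open>Z \<rightarrow> ehom A x y\<close> correspond to the parametrised maps \<open>h : Z \<otimes> U x \<rightarrow> U y\<close> that satisfy
  \<open>P x y Z h\<close>; \<open>el\<close> below is this correspondence.
\<close>

locale parametrised_homs = closed_symmetric_monoidal_category M
  for M :: "('o, 'a, 'm) closed_symmetric_monoidal_scheme" (structure) +
  fixes A :: "('x, 'o, 'a) enriched"
    and U :: "'x \<Rightarrow> 'o"
    and P :: "'x \<Rightarrow> 'x \<Rightarrow> 'o \<Rightarrow> 'a \<Rightarrow> bool"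
    and incl :: "'x \<Rightarrow> 'x \<Rightarrow> 'a"
  assumes U_in [simp]: "x \<in> eobj A \<Longrightarrow> U x \<in> Obj M"
    and incl_in: "\<lbrakk>x \<in> eobj A; y \<in> eobj A\<rbrakk> \<Longrightarrow> incl x y \<in> hom (ehom A x y) \<lbrakk>U x, U y\<rbrakk>"
    and incl_monic: "\<lbrakk>x \<in> eobj A; y \<in> eobj A; p \<in> hom Z (ehom A x y); p' \<in> hom Z (ehom A x y);
      incl x y \<cdot> p = incl x y \<cdot> p'\<rbrakk> \<Longrightarrow> p = p'"
    and incl_P: "\<lbrakk>x \<in> eobj A; y \<in> eobj A; p \<in> hom Z (ehom A x y)\<rbrakk>
      \<Longrightarrow> P x y Z (flat (U x) (U y) (incl x y \<cdot> p))"
    and P_incl: "\<lbrakk>x \<in> eobj A; y \<in> eobj A; Z \<in> Obj M; h \<in> hom (Z \<otimes> U x) (U y); P x y Z h\<rbrakk>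
      \<Longrightarrow> \<exists>p \<in> hom Z (ehom A x y). incl x y \<cdot> p = transpose M Z (U x) (U y) h"
    and P_ident: "x \<in> eobj A \<Longrightarrow> P x x \<I> (lun M (U x))"
    and P_cmp: "\<lbrakk>x \<in> eobj A; y \<in> eobj A; w \<in> eobj A; Z \<in> Obj M; W \<in> Obj M;
      h \<in> hom (Z \<otimes> U x) (U y); P x y Z h; k \<in> hom (W \<otimes> U y) (U w); P y w W k\<rbrakk>
      \<Longrightarrow> P x w (W \<otimes> Z) (k \<cdot> (\<one> W \<odot> h) \<cdot> asc M W Z (U x))"
    and eident_eq: "x \<in> eobj A \<Longrightarrow> eident A x = factor_through M (incl x x) (ihom_ident M (U x))"
    and ecmp_eq: "\<lbrakk>x \<in> eobj A; y \<in> eobj A; z \<in> eobj A\<rbrakk> \<Longrightarrow> ecmp A x y z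
      = factor_through M (incl x z) (ihom_cmp M (U x) (U y) (U z) \<cdot> (incl y z \<odot> incl x y))"
begin

definition el :: "'x \<Rightarrow> 'x \<Rightarrow> 'a \<Rightarrow> 'a"
  where "el x y p = flat (U x) (U y) (incl x y \<cdot> p)"

lemma incl_simps [simp]:
  assumes "x \<in> eobj A" "y \<in> eobj A"
  shows "incl x y \<in> Arr M" "src M (incl x y) = ehom A x y" "trg M (incl x y) = \<lbrakk>U x, U y\<rbrakk>"
    "ehom A x y \<in> Obj M"
  using incl_in[OF assms] by (auto simp: hom_iff)

lemma el_simps [simp]:
  assumes "x \<in> eobj A" "y \<in> eobj A" "p \<in> Arr M" "trg M p = ehom A x y"
  shows "el x y p \<in> Arr M" "src M (el x y p) = src M p \<otimes> U x" "trg M (el x y p) = U y"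
  using assms by (auto simp: el_def)

lemma el_P:
  assumes "x \<in> eobj A" "y \<in> eobj A" "p \<in> hom Z (ehom A x y)"
  shows "P x y Z (el x y p)"
  unfolding el_def using incl_P assms .

lemma el_inj:
  assumes "x \<in> eobj A" "y \<in> eobj A" "p \<in> hom Z (ehom A x y)" "p' \<in> hom Z (ehom A x y)"
    "el x y p = el x y p'"
  shows "p = p'"
  by (rule incl_monic[OF assms(1-4)], rule flat_inj[of "U x" "U y" _ _ Z])
    (use assms in \<open>auto simp: el_def hom_iff\<close>)

lemma el_surj:
  assumes "x \<in> eobj A" "y \<in> eobj A" "Z \<in> Obj M" "h \<in> hom (Z \<otimes> U x) (U y)" "P x y Z h"
  shows "\<exists>p \<in> hom Z (ehom A x y). el x y p = h"
proof -
  obtain p where p: "p \<in> hom Z (ehom A x y)" "incl x y \<cdot> p = transpose M Z (U x) (U y) h"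
    using P_incl[OF assms] by blast
  then show ?thesis
    using assms(1-4) by (intro bexI[of _ p]) (simp_all add: el_def hom_iff)
qed

lemma el_cmp:
  assumes "x \<in> eobj A" "y \<in> eobj A" "p \<in> Arr M" "trg M p = ehom A x y" "z \<in> Arr M" "trg M z = src M p"
  shows "el x y (p \<cdot> z) = el x y p \<cdot> (z \<odot> \<one> (U x))"
  unfolding el_def using assms flat_cmp[of "U x" "U y" "incl x y \<cdot> p" z] by simp

text \<open>The identity of the hom object names the universal parametrised map, its evaluation.
  Every other parametrised map is a reparametrisation of it: the Yoneda principle for the
  represented functor.\<close>

lemma el_ident_cmp:
  assumes "x \<in> eobj A" "y \<in> eobj A" "p \<in> Arr M" "trg M p = ehom A x y"
  shows "el x y (\<one> (ehom A x y)) \<cdot> (p \<odot> \<one> (U x)) = el x y p"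
  using el_cmp[of x y "\<one> (ehom A x y)" p] assms by simp

text \<open>\<open>P_ident\<close> gives the factorisation and \<open>incl_monic\<close> its
  uniqueness, so that the definite description inside \<open>factor_through\<close> denotes.\<close>

lemma eident_props:
  assumes x: "x \<in> eobj A"
  shows "eident A x \<in> hom \<I> (ehom A x x)" "el x x (eident A x) = lun M (U x)"
proof -
  have m: "ihom_ident M (U x) = transpose M \<I> (U x) (U x) (lun M (U x))"
    by (simp add: ihom_ident_def)
  have *: "\<exists>h \<in> hom \<I> (ehom A x x). incl x x \<cdot> h = ihom_ident M (U x)"
    unfolding m by (rule P_incl) (use x P_ident in \<open>auto simp: hom_iff\<close>)
  note ft = factor_through[OF incl_in _ *, folded eident_eq[OF x]]
  have i: "ihom_ident M (U x) \<in> hom \<I> \<lbrakk>U x, U x\<rbrakk>"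
    using x by (auto simp: hom_iff)
  show "eident A x \<in> hom \<I> (ehom A x x)"
    using ft(1)[OF x x i] incl_monic x by blast
  have "incl x x \<cdot> eident A x = ihom_ident M (U x)"
    using ft(2)[OF x x i] incl_monic x by blast
  then show "el x x (eident A x) = lun M (U x)"
    using x by (simp add: el_def)
qed

lemma eident_simps [simp]:
  assumes "x \<in> eobj A"
  shows "eident A x \<in> Arr M" "src M (eident A x) = \<I>" "trg M (eident A x) = ehom A x x"
  using eident_props[OF assms] by (auto simp: hom_iff)

text \<open>The internal composite restricts to the hom objects because \<open>P\<close> is closed
  under composition, applied here to the two universal parametrised maps.\<close>

lemma ecmp_props:
  assumes x: "x \<in> eobj A" "y \<in> eobj A" "z \<in> eobj A"
  shows "ecmp A x y z \<in> hom (ehom A y z \<otimes> ehom A x y) (ehom A x z)"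
    "incl x z \<cdot> ecmp A x y z = ihom_cmp M (U x) (U y) (U z) \<cdot> (incl y z \<odot> incl x y)"
proof -
  let ?m = "ihom_cmp M (U x) (U y) (U z) \<cdot> (incl y z \<odot> incl x y)"
  let ?h = "flat (U y) (U z) (incl y z) \<cdot> (\<one> (ehom A y z) \<odot> flat (U x) (U y) (incl x y))
    \<cdot> asc M (ehom A y z) (ehom A x y) (U x)"
  have h: "flat (U x) (U z) ?m = ?h"
    using x by (simp add: flat_ihom_cmp)
  have "P x z (ehom A y z \<otimes> ehom A x y) ?h"
    by (rule P_cmp)
      (use x incl_P[of y z "\<one> (ehom A y z)" "ehom A y z"] incl_P[of x y "\<one> (ehom A x y)" "ehom A x y"]
        in \<open>auto simp: hom_iff\<close>)
  then have "\<exists>h \<in> hom (ehom A y z \<otimes> ehom A x y) (ehom A x z).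
      incl x z \<cdot> h = transpose M (ehom A y z \<otimes> ehom A x y) (U x) (U z) ?h"
    by (intro P_incl) (use x in \<open>auto simp: hom_iff\<close>)
  then have *: "\<exists>h \<in> hom (ehom A y z \<otimes> ehom A x y) (ehom A x z). incl x z \<cdot> h = ?m"
    unfolding h[symmetric] using x by simp
  note ft = factor_through[OF incl_in _ *, folded ecmp_eq[OF x]]
  have i: "?m \<in> hom (ehom A y z \<otimes> ehom A x y) \<lbrakk>U x, U z\<rbrakk>"
    using x by (auto simp: hom_iff)
  show "ecmp A x y z \<in> hom (ehom A y z \<otimes> ehom A x y) (ehom A x z)"
    using ft(1)[OF x(1,3) i] incl_monic x by blast
  show "incl x z \<cdot> ecmp A x y z = ?m"
    using ft(2)[OF x(1,3) i] incl_monic x by blast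
qed

lemma ecmp_simps [simp]:
  assumes "x \<in> eobj A" "y \<in> eobj A" "z \<in> eobj A"
  shows "ecmp A x y z \<in> Arr M" "src M (ecmp A x y z) = ehom A y z \<otimes> ehom A x y"
    "trg M (ecmp A x y z) = ehom A x z"
  using ecmp_props[OF assms] by (auto simp: hom_iff)

text \<open>Enriched composition becomes composition of parametrised maps, with the two parameters
  tensored. Every later equation involving \<open>ecmp\<close> is reduced by this rule.\<close>

lemma el_ecmp:
  assumes x: "x \<in> eobj A" "y \<in> eobj A" "z \<in> eobj A"
    and p: "p \<in> Arr M" "trg M p = ehom A y z" and q: "q \<in> Arr M" "trg M q = ehom A x y"
  shows "el x z (ecmp A x y z \<cdot> (p \<odot> q))
    = el y z p \<cdot> (\<one> (src M p) \<odot> el x y q) \<cdot> asc M (src M p) (src M q) (U x)"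
proof -
  have "incl x z \<cdot> ecmp A x y z \<cdot> (p \<odot> q)
      = ihom_cmp M (U x) (U y) (U z) \<cdot> (incl y z \<odot> incl x y) \<cdot> (p \<odot> q)"
    by (rule cmp_cong_post[OF ecmp_props(2)]) (use assms in auto)
  also have "\<dots> = ihom_cmp M (U x) (U y) (U z) \<cdot> ((incl y z \<cdot> p) \<odot> (incl x y \<cdot> q))"
    using assms by simp
  finally show ?thesis
    using assms by (simp add: el_def flat_ihom_cmp)
qed

text \<open>Each axiom is an equation of arrows into a hom object and is tested by
  \<open>el_inj\<close>. Associativity then is the pentagon, the left unit law is
  \<open>lun_tensor\<close>, and the right unit law is the triangle.\<close>

theorem enriched: "enriched_category M A"
proof -
  have "ecmp A W X Z \<cdot> (ecmp A X Y Z \<odot> \<one> (ehom A W X))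
      = ecmp A W Y Z \<cdot> (\<one> (ehom A Y Z) \<odot> ecmp A W X Y)
          \<cdot> asc M (ehom A Y Z) (ehom A X Y) (ehom A W X)"
    if "W \<in> eobj A" "X \<in> eobj A" "Y \<in> eobj A" "Z \<in> eobj A" for W X Y Z
  proof (rule el_inj[of W Z])
    let ?E = "ehom A Y Z" and ?F = "ehom A X Y" and ?G = "ehom A W X"
    let ?e = "el Y Z (\<one> ?E)" and ?f = "el X Y (\<one> ?F)" and ?g = "el W X (\<one> ?G)"
    have 1: "el X Z (ecmp A X Y Z) = ?e \<cdot> (\<one> ?E \<odot> ?f) \<cdot> asc M ?E ?F (U X)"
      using el_ecmp[of X Y Z "\<one> ?E" "\<one> ?F"] that by simp
    have 2: "el W Y (ecmp A W X Y) = ?f \<cdot> (\<one> ?F \<odot> ?g) \<cdot> asc M ?F ?G (U W)"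
      using el_ecmp[of W X Y "\<one> ?F" "\<one> ?G"] that by simp
    have "el W Z (ecmp A W X Z \<cdot> (ecmp A X Y Z \<odot> \<one> ?G))
        = ?e \<cdot> (\<one> ?E \<odot> ?f) \<cdot> (\<one> ?E \<odot> \<one> ?F \<odot> ?g) \<cdot> asc M ?E ?F (?G \<otimes> U W) \<cdot> asc M (?E \<otimes> ?F) ?G (U W)"
      using that by (simp add: el_ecmp 1 asc_nats)
    also have "\<dots> = el W Z (ecmp A W Y Z \<cdot> (\<one> ?E \<odot> ecmp A W X Y)) \<cdot> (asc M ?E ?F ?G \<odot> \<one> (U W))"
      using that by (simp add: el_ecmp 2 pentagon)
    also have "\<dots> = el W Z (ecmp A W Y Z \<cdot> (\<one> ?E \<odot> ecmp A W X Y) \<cdot> asc M ?E ?F ?G)"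
      using el_cmp[of W Z "ecmp A W Y Z \<cdot> (\<one> ?E \<odot> ecmp A W X Y)" "asc M ?E ?F ?G"] that by simp
    finally show "el W Z (ecmp A W X Z \<cdot> (ecmp A X Y Z \<odot> \<one> ?G))
      = el W Z (ecmp A W Y Z \<cdot> (\<one> ?E \<odot> ecmp A W X Y) \<cdot> asc M ?E ?F ?G)" .
  qed (use that in \<open>auto simp: hom_iff\<close>)
  moreover have "ecmp A X Y Y \<cdot> (eident A Y \<odot> \<one> (ehom A X Y)) = lun M (ehom A X Y)"
    if "X \<in> eobj A" "Y \<in> eobj A" for X Y
  proof (rule el_inj[of X Y])
    have "el X Y (ecmp A X Y Y \<cdot> (eident A Y \<odot> \<one> (ehom A X Y)))
        = el X Y (\<one> (ehom A X Y)) \<cdot> (lun M (ehom A X Y) \<odot> \<one> (U X))"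
      using that by (simp add: el_ecmp eident_props lun_nat_post lun_tensor)
    then show "el X Y (ecmp A X Y Y \<cdot> (eident A Y \<odot> \<one> (ehom A X Y))) = el X Y (lun M (ehom A X Y))"
      using that by (simp add: el_ident_cmp)
  qed (use that in \<open>auto simp: hom_iff\<close>)
  moreover have "ecmp A X X Y \<cdot> (\<one> (ehom A X Y) \<odot> eident A X) = run M (ehom A X Y)"
    if "X \<in> eobj A" "Y \<in> eobj A" for X Y
  proof (rule el_inj[of X Y])
    have "el X Y (ecmp A X X Y \<cdot> (\<one> (ehom A X Y) \<odot> eident A X))
        = el X Y (\<one> (ehom A X Y)) \<cdot> (run M (ehom A X Y) \<odot> \<one> (U X))"
      using that by (simp add: el_ecmp eident_props triangle)
    then show "el X Y (ecmp A X X Y \<cdot> (\<one> (ehom A X Y) \<odot> eident A X)) = el X Y (run M (ehom A X Y))"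
      using that by (simp add: el_ident_cmp)
  qed (use that in \<open>auto simp: hom_iff\<close>)
  ultimately show ?thesis
    unfolding enriched_category_def by (auto simp: hom_iff)
qed

end

section \<open>Comodules\<close>

locale comonoid_category = closed_symmetric_monoidal_category M
  for M :: "('o, 'a, 'm) closed_symmetric_monoidal_scheme" (structure) +
  fixes C :: "('o, 'a) comonoid"
  assumes comonoid: "comonoid M C"
    and equalisers: "\<And>X Y f g. \<lbrakk>f \<in> hom X Y; g \<in> hom X Y;
        \<exists>h \<in> hom Y X. h \<cdot> f = \<one> X \<and> h \<cdot> g = \<one> X\<rbrakk> \<Longrightarrow> \<exists>e. is_equaliser M f g e"
    and coequalisers: "\<And>X Y f g. \<lbrakk>f \<in> hom X Y; g \<in> hom X Y;
        \<exists>h \<in> hom Y X. f \<cdot> h = \<one> Y \<and> g \<cdot> h = \<one> Y\<rbrakk> \<Longrightarrow> \<exists>q. is_coequaliser M f g q"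
begin

abbreviation K where "K \<equiv> carr C"
abbreviation Delta ("\<Delta>") where "\<Delta> \<equiv> comult C"
abbreviation Epsilon ("\<epsilon>") where "\<epsilon> \<equiv> counit C"

lemma comonoid_simps [simp]:
  "K \<in> Obj M" "\<Delta> \<in> Arr M" "src M \<Delta> = K" "trg M \<Delta> = K \<otimes> K"
  "\<epsilon> \<in> Arr M" "src M \<epsilon> = K" "trg M \<epsilon> = \<I>"
  using comonoid by (simp_all add: comonoid_def hom_iff)

text \<open>With \<open>eps\<close> below, the comultiplication and counit of the comonad
  \<open>T X = X \<otimes> K\<close>. Associators and unitors are absorbed here, so later
  calculations can speak of naturality and comonad laws.\<close>

definition \<delta> :: "'o \<Rightarrow> 'a"
  where "\<delta> X = asc' X K K \<cdot> (\<one> X \<odot> \<Delta>)"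

definition eps :: "'o \<Rightarrow> 'a"
  where "eps X = run M X \<cdot> (\<one> X \<odot> \<epsilon>)"

lemma delta_simps [simp]:
  assumes "X \<in> Obj M"
  shows "\<delta> X \<in> Arr M" "src M (\<delta> X) = X \<otimes> K" "trg M (\<delta> X) = (X \<otimes> K) \<otimes> K"
    "eps X \<in> Arr M" "src M (eps X) = X \<otimes> K" "trg M (eps X) = X"
  using assms by (simp_all add: \<delta>_def eps_def)

lemma cofree_comodule_eq: "cofree_comodule M C X = (X \<otimes> K, \<delta> X)"
  by (simp add: cofree_comodule_def \<delta>_def)

lemma delta_nat:
  assumes "f \<in> Arr M" "trg M f = Y"
  shows "\<delta> Y \<cdot> (f \<odot> \<one> K) = ((f \<odot> \<one> K) \<odot> \<one> K) \<cdot> \<delta> (src M f)"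
proof -
  have "\<delta> Y \<cdot> (f \<odot> \<one> K) = asc' Y K K \<cdot> (f \<odot> \<one> (K \<otimes> K)) \<cdot> (\<one> (src M f) \<odot> \<Delta>)"
    using assms src_trg_in(2)[OF assms(1)] by (simp add: \<delta>_def)
  also have "\<dots> = ((f \<odot> \<one> K) \<odot> \<one> K) \<cdot> \<delta> (src M f)"
    using assms by (subst asc'_nat_ident_post) (simp_all add: \<delta>_def)
  finally show ?thesis .
qed

lemma delta_nat_post:
  assumes "f \<in> Arr M" "trg M f = Y" "k \<in> Arr M" "trg M k = src M f \<otimes> K"
  shows "\<delta> Y \<cdot> (f \<odot> \<one> K) \<cdot> k = ((f \<odot> \<one> K) \<odot> \<one> K) \<cdot> \<delta> (src M f) \<cdot> k"
  by (rule cmp_cong_post[OF delta_nat]) (use assms src_trg_in(2)[OF assms(1)] in simp_all)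

lemma eps_nat:
  assumes "f \<in> Arr M" "trg M f = Y"
  shows "eps Y \<cdot> (f \<odot> \<one> K) = f \<cdot> eps (src M f)"
proof -
  have "eps Y \<cdot> (f \<odot> \<one> K) = run M Y \<cdot> (f \<odot> \<one> \<I>) \<cdot> (\<one> (src M f) \<odot> \<epsilon>)"
    using assms src_trg_in(2)[OF assms(1)] by (simp add: eps_def)
  also have "\<dots> = f \<cdot> eps (src M f)"
    using assms by (subst run_nat_post) (simp_all add: eps_def)
  finally show ?thesis .
qed

lemma eps_nat_post:
  assumes "f \<in> Arr M" "trg M f = Y" "k \<in> Arr M" "trg M k = src M f \<otimes> K"
  shows "eps Y \<cdot> (f \<odot> \<one> K) \<cdot> k = f \<cdot> eps (src M f) \<cdot> k"
  by (rule cmp_cong_post[OF eps_nat]) (use assms src_trg_in(2)[OF assms(1)] in simp_all)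

text \<open>The inverse associators \<open>Z \<otimes> T X \<rightarrow> T (Z \<otimes> X)\<close>
  form a strength of T, and the comultiplication respects it. After naturality this is the inverse
  pentagon.\<close>

lemma delta_tensor:
  assumes "Z \<in> Obj M" "X \<in> Obj M"
  shows "\<delta> (Z \<otimes> X) \<cdot> asc' Z X K = (asc' Z X K \<odot> \<one> K) \<cdot> asc' Z (X \<otimes> K) K \<cdot> (\<one> Z \<odot> \<delta> X)"
proof -
  have "\<delta> (Z \<otimes> X) \<cdot> asc' Z X K
      = asc' (Z \<otimes> X) K K \<cdot> (\<one> (Z \<otimes> X) \<odot> \<Delta>) \<cdot> asc' Z X K"
    using assms by (simp add: \<delta>_def)
  also have "\<dots> = asc' (Z \<otimes> X) K K \<cdot> asc' Z X (K \<otimes> K) \<cdot> (\<one> Z \<odot> \<one> X \<odot> \<Delta>)"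
    using assms by (simp add: asc'_nat)
  also have "\<dots> = (asc' (Z \<otimes> X) K K \<cdot> asc' Z X (K \<otimes> K)) \<cdot> (\<one> Z \<odot> \<one> X \<odot> \<Delta>)"
    using assms by simp
  also have "\<dots> = (asc' Z X K \<odot> \<one> K) \<cdot> asc' Z (X \<otimes> K) K \<cdot> (\<one> Z \<odot> \<delta> X)"
    unfolding pentagon'[OF assms comonoid_simps(1) comonoid_simps(1)]
    using assms by (simp add: \<delta>_def)
  finally show ?thesis .
qed

lemma delta_tensor_post:
  assumes "Z \<in> Obj M" "X \<in> Obj M" "k \<in> Arr M" "trg M k = Z \<otimes> X \<otimes> K"
  shows "\<delta> (Z \<otimes> X) \<cdot> asc' Z X K \<cdot> k
    = (asc' Z X K \<odot> \<one> K) \<cdot> asc' Z (X \<otimes> K) K \<cdot> (\<one> Z \<odot> \<delta> X) \<cdot> k"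
proof -
  have "\<delta> (Z \<otimes> X) \<cdot> asc' Z X K \<cdot> k = (\<delta> (Z \<otimes> X) \<cdot> asc' Z X K) \<cdot> k"
    using assms by simp
  then show ?thesis
    unfolding delta_tensor[OF assms(1,2)] using assms by simp
qed

lemma eps_tensor:
  assumes "Z \<in> Obj M" "X \<in> Obj M"
  shows "eps (Z \<otimes> X) = (\<one> Z \<odot> eps X) \<cdot> asc M Z X K"
  using assms by (simp add: eps_def asc_nats flip: run_tensor)

text \<open>A comodule is a coalgebra for the comonad T: the associator of the original axiom moves
  to the other side and disappears into \<open>\<delta>\<close>.\<close>

lemma comodule_iff:
  "comodule M C (X, \<rho>) \<longleftrightarrow> X \<in> Obj M \<and> \<rho> \<in> hom X (X \<otimes> K) \<and>
    (\<rho> \<odot> \<one> K) \<cdot> \<rho> = \<delta> X \<cdot> \<rho> \<and> eps X \<cdot> \<rho> = \<one> X"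
proof -
  have "asc M X K K \<cdot> (\<rho> \<odot> \<one> K) \<cdot> \<rho> = (\<one> X \<odot> \<Delta>) \<cdot> \<rho> \<longleftrightarrow> (\<rho> \<odot> \<one> K) \<cdot> \<rho> = \<delta> X \<cdot> \<rho>"
    (is "?l = ?r \<longleftrightarrow> _")
    if "X \<in> Obj M" "\<rho> \<in> hom X (X \<otimes> K)"
  proof
    assume *: "?l = ?r"
    have "(\<rho> \<odot> \<one> K) \<cdot> \<rho> = asc' X K K \<cdot> ?l"
      using that by (simp add: hom_iff)
    also have "\<dots> = \<delta> X \<cdot> \<rho>"
      unfolding * using that by (simp add: \<delta>_def hom_iff)
    finally show "(\<rho> \<odot> \<one> K) \<cdot> \<rho> = \<delta> X \<cdot> \<rho>" .
  next
    assume *: "(\<rho> \<odot> \<one> K) \<cdot> \<rho> = \<delta> X \<cdot> \<rho>"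
    show "?l = ?r"
      unfolding * using that by (simp add: \<delta>_def hom_iff)
  qed
  then show ?thesis
    by (auto simp: comodule_def eps_def hom_iff)
qed

lemma comodule_simps [simp]:
  assumes "comodule M C x"
  shows "fst x \<in> Obj M" "snd x \<in> Arr M" "src M (snd x) = fst x" "trg M (snd x) = fst x \<otimes> K"
    "(snd x \<odot> \<one> K) \<cdot> snd x = \<delta> (fst x) \<cdot> snd x" "eps (fst x) \<cdot> snd x = \<one> (fst x)"
  using assms comodule_iff[of "fst x" "snd x"] by (simp_all add: hom_iff)

lemma comodule_map_iff:
  "comodule_map M C x y f \<longleftrightarrow> f \<in> hom (fst x) (fst y) \<and> snd y \<cdot> f = (f \<odot> \<one> K) \<cdot> snd x"
  by (simp add: comodule_map_def case_prod_beta)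

lemma comodule_map_cmp:
  assumes "comodule_map M C x y f" "comodule_map M C y z g"
    "comodule M C x" "comodule M C y" "comodule M C z"
  shows "comodule_map M C x z (g \<cdot> f)"
proof -
  have f: "f \<in> hom (fst x) (fst y)" "snd y \<cdot> f = (f \<odot> \<one> K) \<cdot> snd x"
    and g: "g \<in> hom (fst y) (fst z)" "snd z \<cdot> g = (g \<odot> \<one> K) \<cdot> snd y"
    using assms by (auto simp: comodule_map_iff)
  have "snd z \<cdot> g \<cdot> f = (snd z \<cdot> g) \<cdot> f"
    using f(1) g(1) assms(3-) by (simp add: hom_iff)
  also have "\<dots> = (g \<odot> \<one> K) \<cdot> snd y \<cdot> f"
    unfolding g(2) using f(1) g(1) assms(3-) by (simp add: hom_iff)
  also have "\<dots> = ((g \<cdot> f) \<odot> \<one> K) \<cdot> snd x"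
    unfolding f(2) using f(1) g(1) assms(3-) by (simp add: hom_iff)
  finally show ?thesis
    using f(1) g(1) by (simp add: comodule_map_iff hom_iff)
qed

text \<open>The comodule \<open>Z \<otimes> x\<close>, in which only the second factor is coacted
  upon. With it, a parametrised comodule map is an ordinary comodule map
  \<open>ten Z x \<rightarrow> y\<close>.\<close>

definition ten :: "'o \<Rightarrow> 'o \<times> 'a \<Rightarrow> 'o \<times> 'a"
  where "ten Z x = (Z \<otimes> fst x, asc' Z (fst x) K \<cdot> (\<one> Z \<odot> snd x))"

lemma comodule_ten:
  assumes Z: "Z \<in> Obj M" and x: "comodule M C x"
  shows "comodule M C (ten Z x)"
proof -
  let ?X = "fst x" and ?r = "snd x"
  have "((asc' Z ?X K \<cdot> (\<one> Z \<odot> ?r)) \<odot> \<one> K) \<cdot> asc' Z ?X K \<cdot> (\<one> Z \<odot> ?r)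
      = (asc' Z ?X K \<odot> \<one> K) \<cdot> ((\<one> Z \<odot> ?r) \<odot> \<one> K) \<cdot> asc' Z ?X K \<cdot> (\<one> Z \<odot> ?r)"
    using assms by simp
  also have "\<dots> = (asc' Z ?X K \<odot> \<one> K) \<cdot> asc' Z (?X \<otimes> K) K \<cdot> (\<one> Z \<odot> ?r \<odot> \<one> K) \<cdot> (\<one> Z \<odot> ?r)"
    using assms by (subst asc'_nat_post) simp_all
  also have "\<dots> = (asc' Z ?X K \<odot> \<one> K) \<cdot> asc' Z (?X \<otimes> K) K \<cdot> (\<one> Z \<odot> \<delta> ?X) \<cdot> (\<one> Z \<odot> ?r)"
    using assms by simp
  also have "\<dots> = \<delta> (Z \<otimes> ?X) \<cdot> asc' Z ?X K \<cdot> (\<one> Z \<odot> ?r)"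
    using assms by (subst delta_tensor_post) simp_all
  finally have 1: "((asc' Z ?X K \<cdot> (\<one> Z \<odot> ?r)) \<odot> \<one> K) \<cdot> asc' Z ?X K \<cdot> (\<one> Z \<odot> ?r)
      = \<delta> (Z \<otimes> ?X) \<cdot> asc' Z ?X K \<cdot> (\<one> Z \<odot> ?r)" .
  have 2: "eps (Z \<otimes> ?X) \<cdot> asc' Z ?X K \<cdot> (\<one> Z \<odot> ?r) = \<one> (Z \<otimes> ?X)"
    using assms by (simp add: eps_tensor)
  show ?thesis
    unfolding ten_def comodule_iff using 1 2 assms by (simp add: hom_iff)
qed

text \<open>The cofree comodule is \<open>ten X\<close> of C regarded as a comodule over
  itself.\<close>

lemma comodule_cofree:
  assumes "X \<in> Obj M"
  shows "comodule M C (X \<otimes> K, \<delta> X)"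
proof -
  have "comodule M C (K, \<Delta>)"
    using comonoid by (simp add: comonoid_def comodule_def)
  from comodule_ten[OF assms this] show ?thesis
    by (simp add: ten_def \<delta>_def)
qed

text \<open>The comonad laws of T. Coassociativity and one counit law are the comodule axioms of the
  cofree comodule; the other counit law needs the left counit axiom of C and the triangle.\<close>

lemma delta_eqs:
  assumes "X \<in> Obj M"
  shows "(\<delta> X \<odot> \<one> K) \<cdot> \<delta> X = \<delta> (X \<otimes> K) \<cdot> \<delta> X"
    "eps (X \<otimes> K) \<cdot> \<delta> X = \<one> (X \<otimes> K)"
    "(eps X \<odot> \<one> K) \<cdot> \<delta> X = \<one> (X \<otimes> K)"
proof -
  show "(\<delta> X \<odot> \<one> K) \<cdot> \<delta> X = \<delta> (X \<otimes> K) \<cdot> \<delta> X" "eps (X \<otimes> K) \<cdot> \<delta> X = \<one> (X \<otimes> K)"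
    using comodule_simps(5,6)[OF comodule_cofree[OF assms]] by simp_all
  have e: "lun M K \<cdot> (\<epsilon> \<odot> \<one> K) \<cdot> \<Delta> = \<one> K"
    using comonoid by (simp add: comonoid_def)
  have "(eps X \<odot> \<one> K) \<cdot> \<delta> X = (run M X \<odot> \<one> K) \<cdot> ((\<one> X \<odot> \<epsilon>) \<odot> \<one> K) \<cdot> asc' X K K \<cdot> (\<one> X \<odot> \<Delta>)"
    using assms by (simp add: eps_def \<delta>_def)
  also have "\<dots> = (run M X \<odot> \<one> K) \<cdot> asc' X \<I> K \<cdot> (\<one> X \<odot> \<epsilon> \<odot> \<one> K) \<cdot> (\<one> X \<odot> \<Delta>)"
    using assms by (subst asc'_nat_post) simp_all
  also have "\<dots> = ((\<one> X \<odot> lun M K) \<cdot> asc M X \<I> K) \<cdot> asc' X \<I> K \<cdot> (\<one> X \<odot> \<epsilon> \<odot> \<one> K) \<cdot> (\<one> X \<odot> \<Delta>)"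
    using assms by (subst triangle) simp_all
  also have "\<dots> = \<one> (X \<otimes> K)"
    using assms e by simp
  finally show "(eps X \<odot> \<one> K) \<cdot> \<delta> X = \<one> (X \<otimes> K)" .
qed

lemma comodule_map_ten:
  assumes "comodule_map M C x y f" "comodule M C x" "comodule M C y" "Z \<in> Obj M"
  shows "comodule_map M C (ten Z x) (ten Z y) (\<one> Z \<odot> f)"
proof -
  have f: "f \<in> hom (fst x) (fst y)" "snd y \<cdot> f = (f \<odot> \<one> K) \<cdot> snd x"
    using assms by (auto simp: comodule_map_iff)
  have "asc' Z (fst y) K \<cdot> (\<one> Z \<odot> (f \<odot> \<one> K)) \<cdot> (\<one> Z \<odot> snd x)
      = ((\<one> Z \<odot> f) \<odot> \<one> K) \<cdot> asc' Z (fst x) K \<cdot> (\<one> Z \<odot> snd x)"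
    using f(1) assms(2-) by (subst asc'_nat_post) (simp_all add: hom_iff)
  then show ?thesis
    using f assms(2-) by (simp add: comodule_map_iff ten_def hom_iff)
qed

text \<open>Compatibility with the coactions is the inverse pentagon, once the coaction of
  \<open>x\<close> is moved past the associator. This is what makes iterated parameters
  composable.\<close>

lemma comodule_map_asc:
  assumes "W \<in> Obj M" "Z \<in> Obj M" "comodule M C x"
  shows "comodule_map M C (ten (W \<otimes> Z) x) (ten W (ten Z x)) (asc M W Z (fst x))"
proof -
  let ?X = "fst x" and ?r = "snd x"
  have "(asc' W (Z \<otimes> ?X) K \<cdot> (\<one> W \<odot> (asc' Z ?X K \<cdot> (\<one> Z \<odot> ?r)))) \<cdot> asc M W Z ?X
      = asc' W (Z \<otimes> ?X) K \<cdot> (\<one> W \<odot> asc' Z ?X K) \<cdot> (\<one> W \<odot> \<one> Z \<odot> ?r) \<cdot> asc M W Z ?X"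
    using assms by simp
  also have "\<dots> = asc' W (Z \<otimes> ?X) K \<cdot> (\<one> W \<odot> asc' Z ?X K) \<cdot> asc M W Z (?X \<otimes> K) \<cdot> (\<one> (W \<otimes> Z) \<odot> ?r)"
    using assms by (simp add: asc_nat_ident)
  also have "\<dots> = (asc M W Z ?X \<odot> \<one> K) \<cdot> ((asc' W Z ?X \<odot> \<one> K) \<cdot> asc' W (Z \<otimes> ?X) K
      \<cdot> (\<one> W \<odot> asc' Z ?X K)) \<cdot> asc M W Z (?X \<otimes> K) \<cdot> (\<one> (W \<otimes> Z) \<odot> ?r)"
    using assms by simp
  also have "\<dots> = (asc M W Z ?X \<odot> \<one> K) \<cdot> (asc' (W \<otimes> Z) ?X K \<cdot> asc' W Z (?X \<otimes> K))
      \<cdot> asc M W Z (?X \<otimes> K) \<cdot> (\<one> (W \<otimes> Z) \<odot> ?r)"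
    using assms by (simp only: pentagon' comonoid_simps comodule_simps)
  also have "\<dots> = (asc M W Z ?X \<odot> \<one> K) \<cdot> asc' (W \<otimes> Z) ?X K \<cdot> (\<one> (W \<otimes> Z) \<odot> ?r)"
    using assms by simp
  finally show ?thesis
    using assms by (simp add: comodule_map_iff ten_def hom_iff)
qed

lemma asc'_lun:
  assumes "X \<in> Obj M" "Y \<in> Obj M"
  shows "(lun M X \<odot> \<one> Y) \<cdot> asc' \<I> X Y = lun M (X \<otimes> Y)"
  using assms by (simp flip: lun_tensor)

lemma comodule_map_lun:
  assumes "comodule M C x"
  shows "comodule_map M C (ten \<I> x) x (lun M (fst x))"
proof -
  have "(lun M (fst x) \<odot> \<one> K) \<cdot> asc' \<I> (fst x) K \<cdot> (\<one> \<I> \<odot> snd x)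
      = ((lun M (fst x) \<odot> \<one> K) \<cdot> asc' \<I> (fst x) K) \<cdot> (\<one> \<I> \<odot> snd x)"
    using assms by simp
  also have "\<dots> = snd x \<cdot> lun M (fst x)"
    using assms by (simp only: asc'_lun comonoid_simps comodule_simps) (simp add: lun_nat)
  finally show ?thesis
    using assms by (simp add: comodule_map_iff ten_def hom_iff)
qed

section \<open>Hom objects of comodules\<close>

lemma T_act_simps [simp]:
  assumes "X \<in> Obj M" "Y \<in> Obj M"
  shows "T_act M C X Y \<in> Arr M" "src M (T_act M C X Y) = \<lbrakk>X, Y\<rbrakk>"
    "trg M (T_act M C X Y) = \<lbrakk>X \<otimes> K, Y \<otimes> K\<rbrakk>"
    "flat (X \<otimes> K) (Y \<otimes> K) (T_act M C X Y) = (ev M X Y \<odot> \<one> K) \<cdot> asc' \<lbrakk>X, Y\<rbrakk> X K"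
  using assms by (simp_all add: T_act_def)

lemma flat_T_act:
  assumes "X \<in> Obj M" "Y \<in> Obj M" "p \<in> Arr M" "trg M p = \<lbrakk>X, Y\<rbrakk>"
  shows "flat (X \<otimes> K) (Y \<otimes> K) (T_act M C X Y \<cdot> p) = (flat X Y p \<odot> \<one> K) \<cdot> asc' (src M p) X K"
  using assms by (simp add: flat_cmp flat_def[of _ _ p] asc_nats)

definition comod_fst :: "'o \<times> 'a \<Rightarrow> 'o \<times> 'a \<Rightarrow> 'a"
  where "comod_fst x y = ihom_post M (fst x) (snd y)"

definition comod_snd :: "'o \<times> 'a \<Rightarrow> 'o \<times> 'a \<Rightarrow> 'a"
  where "comod_snd x y = ihom_pre M (snd x) (fst y \<otimes> K) \<cdot> T_act M C (fst x) (fst y)"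

lemma comod_incl_eq: "comod_incl M C x y = equaliser M (comod_fst x y) (comod_snd x y)"
  by (simp add: comod_incl_def comod_fst_def comod_snd_def case_prod_beta)

lemma comod_pair_in:
  assumes "comodule M C x" "comodule M C y"
  shows "comod_fst x y \<in> hom \<lbrakk>fst x, fst y\<rbrakk> \<lbrakk>fst x, fst y \<otimes> K\<rbrakk>"
    "comod_snd x y \<in> hom \<lbrakk>fst x, fst y\<rbrakk> \<lbrakk>fst x, fst y \<otimes> K\<rbrakk>"
  using assms by (simp_all add: comod_fst_def comod_snd_def hom_iff)

text \<open>Uncurrying the two composites yields the two sides of the comodule map equation for
  \<open>ten Z x\<close>. Hence the equaliser represents parametrised comodule maps.\<close>

lemma comod_pair_iff:
  assumes "comodule M C x" "comodule M C y" "p \<in> hom Z \<lbrakk>fst x, fst y\<rbrakk>"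
  shows "comod_fst x y \<cdot> p = comod_snd x y \<cdot> p
    \<longleftrightarrow> comodule_map M C (ten Z x) y (flat (fst x) (fst y) p)"
proof -
  let ?X = "fst x" and ?Y = "fst y"
  have 1: "flat ?X (?Y \<otimes> K) (comod_fst x y \<cdot> p) = snd y \<cdot> flat ?X ?Y p"
    using assms flat_post[of ?X "snd y" "?Y \<otimes> K" p] by (simp add: comod_fst_def hom_iff)
  have 2: "flat ?X (?Y \<otimes> K) (comod_snd x y \<cdot> p)
      = (flat ?X ?Y p \<odot> \<one> K) \<cdot> asc' Z ?X K \<cdot> (\<one> Z \<odot> snd x)"
    using assms flat_pre[of "?Y \<otimes> K" "snd x" ?X "T_act M C ?X ?Y \<cdot> p"]
    by (simp add: comod_snd_def hom_iff flat_T_act)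
  have "comod_fst x y \<cdot> p = comod_snd x y \<cdot> p
      \<longleftrightarrow> flat ?X (?Y \<otimes> K) (comod_fst x y \<cdot> p) = flat ?X (?Y \<otimes> K) (comod_snd x y \<cdot> p)"
    using flat_inj[of ?X "?Y \<otimes> K" "comod_fst x y \<cdot> p" "comod_snd x y \<cdot> p" Z]
      comod_pair_in[OF assms(1,2)] assms by (auto simp: hom_iff)
  then show ?thesis
    unfolding 1 2 using assms by (simp add: comodule_map_iff ten_def hom_iff)
qed

text \<open>Postcomposition with the counit of T is the common left inverse that existence requires:
  on one arrow it cancels by the counit law of \<open>y\<close>, on the other by naturality of
  \<open>eps\<close> and the counit law of \<open>x\<close>.\<close>

lemma comod_incl_equaliser:
  assumes "comodule M C x" "comodule M C y"
  shows "is_equaliser M (comod_fst x y) (comod_snd x y) (comod_incl M C x y)"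
proof -
  let ?X = "fst x" and ?Y = "fst y"
  let ?h = "ihom_post M ?X (eps ?Y)"
  have 1: "flat ?X ?Y (?h \<cdot> comod_fst x y) = ev M ?X ?Y"
  proof -
    have "flat ?X ?Y (?h \<cdot> comod_fst x y) = eps ?Y \<cdot> snd y \<cdot> ev M ?X ?Y"
      using assms flat_post[of ?X "eps ?Y" ?Y "comod_fst x y"]
        ihom_post_simps(4)[of ?X "snd y"] by (simp add: comod_fst_def)
    also have "\<dots> = (eps ?Y \<cdot> snd y) \<cdot> ev M ?X ?Y"
      using assms by (simp del: comodule_simps(6))
    finally show ?thesis
      using assms by simp
  qed
  have 2: "flat ?X ?Y (?h \<cdot> comod_snd x y) = ev M ?X ?Y"
  proof -
    have "flat ?X ?Y (?h \<cdot> comod_snd x y)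
        = eps ?Y \<cdot> (ev M ?X ?Y \<odot> \<one> K) \<cdot> asc' \<lbrakk>?X, ?Y\<rbrakk> ?X K \<cdot> (\<one> \<lbrakk>?X, ?Y\<rbrakk> \<odot> snd x)"
      using assms flat_post[of ?X "eps ?Y" ?Y "comod_snd x y"]
        flat_pre[of "?Y \<otimes> K" "snd x" ?X "T_act M C ?X ?Y"]
      by (simp add: comod_snd_def)
    also have "\<dots> = ev M ?X ?Y"
      using assms by (simp add: eps_nat_post eps_tensor)
    finally show ?thesis .
  qed
  have "?h \<cdot> comod_fst x y = \<one> \<lbrakk>?X, ?Y\<rbrakk>" "?h \<cdot> comod_snd x y = \<one> \<lbrakk>?X, ?Y\<rbrakk>"
    by (rule flat_inj[of ?X ?Y _ _ "\<lbrakk>?X, ?Y\<rbrakk>"];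
      use 1 2 assms comod_pair_in[OF assms] in \<open>simp add: hom_iff\<close>)+
  then have "\<exists>e. is_equaliser M (comod_fst x y) (comod_snd x y) e"
    using assms by (intro equalisers[OF comod_pair_in] bexI[of _ ?h]) (simp_all add: hom_iff)
  then show ?thesis
    unfolding comod_incl_eq equaliser_def by (rule someI_ex)
qed

lemma comod_incl_in:
  assumes "comodule M C x" "comodule M C y"
  shows "comod_incl M C x y \<in> hom (comod_hom M C x y) \<lbrakk>fst x, fst y\<rbrakk>"
    "comod_fst x y \<cdot> comod_incl M C x y = comod_snd x y \<cdot> comod_incl M C x y"
  using comod_incl_equaliser[OF assms] comod_pair_in[OF assms]
  by (simp_all add: is_equaliser_def comod_hom_def hom_iff)

lemma comod_incl_factor:
  assumes "comodule M C x" "comodule M C y" "Z \<in> Obj M" "comodule_map M C (ten Z x) y h"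
  shows "\<exists>p \<in> hom Z (comod_hom M C x y). comod_incl M C x y \<cdot> p = transpose M Z (fst x) (fst y) h"
proof -
  let ?t = "transpose M Z (fst x) (fst y) h"
  have h: "h \<in> hom (Z \<otimes> fst x) (fst y)"
    using assms by (simp add: comodule_map_iff ten_def)
  then have t: "?t \<in> hom Z \<lbrakk>fst x, fst y\<rbrakk>" "flat (fst x) (fst y) ?t = h"
    using assms by (simp_all add: hom_iff)
  then have "comod_fst x y \<cdot> ?t = comod_snd x y \<cdot> ?t"
    using comod_pair_iff[OF assms(1,2) t(1)] assms(4) by simp
  from equaliser_factor[OF comod_incl_equaliser comod_pair_in(1) t(1) this] show ?thesis
    using assms(1,2) unfolding comod_hom_def by blast
qed

lemma hom_ten_simps [simp]:
  assumes "comodule M C x" "Z \<in> Obj M"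
  shows "fst (ten Z x) = Z \<otimes> fst x" "snd (ten Z x) \<in> hom (Z \<otimes> fst x) ((Z \<otimes> fst x) \<otimes> K)"
  using assms by (simp_all add: ten_def hom_iff)

sublocale comod: parametrised_homs M "comod_cat M C" fst
  "\<lambda>x y Z h. comodule_map M C (ten Z x) y h" "comod_incl M C"
proof unfold_locales
  fix x y assume x: "x \<in> eobj (comod_cat M C)"
  then have x': "comodule M C x"
    by (simp add: comod_cat_def)
  show "fst x \<in> Obj M"
    using x' by simp
  show "comodule_map M C (ten \<I> x) x (lun M (fst x))"
    by (rule comodule_map_lun[OF x'])
  assume y: "y \<in> eobj (comod_cat M C)"
  then have y': "comodule M C y"
    by (simp add: comod_cat_def)
  have e: "ehom (comod_cat M C) x y = comod_hom M C x y"
    by (simp add: comod_cat_def)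
  note i = comod_incl_in[OF x' y']
  show "comod_incl M C x y \<in> hom (ehom (comod_cat M C) x y) \<lbrakk>fst x, fst y\<rbrakk>"
    unfolding e by (rule i)
  {
    fix Z p assume p: "p \<in> hom Z (ehom (comod_cat M C) x y)"
    have "comod_fst x y \<cdot> comod_incl M C x y \<cdot> p = comod_snd x y \<cdot> comod_incl M C x y \<cdot> p"
      by (rule cmp_cong_post[OF i(2)])
        (use i(1) p comod_pair_in[OF x' y'] in \<open>simp_all add: hom_iff e\<close>)
    then show "comodule_map M C (ten Z x) y (flat (fst x) (fst y) (comod_incl M C x y \<cdot> p))"
      using p i(1) by (subst comod_pair_iff[OF x' y', symmetric]) (simp_all add: hom_iff e)
    fix p' assume p': "p' \<in> hom Z (ehom (comod_cat M C) x y)"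
      and eq: "comod_incl M C x y \<cdot> p = comod_incl M C x y \<cdot> p'"
    show "p = p'"
      by (rule equaliser_monic[OF comod_incl_equaliser[OF x' y'] comod_pair_in[OF x' y'] _ _ eq])
        (use p p' e in \<open>simp_all add: comod_hom_def\<close>)
  next
    fix Z h assume "Z \<in> Obj M" "comodule_map M C (ten Z x) y h"
    then show "\<exists>p \<in> hom Z (ehom (comod_cat M C) x y).
        comod_incl M C x y \<cdot> p = transpose M Z (fst x) (fst y) h"
      unfolding e using comod_incl_factor[OF x' y'] by blast
  next
    fix w W Z h k assume w: "w \<in> eobj (comod_cat M C)" and Z: "Z \<in> Obj M" "W \<in> Obj M"
      and h: "comodule_map M C (ten Z x) y h" and k: "comodule_map M C (ten W y) w k"
    have w': "comodule M C w"
      using w by (simp add: comod_cat_def)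
    note t = comodule_ten[OF _ x'] comodule_ten[OF _ y']
    \<comment> \<open>The inner map is tensored with \<open>W\<close>, which makes it a map between
      the tensored comodules; the associator then merges the two parameters.\<close>
    have "comodule_map M C (ten W (ten Z x)) w (k \<cdot> (\<one> W \<odot> h))"
      by (rule comodule_map_cmp[OF comodule_map_ten[OF h] k])
        (use Z w' x' y' t in \<open>simp_all add: comodule_ten\<close>)
    from comodule_map_cmp[OF comodule_map_asc[OF Z(2,1) x'] this]
    have "comodule_map M C (ten (W \<otimes> Z) x) w ((k \<cdot> (\<one> W \<odot> h)) \<cdot> asc M W Z (fst x))"
      using Z w' x' by (simp add: comodule_ten)
    then show "comodule_map M C (ten (W \<otimes> Z) x) w (k \<cdot> (\<one> W \<odot> h) \<cdot> asc M W Z (fst x))"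
      using Z h k x' y' w' by (simp add: comodule_map_iff hom_iff)
  }
qed (simp_all add: comod_cat_def)

section \<open>Contramodules\<close>

text \<open>\<open>str Z X Y h : Z \<otimes> F X \<rightarrow> F Y\<close> is \<open>F h\<close> preceded by the strength of \<open>F\<close>.\<close>

definition str :: "'o \<Rightarrow> 'o \<Rightarrow> 'o \<Rightarrow> 'a \<Rightarrow> 'a"
  where "str Z X Y h
    = transpose M (Z \<otimes> \<lbrakk>K, X\<rbrakk>) K Y (h \<cdot> (\<one> Z \<odot> ev M K X) \<cdot> asc M Z \<lbrakk>K, X\<rbrakk> K)"

text \<open>Stated with the strength because \<open>Z \<otimes> X\<close> inherits no evident
  contramodule structure: the strength leads from \<open>Z \<otimes> F X\<close> to
  \<open>F (Z \<otimes> X)\<close>, the wrong direction for an analogue of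
  \<open>ten\<close>.\<close>

definition contra_par :: "'o \<times> 'a \<Rightarrow> 'o \<times> 'a \<Rightarrow> 'o \<Rightarrow> 'a \<Rightarrow> bool"
  where "contra_par x y Z h \<longleftrightarrow> h \<in> hom (Z \<otimes> fst x) (fst y) \<and>
    h \<cdot> (\<one> Z \<odot> snd x) = snd y \<cdot> str Z (fst x) (fst y) h"

text \<open>With \<open>free_unit\<close> below, the multiplication and unit of the monad
  \<open>F X = \<lbrakk>K, X\<rbrakk>\<close>.\<close>

definition free_mult :: "'o \<Rightarrow> 'a"
  where "free_mult X = ihom_pre M \<Delta> X \<cdot> ihom_uncurry M K K X"

definition free_unit :: "'o \<Rightarrow> 'a"
  where "free_unit X = ihom_pre M \<epsilon> X \<cdot> ihom_unit M X"

lemma str_simps [simp]: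
  assumes "Z \<in> Obj M" "X \<in> Obj M" "h \<in> Arr M" "src M h = Z \<otimes> X" "trg M h = Y"
  shows "str Z X Y h \<in> Arr M" "src M (str Z X Y h) = Z \<otimes> \<lbrakk>K, X\<rbrakk>" "trg M (str Z X Y h) = \<lbrakk>K, Y\<rbrakk>"
    "flat K Y (str Z X Y h) = h \<cdot> (\<one> Z \<odot> ev M K X) \<cdot> asc M Z \<lbrakk>K, X\<rbrakk> K"
  using assms by (simp_all add: str_def)

lemma free_simps [simp]:
  assumes "X \<in> Obj M"
  shows "free_mult X \<in> Arr M" "src M (free_mult X) = \<lbrakk>K, \<lbrakk>K, X\<rbrakk>\<rbrakk>" "trg M (free_mult X) = \<lbrakk>K, X\<rbrakk>"
    "free_unit X \<in> Arr M" "src M (free_unit X) = X" "trg M (free_unit X) = \<lbrakk>K, X\<rbrakk>"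
  using assms by (simp_all add: free_mult_def free_unit_def)

text \<open>The multiplication of F and the comultiplication of T are mates under the adjunction
  between T and F: uncurrying twice trades one for the other. \<open>flat_free_unit\<close> says the
  same of unit and counit.\<close>

lemma flat_free_mult:
  assumes "X \<in> Obj M" "t \<in> Arr M" "trg M t = \<lbrakk>K, \<lbrakk>K, X\<rbrakk>\<rbrakk>"
  shows "flat K X (free_mult X \<cdot> t) = flat K X (flat K \<lbrakk>K, X\<rbrakk> t) \<cdot> \<delta> (src M t)"
  using assms by (simp add: free_mult_def flat_pre flat_uncurry \<delta>_def)

lemma flat_free_unit:
  assumes "X \<in> Obj M" "z \<in> Arr M" "trg M z = X"
  shows "flat K X (free_unit X \<cdot> z) = z \<cdot> eps (src M z)"
  using assms flat_cmp[of "\<I>" X "ihom_unit M X" z]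
  by (simp add: free_unit_def flat_pre run_nat run_nat_post eps_def)

lemma flat_free_unit_ident:
  assumes "X \<in> Obj M"
  shows "flat K X (free_unit X) = eps X"
  using flat_free_unit[of X "\<one> X"] assms by simp

lemma free_contramodule_eq: "free_contramodule M C X = (\<lbrakk>K, X\<rbrakk>, free_mult X)"
  by (simp add: free_contramodule_def free_mult_def)

lemma contramodule_iff:
  "contramodule M C (X, \<theta>) \<longleftrightarrow> X \<in> Obj M \<and> \<theta> \<in> hom \<lbrakk>K, X\<rbrakk> X \<and>
    \<theta> \<cdot> ihom_post M K \<theta> = \<theta> \<cdot> free_mult X \<and> \<theta> \<cdot> free_unit X = \<one> X"
  by (simp add: contramodule_def free_mult_def free_unit_def)

lemma contramodule_simps [simp]:
  assumes "contramodule M C x"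
  shows "fst x \<in> Obj M" "snd x \<in> Arr M" "src M (snd x) = \<lbrakk>K, fst x\<rbrakk>" "trg M (snd x) = fst x"
    "snd x \<cdot> free_unit (fst x) = \<one> (fst x)"
  using assms contramodule_iff[of "fst x" "snd x"] by (simp_all add: hom_iff)

lemma F_act_simps [simp]:
  assumes "X \<in> Obj M" "Y \<in> Obj M"
  shows "F_act M C X Y \<in> Arr M" "src M (F_act M C X Y) = \<lbrakk>X, Y\<rbrakk>"
    "trg M (F_act M C X Y) = \<lbrakk>\<lbrakk>K, X\<rbrakk>, \<lbrakk>K, Y\<rbrakk>\<rbrakk>"
    "flat \<lbrakk>K, X\<rbrakk> \<lbrakk>K, Y\<rbrakk> (F_act M C X Y) = ihom_cmp M K X Y"
  using assms by (simp_all add: F_act_def)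

text \<open>Links the enriched action of F in the definition of hom objects to the strength; both
  sides have the same uncurrying by \<open>flat_ihom_cmp\<close>.\<close>

lemma flat_F_act:
  assumes "X \<in> Obj M" "Y \<in> Obj M" "p \<in> Arr M" "trg M p = \<lbrakk>X, Y\<rbrakk>"
  shows "flat \<lbrakk>K, X\<rbrakk> \<lbrakk>K, Y\<rbrakk> (F_act M C X Y \<cdot> p) = str (src M p) X Y (flat X Y p)"
proof (rule flat_inj[of K Y _ _ "src M p \<otimes> \<lbrakk>K, X\<rbrakk>"])
  show "flat K Y (flat \<lbrakk>K, X\<rbrakk> \<lbrakk>K, Y\<rbrakk> (F_act M C X Y \<cdot> p)) = flat K Y (str (src M p) X Y (flat X Y p))"
    using assms flat_ihom_cmp[of K X Y p "\<one> \<lbrakk>K, X\<rbrakk>"]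
    by (simp add: flat_cmp[of "\<lbrakk>K, X\<rbrakk>" "\<lbrakk>K, Y\<rbrakk>"])
qed (use assms in \<open>simp_all add: hom_iff\<close>)

lemma contra_par_lun:
  assumes "contramodule M C x"
  shows "contra_par x x \<I> (lun M (fst x))"
proof -
  let ?X = "fst x"
  have "str \<I> ?X ?X (lun M ?X) = lun M \<lbrakk>K, ?X\<rbrakk>"
  proof (rule flat_inj[of K ?X _ _ "\<I> \<otimes> \<lbrakk>K, ?X\<rbrakk>"])
    show "flat K ?X (str \<I> ?X ?X (lun M ?X)) = flat K ?X (lun M \<lbrakk>K, ?X\<rbrakk>)"
      using assms by (simp add: lun_nat_post lun_tensor) (simp add: flat_def)
  qed (use assms in \<open>simp_all add: hom_iff\<close>)
  then show ?thesis
    using assms by (simp add: contra_par_def hom_iff lun_nat)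
qed

text \<open>After uncurrying, the strengths on the right are evaluated one after the other by their
  defining equation, and what remains is the pentagon for
  \<open>W, Z, \<lbrakk>K, X\<rbrakk>, K\<close>.\<close>

lemma str_cmp:
  assumes "X \<in> Obj M" "Z \<in> Obj M" "W \<in> Obj M" "h \<in> hom (Z \<otimes> X) Y" "k \<in> hom (W \<otimes> Y) V"
  shows "str (W \<otimes> Z) X V (k \<cdot> (\<one> W \<odot> h) \<cdot> asc M W Z X)
    = str W Y V k \<cdot> (\<one> W \<odot> str Z X Y h) \<cdot> asc M W Z \<lbrakk>K, X\<rbrakk>"
proof (rule flat_inj[of K V _ _ "(W \<otimes> Z) \<otimes> \<lbrakk>K, X\<rbrakk>"])
  let ?s = "str Z X Y h"
  have e: "ev M K Y \<cdot> (?s \<odot> \<one> K) = h \<cdot> (\<one> Z \<odot> ev M K X) \<cdot> asc M Z \<lbrakk>K, X\<rbrakk> K"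
    using assms by (simp add: hom_iff flip: flat_def)
  have "flat K V (str W Y V k \<cdot> (\<one> W \<odot> ?s) \<cdot> asc M W Z \<lbrakk>K, X\<rbrakk>)
      = k \<cdot> (\<one> W \<odot> ev M K Y) \<cdot> asc M W \<lbrakk>K, Y\<rbrakk> K \<cdot> ((\<one> W \<odot> ?s) \<odot> \<one> K) \<cdot> (asc M W Z \<lbrakk>K, X\<rbrakk> \<odot> \<one> K)"
    using assms by (simp add: hom_iff flat_cmp)
  also have "\<dots> = k \<cdot> (\<one> W \<odot> ev M K Y) \<cdot> (\<one> W \<odot> ?s \<odot> \<one> K) \<cdot> asc M W (Z \<otimes> \<lbrakk>K, X\<rbrakk>) K
      \<cdot> (asc M W Z \<lbrakk>K, X\<rbrakk> \<odot> \<one> K)"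
    using assms by (subst asc_nat_post) (simp_all add: hom_iff)
  also have "\<dots> = k \<cdot> (\<one> W \<odot> h) \<cdot> (\<one> W \<odot> \<one> Z \<odot> ev M K X) \<cdot> (\<one> W \<odot> asc M Z \<lbrakk>K, X\<rbrakk> K)
      \<cdot> asc M W (Z \<otimes> \<lbrakk>K, X\<rbrakk>) K \<cdot> (asc M W Z \<lbrakk>K, X\<rbrakk> \<odot> \<one> K)"
    using assms by (simp add: hom_iff e)
  also have "\<dots> = k \<cdot> (\<one> W \<odot> h) \<cdot> (\<one> W \<odot> \<one> Z \<odot> ev M K X) \<cdot> asc M W Z (\<lbrakk>K, X\<rbrakk> \<otimes> K)
      \<cdot> asc M (W \<otimes> Z) \<lbrakk>K, X\<rbrakk> K"
    using assms by (simp only: pentagon ihom_Obj comonoid_simps)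
  also have "\<dots> = flat K V (str (W \<otimes> Z) X V (k \<cdot> (\<one> W \<odot> h) \<cdot> asc M W Z X))"
    using assms by (simp add: hom_iff asc_nats)
  finally show "flat K V (str (W \<otimes> Z) X V (k \<cdot> (\<one> W \<odot> h) \<cdot> asc M W Z X))
    = flat K V (str W Y V k \<cdot> (\<one> W \<odot> ?s) \<cdot> asc M W Z \<lbrakk>K, X\<rbrakk>)" ..
qed (use assms in \<open>simp_all add: hom_iff\<close>)

lemma contra_par_cmp:
  assumes "contramodule M C x" "contramodule M C y" "contramodule M C w" "Z \<in> Obj M" "W \<in> Obj M"
    "contra_par x y Z h" "contra_par y w W k"
  shows "contra_par x w (W \<otimes> Z) (k \<cdot> (\<one> W \<odot> h) \<cdot> asc M W Z (fst x))"
proof -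
  have h: "h \<in> hom (Z \<otimes> fst x) (fst y)" "h \<cdot> (\<one> Z \<odot> snd x) = snd y \<cdot> str Z (fst x) (fst y) h"
    and k: "k \<in> hom (W \<otimes> fst y) (fst w)" "k \<cdot> (\<one> W \<odot> snd y) = snd w \<cdot> str W (fst y) (fst w) k"
    using assms by (simp_all add: contra_par_def)
  have "(k \<cdot> (\<one> W \<odot> h) \<cdot> asc M W Z (fst x)) \<cdot> (\<one> (W \<otimes> Z) \<odot> snd x)
      = k \<cdot> (\<one> W \<odot> (h \<cdot> (\<one> Z \<odot> snd x))) \<cdot> asc M W Z \<lbrakk>K, fst x\<rbrakk>"
    using h(1) k(1) assms(1-5) by (simp add: hom_iff asc_nats)
  also have "\<dots> = (k \<cdot> (\<one> W \<odot> snd y)) \<cdot> (\<one> W \<odot> str Z (fst x) (fst y) h) \<cdot> asc M W Z \<lbrakk>K, fst x\<rbrakk>"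
    unfolding h(2) using h(1) k(1) assms(1-5) by (simp add: hom_iff)
  also have "\<dots> = snd w \<cdot> str (W \<otimes> Z) (fst x) (fst w) (k \<cdot> (\<one> W \<odot> h) \<cdot> asc M W Z (fst x))"
    unfolding k(2) using h(1) k(1) assms(1-5) by (simp add: str_cmp[of _ _ _ _ "fst y"]) (simp add: hom_iff)
  finally show ?thesis
    using h(1) k(1) assms(1-5) by (simp add: contra_par_def hom_iff)
qed

section \<open>Hom objects of contramodules\<close>

definition contra_fst :: "'o \<times> 'a \<Rightarrow> 'o \<times> 'a \<Rightarrow> 'a"
  where "contra_fst x y = ihom_post M \<lbrakk>K, fst x\<rbrakk> (snd y) \<cdot> F_act M C (fst x) (fst y)"

definition contra_snd :: "'o \<times> 'a \<Rightarrow> 'o \<times> 'a \<Rightarrow> 'a"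
  where "contra_snd x y = ihom_pre M (snd x) (fst y)"

lemma contra_incl_eq: "contra_incl M C x y = equaliser M (contra_fst x y) (contra_snd x y)"
  by (simp add: contra_incl_def contra_fst_def contra_snd_def case_prod_beta)

lemma contra_pair_in:
  assumes "contramodule M C x" "contramodule M C y"
  shows "contra_fst x y \<in> hom \<lbrakk>fst x, fst y\<rbrakk> \<lbrakk>\<lbrakk>K, fst x\<rbrakk>, fst y\<rbrakk>"
    "contra_snd x y \<in> hom \<lbrakk>fst x, fst y\<rbrakk> \<lbrakk>\<lbrakk>K, fst x\<rbrakk>, fst y\<rbrakk>"
  using assms by (simp_all add: contra_fst_def contra_snd_def hom_iff)

lemma flat_contra_pair:
  assumes "contramodule M C x" "contramodule M C y" "p \<in> hom Z \<lbrakk>fst x, fst y\<rbrakk>"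
  shows "flat \<lbrakk>K, fst x\<rbrakk> (fst y) (contra_fst x y \<cdot> p)
      = snd y \<cdot> str Z (fst x) (fst y) (flat (fst x) (fst y) p)"
    "flat \<lbrakk>K, fst x\<rbrakk> (fst y) (contra_snd x y \<cdot> p) = flat (fst x) (fst y) p \<cdot> (\<one> Z \<odot> snd x)"
  using assms flat_post[of "\<lbrakk>K, fst x\<rbrakk>" "snd y" "fst y" "F_act M C (fst x) (fst y) \<cdot> p"]
    flat_pre[of "fst y" "snd x" "\<lbrakk>K, fst x\<rbrakk>" p]
  by (simp_all add: contra_fst_def contra_snd_def hom_iff flat_F_act)

lemma contra_pair_iff:
  assumes "contramodule M C x" "contramodule M C y" "p \<in> hom Z \<lbrakk>fst x, fst y\<rbrakk>"
  shows "contra_fst x y \<cdot> p = contra_snd x y \<cdot> p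
    \<longleftrightarrow> contra_par x y Z (flat (fst x) (fst y) p)"
proof -
  let ?f = "flat \<lbrakk>K, fst x\<rbrakk> (fst y)"
  have "contra_fst x y \<cdot> p = contra_snd x y \<cdot> p
      \<longleftrightarrow> ?f (contra_fst x y \<cdot> p) = ?f (contra_snd x y \<cdot> p)"
    using flat_inj[of "\<lbrakk>K, fst x\<rbrakk>" "fst y" "contra_fst x y \<cdot> p" "contra_snd x y \<cdot> p" Z]
      contra_pair_in[OF assms(1,2)] assms by (auto simp: hom_iff)
  then show ?thesis
    unfolding flat_contra_pair[OF assms] using assms by (auto simp: contra_par_def hom_iff)
qed

text \<open>The common left inverse is precomposition with the unit of F. On one arrow it cancels by
  the unit law of \<open>x\<close>; on the other the strength first carries the unit across, and
  then the unit law of \<open>y\<close> applies.\<close>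

lemma contra_incl_equaliser:
  assumes "contramodule M C x" "contramodule M C y"
  shows "is_equaliser M (contra_fst x y) (contra_snd x y) (contra_incl M C x y)"
proof -
  let ?X = "fst x" and ?Y = "fst y"
  let ?E = "\<lbrakk>?X, ?Y\<rbrakk>"
  let ?h = "ihom_pre M (free_unit ?X) ?Y"
  note c = flat_contra_pair[OF assms, of "\<one> ?E" ?E]
  have "flat ?X ?Y (?h \<cdot> contra_snd x y) = ev M ?X ?Y"
  proof -
    have "flat ?X ?Y (?h \<cdot> contra_snd x y)
        = (ev M ?X ?Y \<cdot> (\<one> ?E \<odot> snd x)) \<cdot> (\<one> ?E \<odot> free_unit ?X)"
      using assms c(2) contra_pair_in[OF assms] flat_pre[of ?Y "free_unit ?X" ?X "contra_snd x y"]
      by (simp add: hom_iff)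
    then show ?thesis
      using assms by simp
  qed
  moreover have "flat ?X ?Y (?h \<cdot> contra_fst x y) = ev M ?X ?Y"
  proof -
    let ?s = "str ?E ?X ?Y (ev M ?X ?Y)"
    have e: "ev M K ?X \<cdot> (free_unit ?X \<odot> \<one> K) = eps ?X"
      using assms by (simp add: flat_free_unit_ident flip: flat_def)
    \<comment> \<open>The unit of F is compatible with the strength; uncurried, both sides are
      \<open>eps\<close> followed or preceded by evaluation.\<close>
    have "?s \<cdot> (\<one> ?E \<odot> free_unit ?X) = free_unit ?Y \<cdot> ev M ?X ?Y"
    proof (rule flat_inj[of K ?Y _ _ "?E \<otimes> ?X"])
      show "flat K ?Y (?s \<cdot> (\<one> ?E \<odot> free_unit ?X)) = flat K ?Y (free_unit ?Y \<cdot> ev M ?X ?Y)"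
        using assms e by (simp add: flat_free_unit) (simp add: flat_cmp asc_nats eps_tensor)
    qed (use assms in \<open>simp_all add: hom_iff\<close>)
    note s = this
    have "flat ?X ?Y (?h \<cdot> contra_fst x y) = snd y \<cdot> ?s \<cdot> (\<one> ?E \<odot> free_unit ?X)"
      using assms c(1) contra_pair_in[OF assms] flat_pre[of ?Y "free_unit ?X" ?X "contra_fst x y"]
      by (simp add: hom_iff)
    also have "\<dots> = (snd y \<cdot> free_unit ?Y) \<cdot> ev M ?X ?Y"
      unfolding s using assms by (simp del: contramodule_simps(5))
    also have "\<dots> = ev M ?X ?Y"
      using assms by simp
    finally show ?thesis .
  qed
  ultimately have "?h \<cdot> contra_fst x y = \<one> ?E" "?h \<cdot> contra_snd x y = \<one> ?E"
    by - (rule flat_inj[of ?X ?Y _ _ ?E];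
      use assms contra_pair_in[OF assms] in \<open>simp add: hom_iff\<close>)+
  then have "\<exists>e. is_equaliser M (contra_fst x y) (contra_snd x y) e"
    using assms by (intro equalisers[OF contra_pair_in] bexI[of _ ?h]) (simp_all add: hom_iff)
  then show ?thesis
    unfolding contra_incl_eq equaliser_def by (rule someI_ex)
qed

lemma contra_incl_in:
  assumes "contramodule M C x" "contramodule M C y"
  shows "contra_incl M C x y \<in> hom (contra_hom M C x y) \<lbrakk>fst x, fst y\<rbrakk>"
    "contra_fst x y \<cdot> contra_incl M C x y = contra_snd x y \<cdot> contra_incl M C x y"
  using contra_incl_equaliser[OF assms] contra_pair_in[OF assms]
  by (simp_all add: is_equaliser_def contra_hom_def hom_iff)

lemma contra_incl_factor:
  assumes "contramodule M C x" "contramodule M C y" "Z \<in> Obj M" "contra_par x y Z h"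
  shows "\<exists>p \<in> hom Z (contra_hom M C x y). contra_incl M C x y \<cdot> p = transpose M Z (fst x) (fst y) h"
proof -
  let ?t = "transpose M Z (fst x) (fst y) h"
  have h: "h \<in> hom (Z \<otimes> fst x) (fst y)"
    using assms by (simp add: contra_par_def)
  then have t: "?t \<in> hom Z \<lbrakk>fst x, fst y\<rbrakk>" "flat (fst x) (fst y) ?t = h"
    using assms by (simp_all add: hom_iff)
  then have "contra_fst x y \<cdot> ?t = contra_snd x y \<cdot> ?t"
    using contra_pair_iff[OF assms(1,2) t(1)] assms(4) by simp
  from equaliser_factor[OF contra_incl_equaliser contra_pair_in(1) t(1) this] show ?thesis
    using assms(1,2) unfolding contra_hom_def by blast
qed

sublocale contra: parametrised_homs M "contra_cat M C" fst contra_par "contra_incl M C"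
proof unfold_locales
  fix x y assume x: "x \<in> eobj (contra_cat M C)"
  then have x': "contramodule M C x"
    by (simp add: contra_cat_def)
  show "fst x \<in> Obj M"
    using x' by simp
  show "contra_par x x \<I> (lun M (fst x))"
    by (rule contra_par_lun[OF x'])
  assume y: "y \<in> eobj (contra_cat M C)"
  then have y': "contramodule M C y"
    by (simp add: contra_cat_def)
  have e: "ehom (contra_cat M C) x y = contra_hom M C x y"
    by (simp add: contra_cat_def)
  note i = contra_incl_in[OF x' y']
  show "contra_incl M C x y \<in> hom (ehom (contra_cat M C) x y) \<lbrakk>fst x, fst y\<rbrakk>"
    unfolding e by (rule i)
  {
    fix Z p assume p: "p \<in> hom Z (ehom (contra_cat M C) x y)"
    have "contra_fst x y \<cdot> contra_incl M C x y \<cdot> p = contra_snd x y \<cdot> contra_incl M C x y \<cdot> p"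
      by (rule cmp_cong_post[OF i(2)])
        (use i(1) p contra_pair_in[OF x' y'] in \<open>simp_all add: hom_iff e\<close>)
    then show "contra_par x y Z (flat (fst x) (fst y) (contra_incl M C x y \<cdot> p))"
      using p i(1) by (subst contra_pair_iff[OF x' y', symmetric]) (simp_all add: hom_iff e)
    fix p' assume p': "p' \<in> hom Z (ehom (contra_cat M C) x y)"
      and eq: "contra_incl M C x y \<cdot> p = contra_incl M C x y \<cdot> p'"
    show "p = p'"
      by (rule equaliser_monic[OF contra_incl_equaliser[OF x' y'] contra_pair_in[OF x' y'] _ _ eq])
        (use p p' e in \<open>simp_all add: contra_hom_def\<close>)
  next
    fix Z h assume "Z \<in> Obj M" "contra_par x y Z h"
    then show "\<exists>p \<in> hom Z (ehom (contra_cat M C) x y).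
        contra_incl M C x y \<cdot> p = transpose M Z (fst x) (fst y) h"
      unfolding e using contra_incl_factor[OF x' y'] by blast
  next
    fix w W Z h k assume w: "w \<in> eobj (contra_cat M C)" and Z: "Z \<in> Obj M" "W \<in> Obj M"
      and h: "contra_par x y Z h" and k: "contra_par y w W k"
    have w': "contramodule M C w"
      using w by (simp add: contra_cat_def)
    show "contra_par x w (W \<otimes> Z) (k \<cdot> (\<one> W \<odot> h) \<cdot> asc M W Z (fst x))"
      by (rule contra_par_cmp[OF x' y' w' Z h k])
  }
qed (simp_all add: contra_cat_def)

lemma cat_simps [simp]:
  "x \<in> eobj (comod_cat M C) \<longleftrightarrow> comodule M C x"
  "x \<in> eobj (contra_cat M C) \<longleftrightarrow> contramodule M C x"
  by (simp_all add: comod_cat_def contra_cat_def)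

lemma ehom_eq:
  "ehom (comod_cat M C) x y = comod_hom M C x y"
  "ehom (contra_cat M C) x y = contra_hom M C x y"
  by (simp_all add: comod_cat_def contra_cat_def)

section \<open>The functors on objects\<close>

abbreviation L_pair :: "'o \<times> 'a \<Rightarrow> 'a"
  where "L_pair x \<equiv> (ev M K (fst x) \<odot> \<one> K) \<cdot> \<delta> \<lbrakk>K, fst x\<rbrakk>"

text \<open>The unit of F, tensored with \<open>K\<close>, is a common right inverse. For the first
  arrow this is the unit law of \<open>x\<close>; for the second, evaluation after the unit is
  \<open>eps\<close>, and a counit law of T remains.\<close>

lemma L_proj_coequaliser:
  assumes "contramodule M C x"
  shows "is_coequaliser M (snd x \<odot> \<one> K) (L_pair x) (L_proj M C x)"
proof -
  let ?X = "fst x"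
  let ?h = "free_unit ?X \<odot> \<one> K"
  have e: "ev M K ?X \<cdot> (free_unit ?X \<odot> \<one> K) = eps ?X"
    using assms by (simp add: flat_free_unit_ident flip: flat_def)
  have "L_pair x \<cdot> ?h = (eps ?X \<odot> \<one> K) \<cdot> \<delta> ?X"
    using assms by (simp add: delta_nat e)
  then have "L_pair x \<cdot> ?h = \<one> (?X \<otimes> K)"
    using assms by (simp add: delta_eqs)
  then have "\<exists>q. is_coequaliser M (snd x \<odot> \<one> K) (L_pair x) q"
    using assms by (intro coequalisers[of _ "\<lbrakk>K, ?X\<rbrakk> \<otimes> K" "?X \<otimes> K"] bexI[of _ ?h]) (simp_all add: hom_iff)
  moreover have "L_proj M C x = coequaliser M (snd x \<odot> \<one> K) (L_pair x)"
    by (simp add: L_proj_def case_prod_beta \<delta>_def)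
  ultimately show ?thesis
    unfolding coequaliser_def by (metis someI_ex)
qed

lemma L_pair_in:
  assumes "contramodule M C x"
  shows "snd x \<odot> \<one> K \<in> hom (\<lbrakk>K, fst x\<rbrakk> \<otimes> K) (fst x \<otimes> K)"
    "L_pair x \<in> hom (\<lbrakk>K, fst x\<rbrakk> \<otimes> K) (fst x \<otimes> K)"
  using assms by (simp_all add: hom_iff)

lemma L_proj_simps [simp]:
  assumes "contramodule M C x"
  shows "L_proj M C x \<in> Arr M" "src M (L_proj M C x) = fst x \<otimes> K"
  using L_proj_coequaliser[OF assms] assms by (simp_all add: is_coequaliser_def hom_iff)

lemma L_proj_eq:
  assumes "contramodule M C x"
  shows "L_proj M C x \<cdot> (snd x \<odot> \<one> K) = L_proj M C x \<cdot> L_pair x"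
  using L_proj_coequaliser[OF assms] by (simp add: is_coequaliser_def)

lemma L_proj_epic:
  assumes "contramodule M C x" "h \<in> hom (trg M (L_proj M C x)) Z" "h' \<in> hom (trg M (L_proj M C x)) Z"
    "h \<cdot> L_proj M C x = h' \<cdot> L_proj M C x"
  shows "h = h'"
  using coequaliser_epic[OF L_proj_coequaliser L_pair_in] assms by blast

lemma L_proj_factor:
  assumes "contramodule M C x" "h \<in> hom (fst x \<otimes> K) Z" "h \<cdot> (snd x \<odot> \<one> K) = h \<cdot> L_pair x"
  shows "\<exists>k \<in> hom (trg M (L_proj M C x)) Z. k \<cdot> L_proj M C x = h"
  using coequaliser_factor[OF L_proj_coequaliser L_pair_in(1)] assms by blast

lemma fst_L_obj [simp]: "fst (L_obj M C x) = trg M (L_proj M C x)"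
  by (simp add: L_obj_def)

text \<open>The composite \<open>?h\<close> of the comultiplication with \<open>T ?q\<close>
  coequalises the defining pair, by naturality of \<open>\<delta>\<close>, the equation for
  \<open>?q\<close> tensored with \<open>K\<close>, and coassociativity. It thus descends to a
  coaction, whose axioms hold after precomposition with the epimorphism \<open>?q\<close>.\<close>

lemma L_obj:
  assumes x: "contramodule M C x"
  shows "comodule M C (L_obj M C x)"
    "snd (L_obj M C x) \<cdot> L_proj M C x = (L_proj M C x \<odot> \<one> K) \<cdot> \<delta> (fst x)"
proof -
  let ?X = "fst x" and ?q = "L_proj M C x"
  let ?F = "\<lbrakk>K, ?X\<rbrakk>" and ?L = "trg M ?q" and ?h = "(?q \<odot> \<one> K) \<cdot> \<delta> ?X"
  have h: "?h \<in> hom (?X \<otimes> K) (?L \<otimes> K)"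
    using x by (simp add: hom_iff)
  have "?h \<cdot> (snd x \<odot> \<one> K) = ((?q \<cdot> (snd x \<odot> \<one> K)) \<odot> \<one> K) \<cdot> \<delta> ?F"
    using x by (simp add: delta_nat)
  also have "\<dots> = ((?q \<cdot> (ev M K ?X \<odot> \<one> K)) \<odot> \<one> K) \<cdot> (\<delta> ?F \<odot> \<one> K) \<cdot> \<delta> ?F"
    unfolding L_proj_eq[OF x] using x by simp
  also have "\<dots> = ?h \<cdot> L_pair x"
    using x by (simp add: delta_eqs delta_nat_post)
  finally obtain \<rho> where \<rho>: "\<rho> \<in> hom ?L (?L \<otimes> K)" "\<rho> \<cdot> ?q = ?h"
    using L_proj_factor[OF x h] by blast
  have "(\<rho> \<odot> \<one> K) \<cdot> \<rho> = \<delta> ?L \<cdot> \<rho>"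
  proof (rule L_proj_epic[OF x, where Z = "(?L \<otimes> K) \<otimes> K"])
    have "((\<rho> \<odot> \<one> K) \<cdot> \<rho>) \<cdot> ?q = ((\<rho> \<cdot> ?q) \<odot> \<one> K) \<cdot> \<delta> ?X"
      using x \<rho> by (simp add: hom_iff)
    also have "\<dots> = ((?q \<odot> \<one> K) \<odot> \<one> K) \<cdot> (\<delta> ?X \<odot> \<one> K) \<cdot> \<delta> ?X"
      unfolding \<rho>(2) using x by simp
    also have "\<dots> = \<delta> ?L \<cdot> ?h"
      using x by (simp add: delta_eqs delta_nat_post)
    also have "\<dots> = (\<delta> ?L \<cdot> \<rho>) \<cdot> ?q"
      using x \<rho> by (simp add: hom_iff)
    finally show "((\<rho> \<odot> \<one> K) \<cdot> \<rho>) \<cdot> ?q = (\<delta> ?L \<cdot> \<rho>) \<cdot> ?q" .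
  qed (use x \<rho>(1) in \<open>simp_all add: hom_iff\<close>)
  moreover have "eps ?L \<cdot> \<rho> = \<one> ?L"
  proof (rule L_proj_epic[OF x, where Z = ?L])
    show "(eps ?L \<cdot> \<rho>) \<cdot> ?q = \<one> ?L \<cdot> ?q"
      using x \<rho> by (simp add: hom_iff eps_nat_post delta_eqs)
  qed (use x \<rho>(1) in \<open>simp_all add: hom_iff\<close>)
  ultimately have c: "comodule M C (?L, \<rho>)"
    using x \<rho>(1) by (simp add: comodule_iff)
  \<comment> \<open>The property in the definite description of \<open>L_obj\<close>. Its comodule
    map clause fixes the coaction after \<open>?q\<close>, hence altogether.\<close>
  define Q where "Q \<rho>' \<longleftrightarrow> comodule M C (?L, \<rho>') \<and>
      comodule_map M C (cofree_comodule M C ?X) (?L, \<rho>') ?q" for \<rho>'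
  have "Q \<rho>"
    using x c \<rho> by (simp add: Q_def comodule_map_iff cofree_comodule_eq hom_iff)
  moreover have "\<rho>' = \<rho>" if "Q \<rho>'" for \<rho>'
    using that \<rho> x L_proj_epic[OF x, of \<rho>' "?L \<otimes> K" \<rho>]
    by (auto simp: Q_def comodule_map_iff cofree_comodule_eq comodule_iff)
  ultimately have "(THE \<rho>'. Q \<rho>') = \<rho>"
    by (rule the_equality)
  then have "L_obj M C x = (?L, \<rho>)"
    by (simp add: L_obj_def Q_def)
  then show "comodule M C (L_obj M C x)" "snd (L_obj M C x) \<cdot> ?q = (?q \<odot> \<one> K) \<cdot> \<delta> ?X"
    using c \<rho> by simp_all
qed

lemma L_obj_simps [simp]:
  assumes "contramodule M C x"
  shows "comodule M C (L_obj M C x)" "snd (L_obj M C x) \<in> Arr M"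
    "src M (snd (L_obj M C x)) = trg M (L_proj M C x)"
    "trg M (snd (L_obj M C x)) = trg M (L_proj M C x) \<otimes> K"
  using L_obj(1)[OF assms] comodule_simps[OF L_obj(1)[OF assms]] by simp_all

section \<open>The functor R on objects\<close>

abbreviation kappa ("\<kappa>") where "\<kappa> \<equiv> (K, \<Delta>)"

lemma comodule_kappa [simp]: "comodule M C \<kappa>"
  using comonoid by (simp add: comonoid_def comodule_def)

lemma ten_kappa [simp]: "ten Z \<kappa> = (Z \<otimes> K, \<delta> Z)"
  by (simp add: ten_def \<delta>_def)

text \<open>The carrier of \<open>R y\<close> is the hom object out of C, so an arrow
  \<open>Z \<rightarrow> R y\<close> corresponds to a comodule map
  \<open>T Z \<rightarrow> y\<close> from the cofree comodule. \<open>hat\<close> is this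
  correspondence.\<close>

abbreviation hat :: "'o \<times> 'a \<Rightarrow> 'a \<Rightarrow> 'a"
  where "hat \<equiv> comod.el \<kappa>"

abbreviation R_carr :: "'o \<times> 'a \<Rightarrow> 'o"
  where "R_carr y \<equiv> ehom (comod_cat M C) \<kappa> y"

lemma R_carr_Obj [simp]: "comodule M C y \<Longrightarrow> R_carr y \<in> Obj M"
  using comod.incl_simps(4)[of \<kappa> y] by simp

lemma src_R_incl: "src M (R_incl M C y) = R_carr y"
  by (simp add: R_incl_def ehom_eq comod_hom_def)

lemma fst_R_obj [simp]: "fst (R_obj M C y) = R_carr y"
  by (simp add: R_obj_def src_R_incl)

lemma R_incl_simps [simp]:
  assumes "comodule M C y"
  shows "R_incl M C y \<in> Arr M" "src M (R_incl M C y) = R_carr y" "trg M (R_incl M C y) = \<lbrakk>K, fst y\<rbrakk>"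
  using assms comod.incl_simps[of \<kappa> y] by (simp_all add: R_incl_def)

lemma hat_eq: "hat y t = flat K (fst y) (R_incl M C y \<cdot> t)"
  by (simp add: comod.el_def R_incl_def)

lemma hat_simps [simp]:
  assumes "comodule M C y" "p \<in> Arr M" "trg M p = R_carr y"
  shows "hat y p \<in> Arr M" "src M (hat y p) = src M p \<otimes> K" "trg M (hat y p) = fst y"
  using comod.el_simps[of \<kappa> y p] assms by simp_all

lemma hat_cmp:
  assumes "comodule M C y" "p \<in> Arr M" "trg M p = R_carr y" "z \<in> Arr M" "trg M z = src M p"
  shows "hat y (p \<cdot> z) = hat y p \<cdot> (z \<odot> \<one> K)"
  using comod.el_cmp[of \<kappa> y p z] assms by simp

lemma hat_ident_cmp:
  assumes "comodule M C y" "p \<in> Arr M" "trg M p = R_carr y"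
  shows "hat y (\<one> (R_carr y)) \<cdot> (p \<odot> \<one> K) = hat y p"
  using hat_cmp[of y "\<one> (R_carr y)" p] assms by simp

lemma hat_inj:
  assumes "hat y p = hat y p'" "comodule M C y" "p \<in> hom Z (R_carr y)" "p' \<in> hom Z (R_carr y)"
  shows "p = p'"
  using comod.el_inj[of \<kappa> y p Z p'] assms by simp

lemma hat_surj:
  assumes "comodule M C y" "Z \<in> Obj M" "comodule_map M C (Z \<otimes> K, \<delta> Z) y u"
  shows "\<exists>p \<in> hom Z (R_carr y). hat y p = u"
  using comod.el_surj[of \<kappa> y Z u] assms by (simp add: comodule_map_iff)

lemma hat_comodule_map:
  assumes "comodule M C y" "p \<in> hom Z (R_carr y)"
  shows "comodule_map M C (Z \<otimes> K, \<delta> Z) y (hat y p)"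
  using comod.el_P[of \<kappa> y p Z] assms by simp

text \<open>Through \<open>hat\<close> the contramodule laws become coassociativity and a counit law
  of T. The second claim, for arbitrary \<open>t\<close>, is the only description of the structure
  arrow used afterwards.\<close>

lemma R_obj:
  assumes y: "comodule M C y"
  shows "contramodule M C (R_obj M C y)"
    "\<And>t. \<lbrakk>t \<in> Arr M; trg M t = \<lbrakk>K, R_carr y\<rbrakk>\<rbrakk>
      \<Longrightarrow> hat y (snd (R_obj M C y) \<cdot> t) = hat y (flat K (R_carr y) t) \<cdot> \<delta> (src M t)"
proof -
  let ?R = "R_carr y" and ?i = "R_incl M C y"
  let ?F = "\<lbrakk>K, ?R\<rbrakk>" and ?e = "ev M K ?R"
  \<comment> \<open>The comodule map that the structure arrow must correspond to: comultiply on
    \<open>T F R y\<close>, apply T to the evaluation, and end with the universal map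
    \<open>T R y \<rightarrow> y\<close>.\<close>
  have "comodule_map M C (?F \<otimes> K, \<delta> ?F) y (hat y ?e \<cdot> \<delta> ?F)"
  proof (rule comodule_map_cmp)
    show "comodule_map M C (?F \<otimes> K, \<delta> ?F) ((?F \<otimes> K) \<otimes> K, \<delta> (?F \<otimes> K)) (\<delta> ?F)"
      using y by (simp add: comodule_map_iff delta_eqs hom_iff)
    show "comodule_map M C ((?F \<otimes> K) \<otimes> K, \<delta> (?F \<otimes> K)) y (hat y ?e)"
      using y by (intro hat_comodule_map) (simp_all add: hom_iff)
  qed (use y comodule_cofree in simp_all)
  then obtain \<theta> where \<theta>: "\<theta> \<in> hom ?F ?R" "hat y \<theta> = hat y ?e \<cdot> \<delta> ?F"
    using hat_surj[OF y, of ?F "hat y ?e \<cdot> \<delta> ?F"] y by auto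
  have t: "hat y (\<theta> \<cdot> t) = hat y (flat K ?R t) \<cdot> \<delta> (src M t)" if "t \<in> Arr M" "trg M t = ?F" for t
  proof -
    have "hat y (\<theta> \<cdot> t) = hat y ?e \<cdot> \<delta> ?F \<cdot> (t \<odot> \<one> K)"
      using that \<theta> y by (simp add: hat_cmp hom_iff)
    also have "\<dots> = hat y ?e \<cdot> ((t \<odot> \<one> K) \<odot> \<one> K) \<cdot> \<delta> (src M t)"
      using that by (simp add: delta_nat)
    also have "\<dots> = hat y (flat K ?R t) \<cdot> \<delta> (src M t)"
      using that y by (simp add: flat_def hat_cmp)
    finally show ?thesis .
  qed
  have "\<theta> \<cdot> ihom_post M K \<theta> = \<theta> \<cdot> free_mult ?R"
  proof (rule hat_inj[OF _ y, of _ _ "\<lbrakk>K, ?F\<rbrakk>"])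
    have f: "flat K ?R (ihom_post M K \<theta>) = \<theta> \<cdot> ev M K ?F"
      using ihom_post_simps(4)[of K \<theta>] \<theta>(1) by (simp add: hom_iff del: ihom_post_simps(4))
    have g: "flat K ?R (free_mult ?R) = flat K ?R (ev M K ?F) \<cdot> \<delta> \<lbrakk>K, ?F\<rbrakk>"
      using flat_free_mult[of ?R "\<one> \<lbrakk>K, ?F\<rbrakk>"] y by simp
    have "hat y (\<theta> \<cdot> ihom_post M K \<theta>)
        = hat y (flat K ?R (ev M K ?F)) \<cdot> \<delta> (\<lbrakk>K, ?F\<rbrakk> \<otimes> K) \<cdot> \<delta> \<lbrakk>K, ?F\<rbrakk>"
      using y \<theta>(1) by (simp add: t f hom_iff)
    also have "\<dots> = hat y (\<theta> \<cdot> free_mult ?R)"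
      using y \<theta>(1) by (simp add: t g hat_cmp delta_eqs flip: delta_eqs(1))
    finally show "hat y (\<theta> \<cdot> ihom_post M K \<theta>) = hat y (\<theta> \<cdot> free_mult ?R)" .
  qed (use y \<theta>(1) in \<open>simp_all add: hom_iff\<close>)
  moreover have "\<theta> \<cdot> free_unit ?R = \<one> ?R"
  proof (rule hat_inj[OF _ y, of _ _ ?R])
    have "hat y (\<theta> \<cdot> free_unit ?R) = (hat y (\<one> ?R) \<cdot> (eps ?R \<odot> \<one> K)) \<cdot> \<delta> ?R"
      using y by (simp only: hat_ident_cmp delta_simps R_carr_Obj) (simp add: t flat_free_unit_ident)
    also have "\<dots> = hat y (\<one> ?R)"
      using y by (simp add: delta_eqs)
    finally show "hat y (\<theta> \<cdot> free_unit ?R) = hat y (\<one> ?R)" .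
  qed (use y \<theta>(1) in \<open>simp_all add: hom_iff\<close>)
  ultimately have c: "contramodule M C (?R, \<theta>)"
    using y \<theta>(1) by (simp add: contramodule_iff)
  have fi: "flat K (fst y) (free_mult (fst y) \<cdot> ihom_post M K ?i) = hat y ?e \<cdot> \<delta> ?F"
    using y ihom_post_simps(4)[of K ?i] by (simp add: flat_free_mult hat_eq)
  \<comment> \<open>The inclusion respects the structure arrows. The same equation determines
    \<open>\<theta>\<close>, because \<open>hat\<close> is computed through \<open>?i\<close> and is
    injective.\<close>
  have i: "?i \<cdot> \<theta> = free_mult (fst y) \<cdot> ihom_post M K ?i"
    by (rule flat_inj[of K "fst y" _ _ ?F])
      (use y \<theta> fi in \<open>simp_all add: hom_iff flip: hat_eq\<close>)
  define Q where "Q \<theta>' \<longleftrightarrow> contramodule M C (?R, \<theta>') \<and>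
      contramodule_map M C (?R, \<theta>') (free_contramodule M C (fst y)) ?i" for \<theta>'
  have "Q \<theta>"
    using y c i by (simp add: Q_def contramodule_map_def free_contramodule_eq hom_iff)
  moreover have "\<theta>' = \<theta>" if "Q \<theta>'" for \<theta>'
  proof (rule hat_inj[OF _ y, of _ _ ?F])
    show "hat y \<theta>' = hat y \<theta>"
      using that i by (simp add: Q_def contramodule_map_def free_contramodule_eq hat_eq)
    show "\<theta>' \<in> hom ?F ?R"
      using that by (simp add: Q_def contramodule_iff)
  qed (rule \<theta>)
  ultimately have "(THE \<theta>'. Q \<theta>') = \<theta>"
    by (rule the_equality)
  then have R: "R_obj M C y = (?R, \<theta>)"
    by (simp add: R_obj_def Q_def src_R_incl)
  show "contramodule M C (R_obj M C y)"
    using c R by simp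
  show "hat y (snd (R_obj M C y) \<cdot> t) = hat y (flat K ?R t) \<cdot> \<delta> (src M t)"
    if "t \<in> Arr M" "trg M t = ?F" for t
    using t[OF that] R by simp
qed

lemma R_obj_simps [simp]:
  assumes "comodule M C y"
  shows "contramodule M C (R_obj M C y)" "snd (R_obj M C y) \<in> Arr M"
    "src M (snd (R_obj M C y)) = \<lbrakk>K, R_carr y\<rbrakk>" "trg M (snd (R_obj M C y)) = R_carr y"
  using R_obj(1)[OF assms] contramodule_simps[OF R_obj(1)[OF assms]] by simp_all

section \<open>Balanced maps\<close>

text \<open>
  Parametrised comodule maps \<open>Z \<otimes> L x \<rightarrow> y\<close> and parametrised contramodule maps \<open>Z \<otimes> x \<rightarrow> R y\<close> are
  both the same as balanced comodule maps from the cofree comodule \<open>(Z \<otimes> X) \<otimes> K\<close> to \<open>y\<close>.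
\<close>

definition balanced :: "'o \<times> 'a \<Rightarrow> 'o \<Rightarrow> 'a \<Rightarrow> bool"
  where "balanced x Z u \<longleftrightarrow> u \<cdot> ((\<one> Z \<odot> snd x) \<odot> \<one> K)
    = u \<cdot> (((\<one> Z \<odot> ev M K (fst x)) \<cdot> asc M Z \<lbrakk>K, fst x\<rbrakk> K) \<odot> \<one> K) \<cdot> \<delta> (Z \<otimes> \<lbrakk>K, fst x\<rbrakk>)"

text \<open>Applying the injective \<open>hat\<close> to the contramodule map equation gives the two
  sides of \<open>balanced\<close>: the left by naturality, the right by the description of the
  structure of \<open>R y\<close> and the defining equation of the strength.\<close>

lemma contra_par_R_iff:
  assumes x: "contramodule M C x" and y: "comodule M C y" and Z: "Z \<in> Obj M"
    and h: "h \<in> hom (Z \<otimes> fst x) (R_carr y)"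
  shows "contra_par x (R_obj M C y) Z h \<longleftrightarrow> balanced x Z (hat y h)"
proof -
  let ?F = "\<lbrakk>K, fst x\<rbrakk>"
  let ?l = "h \<cdot> (\<one> Z \<odot> snd x)" and ?r = "snd (R_obj M C y) \<cdot> str Z (fst x) (R_carr y) h"
  have "contra_par x (R_obj M C y) Z h \<longleftrightarrow> hat y ?l = hat y ?r"
    using hat_inj[OF _ y, of ?l ?r "Z \<otimes> ?F"] x y Z h by (auto simp: contra_par_def hom_iff)
  moreover have "hat y ?l = hat y h \<cdot> ((\<one> Z \<odot> snd x) \<odot> \<one> K)"
    using x y Z h by (simp add: hat_cmp hom_iff)
  moreover have "hat y ?r = hat y h \<cdot> (((\<one> Z \<odot> ev M K (fst x)) \<cdot> asc M Z ?F K) \<odot> \<one> K) \<cdot> \<delta> (Z \<otimes> ?F)"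
    using x y Z h by (subst R_obj(2)[OF y]) (simp_all add: hat_cmp hom_iff)
  ultimately show ?thesis
    by (simp add: balanced_def)
qed

text \<open>Pulls a map out of \<open>Z \<otimes> L x\<close> back to the cofree comodule on
  \<open>Z \<otimes> X\<close>, where it can be compared with the image under \<open>hat\<close> of
  a map into \<open>R y\<close>.\<close>

definition unfold_L :: "'o \<times> 'a \<Rightarrow> 'o \<Rightarrow> 'a \<Rightarrow> 'a"
  where "unfold_L x Z g = g \<cdot> (\<one> Z \<odot> L_proj M C x) \<cdot> asc M Z (fst x) K"

lemma unfold_L_simps [simp]:
  assumes "contramodule M C x" "Z \<in> Obj M" "g \<in> Arr M" "src M g = Z \<otimes> trg M (L_proj M C x)"
  shows "unfold_L x Z g \<in> Arr M" "src M (unfold_L x Z g) = (Z \<otimes> fst x) \<otimes> K"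
    "trg M (unfold_L x Z g) = trg M g"
  using assms by (simp_all add: unfold_L_def)

lemma tensor_L_epic:
  assumes x: "contramodule M C x" and Z: "Z \<in> Obj M"
    and g: "g \<in> hom (Z \<otimes> trg M (L_proj M C x)) V" "g' \<in> hom (Z \<otimes> trg M (L_proj M C x)) V"
    and eq: "g \<cdot> (\<one> Z \<odot> L_proj M C x) = g' \<cdot> (\<one> Z \<odot> L_proj M C x)"
  shows "g = g'"
  using tensor_coequaliser_epic[OF L_proj_coequaliser[OF x] L_pair_in[OF x] g Z eq] .

lemma unfold_L_inj:
  assumes x: "contramodule M C x" and Z: "Z \<in> Obj M"
    and g: "g \<in> hom (Z \<otimes> trg M (L_proj M C x)) V" "g' \<in> hom (Z \<otimes> trg M (L_proj M C x)) V"
    and eq: "unfold_L x Z g = unfold_L x Z g'"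
  shows "g = g'"
proof (rule tensor_L_epic[OF x Z g])
  show "g \<cdot> (\<one> Z \<odot> L_proj M C x) = g' \<cdot> (\<one> Z \<odot> L_proj M C x)"
    by (rule asc_epic[of _ Z "fst x" K V])
      (use x Z g eq in \<open>simp_all add: unfold_L_def hom_iff\<close>)
qed

lemma unfold_L_cmp:
  assumes "contramodule M C x" "Z \<in> Obj M" "g \<in> Arr M" "src M g = Z \<otimes> trg M (L_proj M C x)"
    "z \<in> hom W Z"
  shows "unfold_L x W (g \<cdot> (z \<odot> \<one> (trg M (L_proj M C x)))) = unfold_L x Z g \<cdot> ((z \<odot> \<one> (fst x)) \<odot> \<one> K)"
  using assms by (simp add: unfold_L_def hom_iff asc_nats)

lemma asc_delta:
  assumes "Z \<in> Obj M" "X \<in> Obj M"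
  shows "asc M Z (X \<otimes> K) K \<cdot> (asc M Z X K \<odot> \<one> K) \<cdot> \<delta> (Z \<otimes> X) = (\<one> Z \<odot> \<delta> X) \<cdot> asc M Z X K"
proof -
  have "asc M Z (X \<otimes> K) K \<cdot> (asc M Z X K \<odot> \<one> K) \<cdot> \<delta> (Z \<otimes> X)
      = asc M Z (X \<otimes> K) K \<cdot> (asc M Z X K \<odot> \<one> K) \<cdot> (\<delta> (Z \<otimes> X) \<cdot> asc' Z X K) \<cdot> asc M Z X K"
    using assms by simp
  also have "\<dots> = (\<one> Z \<odot> \<delta> X) \<cdot> asc M Z X K"
    unfolding delta_tensor[OF assms] using assms by simp
  finally show ?thesis .
qed

text \<open>Rebracketing by the invertible associator, with \<open>asc_delta\<close> for the
  comultiplication, turns \<open>balanced\<close> into the condition of coequalising the pair of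
  \<open>L x\<close> tensored with \<open>Z\<close>.\<close>

lemma balanced_iff:
  assumes x: "contramodule M C x" and Z: "Z \<in> Obj M" and h: "h \<in> hom (Z \<otimes> fst x \<otimes> K) V"
  shows "balanced x Z (h \<cdot> asc M Z (fst x) K)
    \<longleftrightarrow> h \<cdot> (\<one> Z \<odot> snd x \<odot> \<one> K) = h \<cdot> (\<one> Z \<odot> L_pair x)"
proof -
  let ?F = "\<lbrakk>K, fst x\<rbrakk>"
  have 1: "(h \<cdot> asc M Z (fst x) K) \<cdot> ((\<one> Z \<odot> snd x) \<odot> \<one> K)
      = (h \<cdot> (\<one> Z \<odot> snd x \<odot> \<one> K)) \<cdot> asc M Z ?F K"
    using x Z h by (simp add: hom_iff asc_nats)
  have "(h \<cdot> asc M Z (fst x) K) \<cdot> (((\<one> Z \<odot> ev M K (fst x)) \<cdot> asc M Z ?F K) \<odot> \<one> K) \<cdot> \<delta> (Z \<otimes> ?F)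
      = h \<cdot> asc M Z (fst x) K \<cdot> ((\<one> Z \<odot> ev M K (fst x)) \<odot> \<one> K) \<cdot> (asc M Z ?F K \<odot> \<one> K) \<cdot> \<delta> (Z \<otimes> ?F)"
    using x Z h by (simp add: hom_iff)
  also have "\<dots> = h \<cdot> (\<one> Z \<odot> ev M K (fst x) \<odot> \<one> K) \<cdot> asc M Z (?F \<otimes> K) K
      \<cdot> (asc M Z ?F K \<odot> \<one> K) \<cdot> \<delta> (Z \<otimes> ?F)"
    using x Z h by (subst asc_nat_post) (simp_all add: hom_iff)
  also have "\<dots> = (h \<cdot> (\<one> Z \<odot> L_pair x)) \<cdot> asc M Z ?F K"
    using x Z h by (simp add: asc_delta hom_iff)
  finally have 2: "(h \<cdot> asc M Z (fst x) K) \<cdot> (((\<one> Z \<odot> ev M K (fst x)) \<cdot> asc M Z ?F K) \<odot> \<one> K) \<cdot> \<delta> (Z \<otimes> ?F)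
      = (h \<cdot> (\<one> Z \<odot> L_pair x)) \<cdot> asc M Z ?F K" .
  have "h \<cdot> (\<one> Z \<odot> snd x \<odot> \<one> K) \<in> hom (Z \<otimes> ?F \<otimes> K) V" "h \<cdot> (\<one> Z \<odot> L_pair x) \<in> hom (Z \<otimes> ?F \<otimes> K) V"
    using x Z h by (simp_all add: hom_iff)
  from asc_epic[OF this] show ?thesis
    unfolding balanced_def 1 2 using x Z by (metis comonoid_simps(1) contramodule_simps(1) ihom_Obj)
qed

lemma comodule_map_L_proj:
  assumes "contramodule M C x"
  shows "comodule_map M C (fst x \<otimes> K, \<delta> (fst x)) (L_obj M C x) (L_proj M C x)"
  using L_obj[OF assms] assms by (simp add: comodule_map_iff hom_iff)

text \<open>The associator is the case \<open>\<kappa>\<close> of \<open>comodule_map_asc\<close>,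
  and the second factor is the comodule map \<open>L_proj\<close> tensored with
  \<open>Z\<close>.\<close>

lemma comodule_map_tensor_L_proj:
  assumes "contramodule M C x" "Z \<in> Obj M"
  shows "comodule_map M C ((Z \<otimes> fst x) \<otimes> K, \<delta> (Z \<otimes> fst x)) (ten Z (L_obj M C x))
    ((\<one> Z \<odot> L_proj M C x) \<cdot> asc M Z (fst x) K)"
proof (rule comodule_map_cmp)
  show "comodule_map M C ((Z \<otimes> fst x) \<otimes> K, \<delta> (Z \<otimes> fst x)) (ten Z (fst x \<otimes> K, \<delta> (fst x))) (asc M Z (fst x) K)"
    using comodule_map_asc[of Z "fst x" \<kappa>] assms by simp
  show "comodule_map M C (ten Z (fst x \<otimes> K, \<delta> (fst x))) (ten Z (L_obj M C x)) (\<one> Z \<odot> L_proj M C x)"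
    using comodule_map_ten[OF comodule_map_L_proj[OF assms(1)]] comodule_cofree assms by simp
qed (use assms comodule_cofree comodule_ten in simp_all)

lemma unfold_L:
  assumes x: "contramodule M C x" and y: "comodule M C y" and Z: "Z \<in> Obj M"
    and g: "comodule_map M C (ten Z (L_obj M C x)) y g"
  shows "comodule_map M C ((Z \<otimes> fst x) \<otimes> K, \<delta> (Z \<otimes> fst x)) y (unfold_L x Z g)"
    "balanced x Z (unfold_L x Z g)"
proof -
  let ?q = "L_proj M C x"
  have g': "g \<in> hom (Z \<otimes> trg M ?q) (fst y)"
    using g x Z by (simp add: comodule_map_iff ten_def)
  show "comodule_map M C ((Z \<otimes> fst x) \<otimes> K, \<delta> (Z \<otimes> fst x)) y (unfold_L x Z g)"
    unfolding unfold_L_def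
    using comodule_map_cmp[OF comodule_map_tensor_L_proj g] x y Z comodule_cofree comodule_ten by simp
  have "(g \<cdot> (\<one> Z \<odot> ?q)) \<cdot> (\<one> Z \<odot> snd x \<odot> \<one> K) = (g \<cdot> (\<one> Z \<odot> ?q)) \<cdot> (\<one> Z \<odot> L_pair x)"
    using x Z g' L_proj_eq[OF x] by (simp add: hom_iff)
  then have "balanced x Z ((g \<cdot> (\<one> Z \<odot> ?q)) \<cdot> asc M Z (fst x) K)"
    using x Z g' by (subst balanced_iff[of _ _ _ "fst y"]) (simp_all add: hom_iff)
  then show "balanced x Z (unfold_L x Z g)"
    using x Z g' by (simp add: unfold_L_def hom_iff)
qed

text \<open>Being balanced yields a factorisation through \<open>Z \<otimes> L x\<close> in the base
  category, since \<open>Z \<otimes> -\<close> preserves the coequaliser. Compatibility of the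
  factor with the coactions is established separately.\<close>

lemma unfold_L_surj:
  assumes x: "contramodule M C x" and y: "comodule M C y" and Z: "Z \<in> Obj M"
    and u: "comodule_map M C ((Z \<otimes> fst x) \<otimes> K, \<delta> (Z \<otimes> fst x)) y u" "balanced x Z u"
  shows "\<exists>g. comodule_map M C (ten Z (L_obj M C x)) y g \<and> unfold_L x Z g = u"
proof -
  let ?q = "L_proj M C x" and ?X = "fst x" and ?l = "L_obj M C x"
  let ?L = "trg M ?q"
  have u': "u \<in> hom ((Z \<otimes> ?X) \<otimes> K) (fst y)" "snd y \<cdot> u = (u \<odot> \<one> K) \<cdot> \<delta> (Z \<otimes> ?X)"
    using u by (simp_all add: comodule_map_iff)
  let ?h = "u \<cdot> asc' Z ?X K"
  have h: "?h \<in> hom (Z \<otimes> ?X \<otimes> K) (fst y)" "?h \<cdot> asc M Z ?X K = u"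
    using u' x Z by (simp_all add: hom_iff)
  then have "?h \<cdot> (\<one> Z \<odot> snd x \<odot> \<one> K) = ?h \<cdot> (\<one> Z \<odot> L_pair x)"
    using balanced_iff[OF x Z h(1)] u(2) by simp
  from tensor_coequaliser_factor[OF L_proj_coequaliser[OF x] L_pair_in[OF x] h(1) this Z]
  obtain g where g: "g \<in> hom (Z \<otimes> ?L) (fst y)" "g \<cdot> (\<one> Z \<odot> ?q) = ?h"
    by blast
  have gu: "unfold_L x Z g = u"
  proof -
    have "unfold_L x Z g = (g \<cdot> (\<one> Z \<odot> ?q)) \<cdot> asc M Z ?X K"
      using g(1) x Z by (simp add: unfold_L_def hom_iff)
    then show ?thesis
      unfolding g(2) h(2) .
  qed
  \<comment> \<open>Tested after precomposition with the epimorphism out of the cofree comodule,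
    where it follows from the comodule map equations of \<open>u\<close> and of
    \<open>?m\<close>.\<close>
  have "snd y \<cdot> g = (g \<odot> \<one> K) \<cdot> snd (ten Z ?l)"
  proof (rule unfold_L_inj[OF x Z])
    let ?m = "(\<one> Z \<odot> ?q) \<cdot> asc M Z ?X K"
    have m: "snd (ten Z ?l) \<cdot> ?m = (?m \<odot> \<one> K) \<cdot> \<delta> (Z \<otimes> ?X)"
      using comodule_map_tensor_L_proj[OF x Z] by (simp add: comodule_map_iff)
    have t: "snd (ten Z ?l) \<in> hom (Z \<otimes> ?L) ((Z \<otimes> ?L) \<otimes> K)"
      using hom_ten_simps(2)[of ?l Z] x Z by simp
    have "unfold_L x Z (snd y \<cdot> g) = snd y \<cdot> unfold_L x Z g"
      using x y Z g(1) by (simp add: unfold_L_def hom_iff)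
    also have "\<dots> = ((g \<cdot> ?m) \<odot> \<one> K) \<cdot> \<delta> (Z \<otimes> ?X)"
      unfolding gu u'(2) by (simp add: unfold_L_def flip: gu)
    also have "\<dots> = (g \<odot> \<one> K) \<cdot> (?m \<odot> \<one> K) \<cdot> \<delta> (Z \<otimes> ?X)"
      using x y Z g(1) by (simp add: hom_iff)
    also have "\<dots> = (g \<odot> \<one> K) \<cdot> snd (ten Z ?l) \<cdot> ?m"
      unfolding m ..
    also have "\<dots> = unfold_L x Z ((g \<odot> \<one> K) \<cdot> snd (ten Z ?l))"
      using x y Z g(1) t by (simp add: unfold_L_def hom_iff)
    finally show "unfold_L x Z (snd y \<cdot> g) = unfold_L x Z ((g \<odot> \<one> K) \<cdot> snd (ten Z ?l))" .
    show "snd y \<cdot> g \<in> hom (Z \<otimes> ?L) (fst y \<otimes> K)" "(g \<odot> \<one> K) \<cdot> snd (ten Z ?l) \<in> hom (Z \<otimes> ?L) (fst y \<otimes> K)"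
      using x y Z g(1) t by (simp_all add: hom_iff)
  qed
  then have "comodule_map M C (ten Z ?l) y g"
    using g(1) x Z by (simp add: comodule_map_iff ten_def)
  with gu show ?thesis
    by blast
qed

section \<open>The functors on hom objects\<close>

lemma contra_el_R_simps [simp]:
  assumes "contramodule M C x" "comodule M C y" "p \<in> Arr M" "trg M p = ehom (contra_cat M C) x (R_obj M C y)"
  shows "contra.el x (R_obj M C y) p \<in> Arr M" "src M (contra.el x (R_obj M C y) p) = src M p \<otimes> fst x"
    "trg M (contra.el x (R_obj M C y) p) = R_carr y"
  using contra.el_simps[of x "R_obj M C y" p] assms by simp_all

lemma comod_el_L_simps [simp]:
  assumes "contramodule M C x" "comodule M C y" "p \<in> Arr M" "trg M p = ehom (comod_cat M C) (L_obj M C x) y"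
  shows "comod.el (L_obj M C x) y p \<in> Arr M"
    "src M (comod.el (L_obj M C x) y p) = src M p \<otimes> trg M (L_proj M C x)"
    "trg M (comod.el (L_obj M C x) y p) = fst y"
  using comod.el_simps[of "L_obj M C x" y p] assms by simp_all

lemma ehom_Obj [simp]:
  "\<lbrakk>comodule M C x; comodule M C y\<rbrakk> \<Longrightarrow> ehom (comod_cat M C) x y \<in> Obj M"
  "\<lbrakk>contramodule M C x; contramodule M C y\<rbrakk> \<Longrightarrow> ehom (contra_cat M C) x y \<in> Obj M"
  using comod.incl_simps(4)[of x y] contra.incl_simps(4)[of x y] by simp_all

text \<open>With the next two lemmas this identifies arrows from \<open>Z\<close> into the
  contramodule hom object with balanced comodule maps, by uncurrying twice.\<close>

lemma contra_el_R_inj: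
  assumes x: "contramodule M C x" and y: "comodule M C y"
    and p: "p \<in> hom Z (ehom (contra_cat M C) x (R_obj M C y))" "p' \<in> hom Z (ehom (contra_cat M C) x (R_obj M C y))"
    and eq: "hat y (contra.el x (R_obj M C y) p) = hat y (contra.el x (R_obj M C y) p')"
  shows "p = p'"
proof (rule contra.el_inj[of x "R_obj M C y" _ Z])
  show "contra.el x (R_obj M C y) p = contra.el x (R_obj M C y) p'"
    by (rule hat_inj[OF eq y, of "Z \<otimes> fst x"]) (use x y p in \<open>simp_all add: hom_iff\<close>)
qed (use x y p in simp_all)

lemma contra_el_R_surj:
  assumes x: "contramodule M C x" and y: "comodule M C y" and Z: "Z \<in> Obj M"
    and u: "comodule_map M C ((Z \<otimes> fst x) \<otimes> K, \<delta> (Z \<otimes> fst x)) y u" "balanced x Z u"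
  shows "\<exists>p \<in> hom Z (ehom (contra_cat M C) x (R_obj M C y)). hat y (contra.el x (R_obj M C y) p) = u"
proof -
  obtain h where h: "h \<in> hom (Z \<otimes> fst x) (R_carr y)" "hat y h = u"
    using hat_surj[OF y _ u(1)] x Z by auto
  then have "contra_par x (R_obj M C y) Z h"
    using contra_par_R_iff[OF x y Z h(1)] u(2) by simp
  then obtain p where "p \<in> hom Z (ehom (contra_cat M C) x (R_obj M C y))" "contra.el x (R_obj M C y) p = h"
    using contra.el_surj[of x "R_obj M C y" Z h] x y Z h(1) by auto
  then show ?thesis
    using h(2) by blast
qed

lemma contra_el_R_props:
  assumes x: "contramodule M C x" and y: "comodule M C y"
    and p: "p \<in> hom Z (ehom (contra_cat M C) x (R_obj M C y))"
  shows "comodule_map M C ((Z \<otimes> fst x) \<otimes> K, \<delta> (Z \<otimes> fst x)) y (hat y (contra.el x (R_obj M C y) p))"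
    "balanced x Z (hat y (contra.el x (R_obj M C y) p))"
proof -
  let ?h = "contra.el x (R_obj M C y) p"
  have h: "?h \<in> hom (Z \<otimes> fst x) (R_carr y)" and Z: "Z \<in> Obj M"
    using x y p by (simp_all add: hom_iff)
  show "comodule_map M C ((Z \<otimes> fst x) \<otimes> K, \<delta> (Z \<otimes> fst x)) y (hat y ?h)"
    by (rule hat_comodule_map[OF y h])
  show "balanced x Z (hat y ?h)"
    using contra_par_R_iff[OF x y Z h] contra.el_P[of x "R_obj M C y" p Z] x y p by simp
qed

text \<open>The counterpart for comodule maps out of \<open>L x\<close>; with the next two lemmas it
  identifies arrows from \<open>Z\<close> into that hom object with the same balanced maps.\<close>

lemma comod_el_L_inj:
  assumes x: "contramodule M C x" and y: "comodule M C y"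
    and p: "p \<in> hom Z (ehom (comod_cat M C) (L_obj M C x) y)" "p' \<in> hom Z (ehom (comod_cat M C) (L_obj M C x) y)"
    and eq: "unfold_L x Z (comod.el (L_obj M C x) y p) = unfold_L x Z (comod.el (L_obj M C x) y p')"
  shows "p = p'"
proof (rule comod.el_inj[of "L_obj M C x" y _ Z])
  show "comod.el (L_obj M C x) y p = comod.el (L_obj M C x) y p'"
    by (rule unfold_L_inj[OF x _ _ _ eq, of "fst y"]) (use x y p in \<open>simp_all add: hom_iff\<close>)
qed (use x y p in simp_all)

lemma comod_el_L_surj:
  assumes x: "contramodule M C x" and y: "comodule M C y" and Z: "Z \<in> Obj M"
    and u: "comodule_map M C ((Z \<otimes> fst x) \<otimes> K, \<delta> (Z \<otimes> fst x)) y u" "balanced x Z u"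
  shows "\<exists>p \<in> hom Z (ehom (comod_cat M C) (L_obj M C x) y). unfold_L x Z (comod.el (L_obj M C x) y p) = u"
proof -
  obtain g where g: "comodule_map M C (ten Z (L_obj M C x)) y g" "unfold_L x Z g = u"
    using unfold_L_surj[OF x y Z u] by blast
  moreover have "g \<in> hom (Z \<otimes> trg M (L_proj M C x)) (fst y)"
    using g(1) x Z by (simp add: comodule_map_iff ten_def)
  ultimately show ?thesis
    using comod.el_surj[of "L_obj M C x" y Z g] x y Z by auto
qed

lemma comod_el_L_props:
  assumes x: "contramodule M C x" and y: "comodule M C y"
    and p: "p \<in> hom Z (ehom (comod_cat M C) (L_obj M C x) y)"
  shows "comodule_map M C ((Z \<otimes> fst x) \<otimes> K, \<delta> (Z \<otimes> fst x)) y (unfold_L x Z (comod.el (L_obj M C x) y p))"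
    "balanced x Z (unfold_L x Z (comod.el (L_obj M C x) y p))"
proof -
  have Z: "Z \<in> Obj M"
    using p by (simp add: hom_iff)
  have "comodule_map M C (ten Z (L_obj M C x)) y (comod.el (L_obj M C x) y p)"
    using comod.el_P[of "L_obj M C x" y p Z] x y p by simp
  from unfold_L[OF x y Z this]
  show "comodule_map M C ((Z \<otimes> fst x) \<otimes> K, \<delta> (Z \<otimes> fst x)) y (unfold_L x Z (comod.el (L_obj M C x) y p))"
    "balanced x Z (unfold_L x Z (comod.el (L_obj M C x) y p))" .
qed

text \<open>Translates the condition in the definition of \<open>R_hom\<close>, an equation of
  arrows into \<open>\<lbrakk>R x, F Y\<rbrakk>\<close>, by uncurrying twice. The right-hand side
  becomes the universal comodule map of \<open>E\<close> composed with that of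
  \<open>R x\<close>.\<close>

lemma R_hom_spec:
  assumes x: "comodule M C x" and y: "comodule M C y"
    and h: "h \<in> hom (comod_hom M C x y) (contra_hom M C (R_obj M C x) (R_obj M C y))"
  defines "E \<equiv> ehom (comod_cat M C) x y"
  shows "ihom_post M (fst (R_obj M C x)) (R_incl M C y) \<cdot> contra_incl M C (R_obj M C x) (R_obj M C y) \<cdot> h
      = ihom_pre M (R_incl M C x) \<lbrakk>K, fst y\<rbrakk> \<cdot> F_act M C (fst x) (fst y) \<cdot> comod_incl M C x y
    \<longleftrightarrow> hat y (contra.el (R_obj M C x) (R_obj M C y) h)
      = comod.el x y (\<one> E) \<cdot> (\<one> E \<odot> hat x (\<one> (R_carr x))) \<cdot> asc M E (R_carr x) K"
    (is "?l = ?r \<longleftrightarrow> ?l' = ?r'")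
proof -
  let ?F = "\<lbrakk>K, fst y\<rbrakk>" and ?i = "R_incl M C x" and ?X = "fst x"
  let ?ci = "contra_incl M C (R_obj M C x) (R_obj M C y)"
  have E: "E \<in> Obj M" and h': "h \<in> hom E (ehom (contra_cat M C) (R_obj M C x) (R_obj M C y))"
    using x y h by (simp_all add: E_def ehom_eq[symmetric])
  have ci: "?ci \<in> Arr M" "src M ?ci = ehom (contra_cat M C) (R_obj M C x) (R_obj M C y)"
    "trg M ?ci = \<lbrakk>R_carr x, R_carr y\<rbrakk>"
    using contra.incl_simps[of "R_obj M C x" "R_obj M C y"] x y by simp_all
  have co: "comod_incl M C x y \<in> Arr M" "src M (comod_incl M C x y) = E"
    "trg M (comod_incl M C x y) = \<lbrakk>fst x, fst y\<rbrakk>"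
    using comod.incl_simps[of x y] x y by (simp_all add: E_def)
  have lr: "?l \<in> hom E \<lbrakk>R_carr x, ?F\<rbrakk>" "?r \<in> hom E \<lbrakk>R_carr x, ?F\<rbrakk>"
    using x y h' ci co E by (simp_all add: hom_iff)
  have "flat (R_carr x) ?F ?l = R_incl M C y \<cdot> contra.el (R_obj M C x) (R_obj M C y) h"
    using x y h' ci flat_post[of "R_carr x" "R_incl M C y" ?F "?ci \<cdot> h"]
    by (simp add: hom_iff contra.el_def)
  then have 1: "flat K (fst y) (flat (R_carr x) ?F ?l) = ?l'"
    by (simp add: hat_eq)
  have "flat (R_carr x) ?F ?r
      = str E ?X (fst y) (comod.el x y (\<one> E)) \<cdot> (\<one> E \<odot> ?i)"
    using x y co E flat_pre[of ?F ?i "R_carr x" "F_act M C ?X (fst y) \<cdot> comod_incl M C x y"]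
    by (simp add: flat_F_act comod.el_def)
  moreover have e: "comod.el x y (\<one> E) \<in> hom (E \<otimes> ?X) (fst y)"
    using comod.el_simps[of x y "\<one> E"] x y E by (simp add: hom_iff E_def)
  moreover have "ev M K ?X \<cdot> (?i \<odot> \<one> K) = hat x (\<one> (R_carr x))"
    using x by (simp add: hat_eq flat_def)
  ultimately have 2: "flat K (fst y) (flat (R_carr x) ?F ?r) = ?r'"
    using x y E by (simp add: flat_cmp hom_iff asc_nats)
  have "?l = ?r \<longleftrightarrow> flat K (fst y) (flat (R_carr x) ?F ?l) = flat K (fst y) (flat (R_carr x) ?F ?r)"
  proof
    assume eq: "flat K (fst y) (flat (R_carr x) ?F ?l) = flat K (fst y) (flat (R_carr x) ?F ?r)"
    have "flat (R_carr x) ?F ?l = flat (R_carr x) ?F ?r"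
      by (rule flat_inj[OF eq, of "E \<otimes> R_carr x"]) (use lr x y in \<open>simp_all add: hom_iff\<close>)
    from flat_inj[OF this lr] show "?l = ?r"
      using x y by simp
  qed simp
  then show ?thesis
    unfolding 1 2 .
qed

text \<open>The prescribed map \<open>?u\<close> is a composite of parametrised comodule maps, hence
  one itself, and it is balanced because the structure of \<open>R x\<close> is known through
  \<open>hat\<close>. The correspondence then gives exactly one arrow.\<close>

lemma R_hom:
  assumes x: "comodule M C x" and y: "comodule M C y"
  defines "E \<equiv> ehom (comod_cat M C) x y"
  shows "R_hom M C x y \<in> hom E (ehom (contra_cat M C) (R_obj M C x) (R_obj M C y))"
    "hat y (contra.el (R_obj M C x) (R_obj M C y) (R_hom M C x y))
      = comod.el x y (\<one> E) \<cdot> (\<one> E \<odot> hat x (\<one> (R_carr x))) \<cdot> asc M E (R_carr x) K"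
proof -
  let ?R = "R_carr x" and ?k = "comod.el x y (\<one> E)" and ?e = "hat x (\<one> (R_carr x))"
  let ?F = "\<lbrakk>K, R_carr x\<rbrakk>" and ?th = "snd (R_obj M C x)"
  let ?u = "?k \<cdot> (\<one> E \<odot> ?e) \<cdot> asc M E ?R K"
  have E: "E \<in> Obj M"
    using x y by (simp add: E_def)
  have k: "?k \<in> hom (E \<otimes> fst x) (fst y)"
    using comod.el_simps[of x y "\<one> E"] x y E by (simp add: hom_iff E_def)
  have kP: "comodule_map M C (ten E x) y ?k"
    using comod.el_P[of x y "\<one> E" E] x y E by (simp add: hom_iff E_def)
  have eP: "comodule_map M C (ten ?R \<kappa>) x ?e"
    using comod.el_P[of \<kappa> x "\<one> ?R" ?R] x by (simp add: hom_iff)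
  have "comodule_map M C (ten (E \<otimes> ?R) \<kappa>) y (?k \<cdot> (\<one> E \<odot> ?e) \<cdot> asc M E ?R (fst \<kappa>))"
    by (rule comod.P_cmp[OF _ _ _ _ _ _ eP _ kP]) (use x y E k in \<open>simp_all add: hom_iff\<close>)
  then have 1: "comodule_map M C ((E \<otimes> ?R) \<otimes> K, \<delta> (E \<otimes> ?R)) y ?u"
    by simp
  \<comment> \<open>The description of the structure of \<open>R x\<close>, taken at the identity of
    \<open>F (R x)\<close>.\<close>
  have et: "?e \<cdot> (?th \<odot> \<one> K) = ?e \<cdot> (ev M K ?R \<odot> \<one> K) \<cdot> \<delta> ?F"
  proof -
    have "hat x (?th \<cdot> \<one> ?F) = hat x (ev M K ?R) \<cdot> \<delta> ?F"
      using x by (subst R_obj(2)) simp_all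
    then have "?e \<cdot> (?th \<odot> \<one> K) = (?e \<cdot> (ev M K ?R \<odot> \<one> K)) \<cdot> \<delta> ?F"
      using x by (simp add: hat_ident_cmp)
    then show ?thesis
      using x by simp
  qed
  have "?u \<cdot> ((\<one> E \<odot> ?th) \<odot> \<one> K) = ?k \<cdot> (\<one> E \<odot> (?e \<cdot> (?th \<odot> \<one> K))) \<cdot> asc M E ?F K"
    using x y E k by (simp add: hom_iff asc_nats)
  also have "\<dots> = ?k \<cdot> (\<one> E \<odot> (?e \<cdot> (ev M K ?R \<odot> \<one> K))) \<cdot> (\<one> E \<odot> \<delta> ?F) \<cdot> asc M E ?F K"
    unfolding et using x y E k by (simp add: hom_iff)
  also have "\<dots> = ?k \<cdot> (\<one> E \<odot> (?e \<cdot> (ev M K ?R \<odot> \<one> K))) \<cdot> asc M E (?F \<otimes> K) K \<cdot> (asc M E ?F K \<odot> \<one> K) \<cdot> \<delta> (E \<otimes> ?F)"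
    using x E by (simp add: asc_delta)
  also have "\<dots> = ?k \<cdot> (\<one> E \<odot> ?e) \<cdot> asc M E ?R K \<cdot> ((\<one> E \<odot> ev M K ?R) \<odot> \<one> K)
      \<cdot> (asc M E ?F K \<odot> \<one> K) \<cdot> \<delta> (E \<otimes> ?F)"
    using x y E k by (subst asc_nat_post) (simp_all add: hom_iff)
  also have "\<dots> = ?u \<cdot> (((\<one> E \<odot> ev M K ?R) \<cdot> asc M E ?F K) \<odot> \<one> K) \<cdot> \<delta> (E \<otimes> ?F)"
    using x y E k by (simp add: hom_iff)
  finally have 2: "balanced (R_obj M C x) E ?u"
    by (simp add: balanced_def)
  obtain h where h: "h \<in> hom E (ehom (contra_cat M C) (R_obj M C x) (R_obj M C y))"
    "hat y (contra.el (R_obj M C x) (R_obj M C y) h) = ?u"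
    using contra_el_R_surj[OF R_obj(1)[OF x] y E _ 2] 1 by auto
  have "R_hom M C x y = h"
    unfolding R_hom_def
  proof (rule the_equality)
    show "h \<in> hom (comod_hom M C x y) (contra_hom M C (R_obj M C x) (R_obj M C y)) \<and>
      ihom_post M (fst (R_obj M C x)) (R_incl M C y) \<cdot> contra_incl M C (R_obj M C x) (R_obj M C y) \<cdot> h
      = ihom_pre M (R_incl M C x) \<lbrakk>K, fst y\<rbrakk> \<cdot> F_act M C (fst x) (fst y) \<cdot> comod_incl M C x y"
      using h R_hom_spec[OF x y, of h] by (simp add: E_def ehom_eq)
    fix h' assume h': "h' \<in> hom (comod_hom M C x y) (contra_hom M C (R_obj M C x) (R_obj M C y)) \<and>
      ihom_post M (fst (R_obj M C x)) (R_incl M C y) \<cdot> contra_incl M C (R_obj M C x) (R_obj M C y) \<cdot> h'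
      = ihom_pre M (R_incl M C x) \<lbrakk>K, fst y\<rbrakk> \<cdot> F_act M C (fst x) (fst y) \<cdot> comod_incl M C x y"
    then have u: "hat y (contra.el (R_obj M C x) (R_obj M C y) h') = ?u"
      using R_hom_spec[OF x y, of h'] by (simp add: E_def ehom_eq)
    have "h' \<in> hom E (ehom (contra_cat M C) (R_obj M C x) (R_obj M C y))"
      using h' by (simp add: E_def ehom_eq)
    from contra_el_R_inj[OF R_obj(1)[OF x] y this h(1) trans[OF u h(2)[symmetric]]] show "h' = h" .
  qed
  with h show "R_hom M C x y \<in> hom E (ehom (contra_cat M C) (R_obj M C x) (R_obj M C y))"
    "hat y (contra.el (R_obj M C x) (R_obj M C y) (R_hom M C x y)) = ?u"
    by simp_all
qed

lemma R_hom_simps [simp]: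
  assumes "comodule M C x" "comodule M C y"
  shows "R_hom M C x y \<in> Arr M" "src M (R_hom M C x y) = ehom (comod_cat M C) x y"
    "trg M (R_hom M C x y) = ehom (contra_cat M C) (R_obj M C x) (R_obj M C y)"
  using R_hom(1)[OF assms] by (simp_all add: hom_iff)

lemma contra_el_RR_simps [simp]:
  assumes "comodule M C x" "comodule M C y" "p \<in> Arr M"
    "trg M p = ehom (contra_cat M C) (R_obj M C x) (R_obj M C y)"
  shows "contra.el (R_obj M C x) (R_obj M C y) p \<in> Arr M"
    "src M (contra.el (R_obj M C x) (R_obj M C y) p) = src M p \<otimes> R_carr x"
    "trg M (contra.el (R_obj M C x) (R_obj M C y) p) = R_carr y"
  using contra_el_R_simps[of "R_obj M C x" y p] assms by simp_all

text \<open>The action of R in generalised elements: an arbitrary \<open>r\<close> into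
  \<open>R x\<close> is allowed, so that the rule also applies when the action follows another
  parametrised map.\<close>

lemma hat_R_hom:
  assumes x: "comodule M C x" and y: "comodule M C y" and r: "r \<in> Arr M" "trg M r = R_carr x"
  defines "E \<equiv> ehom (comod_cat M C) x y"
  shows "hat y (contra.el (R_obj M C x) (R_obj M C y) (R_hom M C x y) \<cdot> (\<one> E \<odot> r))
    = comod.el x y (\<one> E) \<cdot> (\<one> E \<odot> hat x r) \<cdot> asc M E (src M r) K"
proof -
  have E: "E \<in> Obj M"
    using x y by (simp add: E_def)
  have k: "comod.el x y (\<one> E) \<in> hom (E \<otimes> fst x) (fst y)"
    using comod.el_simps[of x y "\<one> E"] x y E by (simp add: hom_iff E_def)
  have "hat y (contra.el (R_obj M C x) (R_obj M C y) (R_hom M C x y) \<cdot> (\<one> E \<odot> r))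
      = hat y (contra.el (R_obj M C x) (R_obj M C y) (R_hom M C x y)) \<cdot> ((\<one> E \<odot> r) \<odot> \<one> K)"
    using x y r E by (intro hat_cmp) (simp_all add: E_def)
  also have "\<dots> = comod.el x y (\<one> E) \<cdot> (\<one> E \<odot> (hat x (\<one> (R_carr x)) \<cdot> (r \<odot> \<one> K))) \<cdot> asc M E (src M r) K"
    unfolding R_hom(2)[OF x y, folded E_def] using x y r E k by (simp add: hom_iff asc_nats)
  also have "hat x (\<one> (R_carr x)) \<cdot> (r \<odot> \<one> K) = hat x r"
    using x r by (simp add: hat_ident_cmp)
  finally show ?thesis .
qed

text \<open>One uncurrying turns both sides into maps out of \<open>E \<otimes> T X\<close>;
  precomposition with the invertible associator, which loses nothing, brings them to the cofree
  comodule on \<open>E \<otimes> X\<close>.\<close>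

lemma L_hom_spec:
  assumes x: "contramodule M C x" and y: "contramodule M C y"
    and h: "h \<in> hom (contra_hom M C x y) (comod_hom M C (L_obj M C x) (L_obj M C y))"
  defines "E \<equiv> ehom (contra_cat M C) x y"
  shows "ihom_pre M (L_proj M C x) (fst (L_obj M C y)) \<cdot> comod_incl M C (L_obj M C x) (L_obj M C y) \<cdot> h
      = ihom_post M (fst x \<otimes> K) (L_proj M C y) \<cdot> T_act M C (fst x) (fst y) \<cdot> contra_incl M C x y
    \<longleftrightarrow> unfold_L x E (comod.el (L_obj M C x) (L_obj M C y) h)
      = L_proj M C y \<cdot> (contra.el x y (\<one> E) \<odot> \<one> K)"
    (is "?l = ?r \<longleftrightarrow> ?l' = ?r'")
proof -
  let ?X = "fst x" and ?Y = "fst y" and ?p = "L_proj M C x" and ?q = "L_proj M C y"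
  let ?ci = "comod_incl M C (L_obj M C x) (L_obj M C y)"
  let ?g = "comod.el (L_obj M C x) (L_obj M C y) h"
  have E: "E \<in> Obj M" and h': "h \<in> hom E (ehom (comod_cat M C) (L_obj M C x) (L_obj M C y))"
    using x y h by (simp_all add: E_def ehom_eq[symmetric])
  have ci: "?ci \<in> Arr M" "src M ?ci = ehom (comod_cat M C) (L_obj M C x) (L_obj M C y)"
    "trg M ?ci = \<lbrakk>trg M ?p, trg M ?q\<rbrakk>"
    using comod.incl_simps[of "L_obj M C x" "L_obj M C y"] x y by simp_all
  have co: "contra_incl M C x y \<in> Arr M" "src M (contra_incl M C x y) = E"
    "trg M (contra_incl M C x y) = \<lbrakk>?X, ?Y\<rbrakk>"
    using contra.incl_simps[of x y] x y by (simp_all add: E_def)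
  have lr: "?l \<in> hom E \<lbrakk>?X \<otimes> K, trg M ?q\<rbrakk>" "?r \<in> hom E \<lbrakk>?X \<otimes> K, trg M ?q\<rbrakk>"
    using x y h' ci co E by (simp_all add: hom_iff)
  have g: "?g \<in> hom (E \<otimes> trg M ?p) (trg M ?q)"
    using x y h' by (simp add: hom_iff)
  have k: "contra.el x y (\<one> E) \<in> hom (E \<otimes> ?X) ?Y"
    using contra.el_simps[of x y "\<one> E"] x y E by (simp add: hom_iff E_def)
  have 1: "flat (?X \<otimes> K) (trg M ?q) ?l = ?g \<cdot> (\<one> E \<odot> ?p)"
    using x y h' ci flat_pre[of "trg M ?q" ?p "?X \<otimes> K" "?ci \<cdot> h"]
    by (simp add: hom_iff comod.el_def)
  have 2: "flat (?X \<otimes> K) (trg M ?q) ?r = ?q \<cdot> (contra.el x y (\<one> E) \<odot> \<one> K) \<cdot> asc' E ?X K"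
    using x y co E flat_post[of "?X \<otimes> K" ?q "trg M ?q" "T_act M C ?X ?Y \<cdot> contra_incl M C x y"]
    by (simp add: flat_T_act contra.el_def)
  let ?a = "?g \<cdot> (\<one> E \<odot> ?p)" and ?b = "?q \<cdot> (contra.el x y (\<one> E) \<odot> \<one> K) \<cdot> asc' E ?X K"
  have ab: "?a \<in> hom (E \<otimes> ?X \<otimes> K) (trg M ?q)" "?b \<in> hom (E \<otimes> ?X \<otimes> K) (trg M ?q)"
    using x y E g k by (simp_all add: hom_iff)
  have l: "?a \<cdot> asc M E ?X K = ?l'"
    using x y E g by (simp add: unfold_L_def hom_iff)
  have r: "?b \<cdot> asc M E ?X K = ?r'"
    using x y E k by (simp add: hom_iff)
  show ?thesis
  proof
    assume "?l = ?r"
    then have "?a = ?b"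
      using 1 2 by metis
    then show "?l' = ?r'"
      using l r by metis
  next
    assume "?l' = ?r'"
    then have "?a \<cdot> asc M E ?X K = ?b \<cdot> asc M E ?X K"
      using l r by metis
    from asc_epic[OF ab this] have "?a = ?b"
      using x E by simp
    then have "flat (?X \<otimes> K) (trg M ?q) ?l = flat (?X \<otimes> K) (trg M ?q) ?r"
      using 1 2 by metis
    from flat_inj[OF this lr] show "?l = ?r"
      using x y by simp
  qed
qed

text \<open>The prescribed map is \<open>?q\<close> after T applied to the universal contramodule
  map \<open>?k\<close>. The cofree construction makes it a comodule map; it is balanced because
  \<open>?k\<close> respects the structure arrows and \<open>?q\<close> coequalises the pair of
  \<open>L y\<close>.\<close>

lemma L_hom:
  assumes x: "contramodule M C x" and y: "contramodule M C y"
  defines "E \<equiv> ehom (contra_cat M C) x y"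
  shows "L_hom M C x y \<in> hom E (ehom (comod_cat M C) (L_obj M C x) (L_obj M C y))"
    "unfold_L x E (comod.el (L_obj M C x) (L_obj M C y) (L_hom M C x y))
      = L_proj M C y \<cdot> (contra.el x y (\<one> E) \<odot> \<one> K)"
proof -
  let ?X = "fst x" and ?Y = "fst y" and ?q = "L_proj M C y" and ?k = "contra.el x y (\<one> E)"
  let ?F = "\<lbrakk>K, ?X\<rbrakk>"
  let ?s = "str E ?X ?Y ?k"
  let ?u = "?q \<cdot> (?k \<odot> \<one> K)"
  have E: "E \<in> Obj M"
    using x y by (simp add: E_def)
  have k: "?k \<in> hom (E \<otimes> ?X) ?Y" "?k \<cdot> (\<one> E \<odot> snd x) = snd y \<cdot> ?s"
    using contra.el_simps[of x y "\<one> E"] contra.el_P[of x y "\<one> E" E] x y E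
    by (simp_all add: hom_iff E_def contra_par_def)
  have 1: "comodule_map M C ((E \<otimes> ?X) \<otimes> K, \<delta> (E \<otimes> ?X)) (L_obj M C y) ?u"
    by (rule comodule_map_cmp[OF _ comodule_map_L_proj[OF y]])
      (use x y E k(1) comodule_cofree in \<open>simp_all add: comodule_map_iff hom_iff delta_nat\<close>)
  have "?u \<cdot> ((\<one> E \<odot> snd x) \<odot> \<one> K) = ?q \<cdot> ((?k \<cdot> (\<one> E \<odot> snd x)) \<odot> \<one> K)"
    using x y E k(1) by (simp add: hom_iff)
  also have "\<dots> = (?q \<cdot> (snd y \<odot> \<one> K)) \<cdot> (?s \<odot> \<one> K)"
    unfolding k(2) using x y E k(1) by (simp add: hom_iff)
  also have "\<dots> = ?q \<cdot> (ev M K ?Y \<odot> \<one> K) \<cdot> \<delta> \<lbrakk>K, ?Y\<rbrakk> \<cdot> (?s \<odot> \<one> K)"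
    unfolding L_proj_eq[OF y] using x y E k(1) by (simp add: hom_iff)
  also have "\<dots> = ?q \<cdot> ((ev M K ?Y \<cdot> (?s \<odot> \<one> K)) \<odot> \<one> K) \<cdot> \<delta> (E \<otimes> ?F)"
    using x y E k(1) by (simp add: hom_iff delta_nat)
  \<comment> \<open>The defining equation of the strength: it moves evaluation from the target
    \<open>y\<close> back to the source \<open>x\<close>.\<close>
  also have "ev M K ?Y \<cdot> (?s \<odot> \<one> K) = ?k \<cdot> (\<one> E \<odot> ev M K ?X) \<cdot> asc M E ?F K"
    using x y E k(1) by (simp add: hom_iff flip: flat_def)
  also have "?q \<cdot> ((?k \<cdot> (\<one> E \<odot> ev M K ?X) \<cdot> asc M E ?F K) \<odot> \<one> K) \<cdot> \<delta> (E \<otimes> ?F)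
      = ?u \<cdot> (((\<one> E \<odot> ev M K ?X) \<cdot> asc M E ?F K) \<odot> \<one> K) \<cdot> \<delta> (E \<otimes> ?F)"
    using x y E k(1) by (simp add: hom_iff)
  finally have 2: "balanced x E ?u"
    by (simp add: balanced_def)
  obtain h where h: "h \<in> hom E (ehom (comod_cat M C) (L_obj M C x) (L_obj M C y))"
    "unfold_L x E (comod.el (L_obj M C x) (L_obj M C y) h) = ?u"
    using comod_el_L_surj[OF x L_obj(1)[OF y] E 1 2] by auto
  have "L_hom M C x y = h"
    unfolding L_hom_def
  proof (rule the_equality)
    show "h \<in> hom (contra_hom M C x y) (comod_hom M C (L_obj M C x) (L_obj M C y)) \<and>
      ihom_pre M (L_proj M C x) (fst (L_obj M C y)) \<cdot> comod_incl M C (L_obj M C x) (L_obj M C y) \<cdot> h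
      = ihom_post M (fst x \<otimes> K) (L_proj M C y) \<cdot> T_act M C (fst x) (fst y) \<cdot> contra_incl M C x y"
      using h L_hom_spec[OF x y, of h] by (simp add: E_def ehom_eq)
    fix h' assume h': "h' \<in> hom (contra_hom M C x y) (comod_hom M C (L_obj M C x) (L_obj M C y)) \<and>
      ihom_pre M (L_proj M C x) (fst (L_obj M C y)) \<cdot> comod_incl M C (L_obj M C x) (L_obj M C y) \<cdot> h'
      = ihom_post M (fst x \<otimes> K) (L_proj M C y) \<cdot> T_act M C (fst x) (fst y) \<cdot> contra_incl M C x y"
    then have u: "unfold_L x E (comod.el (L_obj M C x) (L_obj M C y) h') = ?u"
      using L_hom_spec[OF x y, of h'] by (simp add: E_def ehom_eq)
    have "h' \<in> hom E (ehom (comod_cat M C) (L_obj M C x) (L_obj M C y))"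
      using h' by (simp add: E_def ehom_eq)
    from comod_el_L_inj[OF x L_obj(1)[OF y] this h(1) trans[OF u h(2)[symmetric]]] show "h' = h" .
  qed
  with h show "L_hom M C x y \<in> hom E (ehom (comod_cat M C) (L_obj M C x) (L_obj M C y))"
    "unfold_L x E (comod.el (L_obj M C x) (L_obj M C y) (L_hom M C x y)) = ?u"
    by simp_all
qed

lemma L_hom_simps [simp]:
  assumes "contramodule M C x" "contramodule M C y"
  shows "L_hom M C x y \<in> Arr M" "src M (L_hom M C x y) = ehom (contra_cat M C) x y"
    "trg M (L_hom M C x y) = ehom (comod_cat M C) (L_obj M C x) (L_obj M C y)"
  using L_hom(1)[OF assms] by (simp_all add: hom_iff)

lemma comod_el_LL_simps [simp]:
  assumes "contramodule M C x" "contramodule M C y" "p \<in> Arr M"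
    "trg M p = ehom (comod_cat M C) (L_obj M C x) (L_obj M C y)"
  shows "comod.el (L_obj M C x) (L_obj M C y) p \<in> Arr M"
    "src M (comod.el (L_obj M C x) (L_obj M C y) p) = src M p \<otimes> trg M (L_proj M C x)"
    "trg M (comod.el (L_obj M C x) (L_obj M C y) p) = trg M (L_proj M C y)"
  using comod_el_L_simps[of x "L_obj M C y" p] assms by simp_all

lemma hat_contra_el_cmp:
  assumes "contramodule M C x" "comodule M C y"
    "p \<in> Arr M" "trg M p = ehom (contra_cat M C) x (R_obj M C y)" "z \<in> Arr M" "trg M z = src M p"
  shows "hat y (contra.el x (R_obj M C y) (p \<cdot> z))
    = hat y (contra.el x (R_obj M C y) p) \<cdot> ((z \<odot> \<one> (fst x)) \<odot> \<one> K)"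
  using assms by (simp add: contra.el_cmp hat_cmp)

lemma unfold_L_comod_el_cmp:
  assumes "contramodule M C x" "comodule M C y"
    "p \<in> hom Z (ehom (comod_cat M C) (L_obj M C x) y)" "z \<in> hom W Z"
  shows "unfold_L x W (comod.el (L_obj M C x) y (p \<cdot> z))
    = unfold_L x Z (comod.el (L_obj M C x) y p) \<cdot> ((z \<odot> \<one> (fst x)) \<odot> \<one> K)"
  using assms unfold_L_cmp[of x Z "comod.el (L_obj M C x) y p" z W] by (simp add: comod.el_cmp hom_iff)

text \<open>If \<open>g\<close> lies over \<open>k\<close> along the projections, then composing
  with \<open>g\<close> downstairs is precomposing with T of \<open>k\<close> upstairs. The two
  bracketings of the parameters are reconciled by the pentagon. Functoriality of L and naturality in
  the contramodule variable both rest on this.\<close>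

lemma unfold_L_cmp_L:
  assumes x: "contramodule M C x" and y: "contramodule M C y" and Z: "Z \<in> Obj M" and W: "W \<in> Obj M"
    and g: "g \<in> hom (Z \<otimes> trg M (L_proj M C x)) (trg M (L_proj M C y))"
    and k: "k \<in> hom (Z \<otimes> fst x) (fst y)" "unfold_L x Z g = L_proj M C y \<cdot> (k \<odot> \<one> K)"
    and f: "f \<in> hom (W \<otimes> trg M (L_proj M C y)) V"
  shows "unfold_L x (W \<otimes> Z) (f \<cdot> (\<one> W \<odot> g) \<cdot> asc M W Z (trg M (L_proj M C x)))
    = unfold_L y W f \<cdot> (((\<one> W \<odot> k) \<cdot> asc M W Z (fst x)) \<odot> \<one> K)"
proof -
  let ?X = "fst x" and ?p = "L_proj M C x" and ?q = "L_proj M C y"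
  have "unfold_L x (W \<otimes> Z) (f \<cdot> (\<one> W \<odot> g) \<cdot> asc M W Z (trg M ?p))
      = f \<cdot> (\<one> W \<odot> (g \<cdot> (\<one> Z \<odot> ?p))) \<cdot> asc M W Z (?X \<otimes> K) \<cdot> asc M (W \<otimes> Z) ?X K"
    using x y Z W g f by (simp add: unfold_L_def hom_iff asc_nats)
  also have "\<dots> = f \<cdot> (\<one> W \<odot> (g \<cdot> (\<one> Z \<odot> ?p))) \<cdot> (\<one> W \<odot> asc M Z ?X K) \<cdot> asc M W (Z \<otimes> ?X) K
      \<cdot> (asc M W Z ?X \<odot> \<one> K)"
    using x Z W by (simp only: pentagon contramodule_simps comonoid_simps)
  also have "\<dots> = f \<cdot> (\<one> W \<odot> unfold_L x Z g) \<cdot> asc M W (Z \<otimes> ?X) K \<cdot> (asc M W Z ?X \<odot> \<one> K)"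
    using x y Z W g f by (simp add: unfold_L_def hom_iff)
  also have "\<dots> = f \<cdot> (\<one> W \<odot> ?q) \<cdot> (\<one> W \<odot> k \<odot> \<one> K) \<cdot> asc M W (Z \<otimes> ?X) K \<cdot> (asc M W Z ?X \<odot> \<one> K)"
    unfolding k(2) using x y Z W k(1) f by (simp add: hom_iff)
  also have "\<dots> = f \<cdot> (\<one> W \<odot> ?q) \<cdot> asc M W (fst y) K \<cdot> ((\<one> W \<odot> k) \<odot> \<one> K) \<cdot> (asc M W Z ?X \<odot> \<one> K)"
    using x y Z W k(1) f by (subst asc_nat_post) (simp_all add: hom_iff)
  also have "\<dots> = unfold_L y W f \<cdot> (((\<one> W \<odot> k) \<cdot> asc M W Z ?X) \<odot> \<one> K)"
    using x y Z W k(1) f by (simp add: unfold_L_def hom_iff)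
  finally show ?thesis .
qed

text \<open>Both laws are compared as comodule maps by \<open>contra_el_R_inj\<close>. The identity
  law reduces to \<open>lun_tensor\<close>, the composition law to the pentagon and
  \<open>hat_R_hom\<close>.\<close>

lemma R_enriched_functor:
  "enriched_functor M (comod_cat M C) (contra_cat M C) (R_functor M C)"
proof -
  let ?B = "comod_cat M C" and ?A = "contra_cat M C" and ?R = "R_obj M C"
  have "R_hom M C x x \<cdot> eident ?B x = eident ?A (?R x)" if x: "comodule M C x" for x
  proof (rule contra_el_R_inj[OF R_obj(1)[OF x] x, of _ \<I>])
    let ?E = "ehom ?B x x" and ?e = "hat x (\<one> (R_carr x))"
    have i: "eident ?B x \<in> Arr M" "src M (eident ?B x) = \<I>" "trg M (eident ?B x) = ?E"
      "eident ?A (?R x) \<in> Arr M" "src M (eident ?A (?R x)) = \<I>" "trg M (eident ?A (?R x)) = ehom ?A (?R x) (?R x)"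
      using x by simp_all
    have k: "comod.el x x (\<one> ?E) \<cdot> (eident ?B x \<odot> \<one> (fst x)) = lun M (fst x)"
      using comod.el_ident_cmp[of x x "eident ?B x"] comod.eident_props[of x] x by simp
    have k': "comod.el x x (\<one> ?E) \<in> hom (?E \<otimes> fst x) (fst x)"
      using comod.el_simps[of x x "\<one> ?E"] x by (simp add: hom_iff)
    have "hat x (contra.el (?R x) (?R x) (R_hom M C x x \<cdot> eident ?B x))
        = (comod.el x x (\<one> ?E) \<cdot> (eident ?B x \<odot> \<one> (fst x))) \<cdot> (\<one> \<I> \<odot> ?e) \<cdot> asc M \<I> (R_carr x) K"
      using x k' by (simp add: hat_contra_el_cmp R_hom(2) hom_iff asc_nats)
    also have "\<dots> = ?e \<cdot> (lun M (R_carr x) \<odot> \<one> K)"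
      unfolding k using x by (simp add: lun_nat_post lun_tensor)
    also have "\<dots> = hat x (contra.el (?R x) (?R x) (eident ?A (?R x)))"
      using x contra.eident_props(2)[of "?R x"] by (simp add: hat_ident_cmp)
    finally show "hat x (contra.el (?R x) (?R x) (R_hom M C x x \<cdot> eident ?B x))
      = hat x (contra.el (?R x) (?R x) (eident ?A (?R x)))" .
    show "R_hom M C x x \<cdot> eident ?B x \<in> hom \<I> (ehom ?A (?R x) (?R x))"
      "eident ?A (?R x) \<in> hom \<I> (ehom ?A (?R x) (?R x))"
      using i x by (simp_all add: hom_iff)
  qed
  moreover have "R_hom M C x z \<cdot> ecmp ?B x y z = ecmp ?A (?R x) (?R y) (?R z) \<cdot> (R_hom M C y z \<odot> R_hom M C x y)"
    if x: "comodule M C x" and y: "comodule M C y" and z: "comodule M C z" for x y z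
  proof (rule contra_el_R_inj[OF R_obj(1)[OF x] z, of _ "ehom ?B y z \<otimes> ehom ?B x y"])
    let ?W = "ehom ?B y z" and ?Z = "ehom ?B x y" and ?E = "ehom ?B x z" and ?e = "hat x (\<one> (R_carr x))"
    let ?k = "comod.el x y (\<one> ?Z)" and ?m = "comod.el y z (\<one> ?W)"
    let ?g = "contra.el (?R x) (?R y) (R_hom M C x y)" and ?f = "contra.el (?R y) (?R z) (R_hom M C y z)"
    have c: "ecmp ?B x y z \<in> Arr M" "src M (ecmp ?B x y z) = ?W \<otimes> ?Z" "trg M (ecmp ?B x y z) = ?E"
      using x y z by simp_all
    have k: "?k \<in> hom (?Z \<otimes> fst x) (fst y)" "?m \<in> hom (?W \<otimes> fst y) (fst z)"
      "comod.el x z (\<one> ?E) \<in> hom (?E \<otimes> fst x) (fst z)"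
      using comod.el_simps[of x y "\<one> ?Z"] comod.el_simps[of y z "\<one> ?W"] comod.el_simps[of x z "\<one> ?E"]
        x y z by (simp_all add: hom_iff)
    have m: "comod.el x z (\<one> ?E) \<cdot> (ecmp ?B x y z \<odot> \<one> (fst x)) = ?m \<cdot> (\<one> ?W \<odot> ?k) \<cdot> asc M ?W ?Z (fst x)"
      using comod.el_ident_cmp[of x z "ecmp ?B x y z"] comod.el_ecmp[of x y z "\<one> ?W" "\<one> ?Z"] x y z by simp
    have "hat z (contra.el (?R x) (?R z) (R_hom M C x z \<cdot> ecmp ?B x y z))
        = (comod.el x z (\<one> ?E) \<cdot> (ecmp ?B x y z \<odot> \<one> (fst x))) \<cdot> (\<one> (?W \<otimes> ?Z) \<odot> ?e)
            \<cdot> asc M (?W \<otimes> ?Z) (R_carr x) K"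
      using x y z k c by (simp add: hat_contra_el_cmp R_hom(2) hom_iff asc_nats)
    also have "\<dots> = ?m \<cdot> (\<one> ?W \<odot> ?k) \<cdot> (\<one> ?W \<odot> \<one> ?Z \<odot> ?e) \<cdot> asc M ?W ?Z (R_carr x \<otimes> K)
        \<cdot> asc M (?W \<otimes> ?Z) (R_carr x) K"
      unfolding m using x y z k by (simp add: hom_iff asc_nats)
    also have "\<dots> = ?m \<cdot> (\<one> ?W \<odot> hat y ?g) \<cdot> asc M ?W (?Z \<otimes> R_carr x) K \<cdot> (asc M ?W ?Z (R_carr x) \<odot> \<one> K)"
      using x y z k by (simp add: pentagon R_hom(2) hom_iff)
    also have "\<dots> = hat z (?f \<cdot> (\<one> ?W \<odot> ?g)) \<cdot> (asc M ?W ?Z (R_carr x) \<odot> \<one> K)"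
      using x y z k by (simp add: hat_R_hom hom_iff)
    also have "\<dots> = hat z ((?f \<cdot> (\<one> ?W \<odot> ?g)) \<cdot> asc M ?W ?Z (R_carr x))"
      using x y z by (subst hat_cmp) simp_all
    also have "\<dots> = hat z (contra.el (?R x) (?R z) (ecmp ?A (?R x) (?R y) (?R z) \<cdot> (R_hom M C y z \<odot> R_hom M C x y)))"
      using x y z by (simp add: contra.el_ecmp)
    finally show "hat z (contra.el (?R x) (?R z) (R_hom M C x z \<cdot> ecmp ?B x y z))
      = hat z (contra.el (?R x) (?R z) (ecmp ?A (?R x) (?R y) (?R z) \<cdot> (R_hom M C y z \<odot> R_hom M C x y)))" .
  qed (use x y z in \<open>simp_all add: hom_iff\<close>)
  ultimately show ?thesis
    unfolding enriched_functor_def using comod.enriched contra.enriched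
    by (simp add: R_functor_def R_hom(1))
qed

text \<open>Both laws are compared on cofree comodules by \<open>comod_el_L_inj\<close>. The
  identity law is again \<open>lun_tensor\<close>, and \<open>unfold_L_cmp_L\<close> gives the
  composition law.\<close>

lemma L_enriched_functor:
  "enriched_functor M (contra_cat M C) (comod_cat M C) (L_functor M C)"
proof -
  let ?B = "comod_cat M C" and ?A = "contra_cat M C" and ?L = "L_obj M C"
  have "L_hom M C x x \<cdot> eident ?A x = eident ?B (?L x)" if x: "contramodule M C x" for x
  proof (rule comod_el_L_inj[OF x L_obj(1)[OF x], of _ \<I>])
    let ?E = "ehom ?A x x" and ?q = "L_proj M C x"
    have i: "eident ?A x \<in> Arr M" "src M (eident ?A x) = \<I>" "trg M (eident ?A x) = ?E"
      "eident ?B (?L x) \<in> Arr M" "src M (eident ?B (?L x)) = \<I>" "trg M (eident ?B (?L x)) = ehom ?B (?L x) (?L x)"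
      using x by simp_all
    have k: "contra.el x x (\<one> ?E) \<cdot> (eident ?A x \<odot> \<one> (fst x)) = lun M (fst x)"
      using contra.el_ident_cmp[of x x "eident ?A x"] contra.eident_props[of x] x by simp
    have k': "contra.el x x (\<one> ?E) \<in> hom (?E \<otimes> fst x) (fst x)"
      using contra.el_simps[of x x "\<one> ?E"] x by (simp add: hom_iff)
    have "unfold_L x \<I> (comod.el (?L x) (?L x) (L_hom M C x x \<cdot> eident ?A x))
        = ?q \<cdot> ((contra.el x x (\<one> ?E) \<cdot> (eident ?A x \<odot> \<one> (fst x))) \<odot> \<one> K)"
      using x k' i unfold_L_comod_el_cmp[OF x L_obj(1)[OF x] L_hom(1)[OF x x], of "eident ?A x" \<I>]
      by (simp add: L_hom(2) hom_iff)
    also have "\<dots> = unfold_L x \<I> (lun M (trg M ?q))"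
      unfolding k using x by (simp add: unfold_L_def lun_nat_post lun_tensor)
    also have "\<dots> = unfold_L x \<I> (comod.el (?L x) (?L x) (eident ?B (?L x)))"
      using x comod.eident_props(2)[of "?L x"] by simp
    finally show "unfold_L x \<I> (comod.el (?L x) (?L x) (L_hom M C x x \<cdot> eident ?A x))
      = unfold_L x \<I> (comod.el (?L x) (?L x) (eident ?B (?L x)))" .
    show "L_hom M C x x \<cdot> eident ?A x \<in> hom \<I> (ehom ?B (?L x) (?L x))"
      "eident ?B (?L x) \<in> hom \<I> (ehom ?B (?L x) (?L x))"
      using i x by (simp_all add: hom_iff)
  qed
  moreover have "L_hom M C x z \<cdot> ecmp ?A x y z = ecmp ?B (?L x) (?L y) (?L z) \<cdot> (L_hom M C y z \<odot> L_hom M C x y)"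
    if x: "contramodule M C x" and y: "contramodule M C y" and z: "contramodule M C z" for x y z
  proof (rule comod_el_L_inj[OF x L_obj(1)[OF z], of _ "ehom ?A y z \<otimes> ehom ?A x y"])
    let ?W = "ehom ?A y z" and ?Z = "ehom ?A x y" and ?E = "ehom ?A x z"
    let ?k = "contra.el x y (\<one> ?Z)" and ?m = "contra.el y z (\<one> ?W)"
    let ?g = "comod.el (?L x) (?L y) (L_hom M C x y)" and ?f = "comod.el (?L y) (?L z) (L_hom M C y z)"
    have c: "ecmp ?A x y z \<in> hom (?W \<otimes> ?Z) ?E"
      using contra.ecmp_props[of x y z] x y z by simp
    have k: "?k \<in> hom (?Z \<otimes> fst x) (fst y)" "?m \<in> hom (?W \<otimes> fst y) (fst z)"
      "contra.el x z (\<one> ?E) \<in> hom (?E \<otimes> fst x) (fst z)"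
      using contra.el_simps[of x y "\<one> ?Z"] contra.el_simps[of y z "\<one> ?W"] contra.el_simps[of x z "\<one> ?E"]
        x y z by (simp_all add: hom_iff)
    have g: "?g \<in> hom (?Z \<otimes> trg M (L_proj M C x)) (trg M (L_proj M C y))"
      "?f \<in> hom (?W \<otimes> trg M (L_proj M C y)) (trg M (L_proj M C z))"
      using x y z by (simp_all add: hom_iff)
    have m: "contra.el x z (\<one> ?E) \<cdot> (ecmp ?A x y z \<odot> \<one> (fst x)) = ?m \<cdot> (\<one> ?W \<odot> ?k) \<cdot> asc M ?W ?Z (fst x)"
      using contra.el_ident_cmp[of x z "ecmp ?A x y z"] contra.el_ecmp[of x y z "\<one> ?W" "\<one> ?Z"] x y z by simp
    have "unfold_L x (?W \<otimes> ?Z) (comod.el (?L x) (?L z) (L_hom M C x z \<cdot> ecmp ?A x y z))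
        = L_proj M C z \<cdot> ((contra.el x z (\<one> ?E) \<cdot> (ecmp ?A x y z \<odot> \<one> (fst x))) \<odot> \<one> K)"
      using x y z k c unfold_L_comod_el_cmp[OF x L_obj(1)[OF z] L_hom(1)[OF x z] c]
      by (simp add: L_hom(2) hom_iff)
    also have "\<dots> = unfold_L y ?W ?f \<cdot> (((\<one> ?W \<odot> ?k) \<cdot> asc M ?W ?Z (fst x)) \<odot> \<one> K)"
      unfolding m using x y z k by (simp add: L_hom(2) hom_iff)
    also have "\<dots> = unfold_L x (?W \<otimes> ?Z) (?f \<cdot> (\<one> ?W \<odot> ?g) \<cdot> asc M ?W ?Z (trg M (L_proj M C x)))"
      using unfold_L_cmp_L[OF x y _ _ g(1) k(1) L_hom(2)[OF x y] g(2)] x y z by simp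
    also have "\<dots> = unfold_L x (?W \<otimes> ?Z)
        (comod.el (?L x) (?L z) (ecmp ?B (?L x) (?L y) (?L z) \<cdot> (L_hom M C y z \<odot> L_hom M C x y)))"
      using x y z by (simp add: comod.el_ecmp)
    finally show "unfold_L x (?W \<otimes> ?Z) (comod.el (?L x) (?L z) (L_hom M C x z \<cdot> ecmp ?A x y z))
      = unfold_L x (?W \<otimes> ?Z)
        (comod.el (?L x) (?L z) (ecmp ?B (?L x) (?L y) (?L z) \<cdot> (L_hom M C y z \<odot> L_hom M C x y)))" .
  qed (use x y z in \<open>simp_all add: hom_iff\<close>)
  ultimately show ?thesis
    unfolding enriched_functor_def using comod.enriched contra.enriched
    by (simp add: L_functor_def L_hom(1))
qed

section \<open>The adjunction\<close>

text \<open>The image of the universal parametrised comodule map, as the Yoneda lemma prescribes: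
  the arrow whose balanced map is that of the identity of the hom object.\<close>

definition adj :: "'o \<times> 'a \<Rightarrow> 'o \<times> 'a \<Rightarrow> 'a"
  where "adj x y = (SOME p.
    p \<in> hom (ehom (comod_cat M C) (L_obj M C x) y) (ehom (contra_cat M C) x (R_obj M C y)) \<and>
    hat y (contra.el x (R_obj M C y) p)
    = unfold_L x (ehom (comod_cat M C) (L_obj M C x) y)
        (comod.el (L_obj M C x) y (\<one> (ehom (comod_cat M C) (L_obj M C x) y))))"

lemma adj:
  assumes x: "contramodule M C x" and y: "comodule M C y"
  defines "E \<equiv> ehom (comod_cat M C) (L_obj M C x) y"
  shows "adj x y \<in> hom E (ehom (contra_cat M C) x (R_obj M C y))"
    "hat y (contra.el x (R_obj M C y) (adj x y)) = unfold_L x E (comod.el (L_obj M C x) y (\<one> E))"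
proof -
  have E: "E \<in> Obj M"
    using x y by (simp add: E_def)
  then have "\<one> E \<in> hom E (ehom (comod_cat M C) (L_obj M C x) y)"
    by (simp add: E_def hom_iff)
  from contra_el_R_surj[OF x y E comod_el_L_props[OF x y this]]
  have "\<exists>p. p \<in> hom E (ehom (contra_cat M C) x (R_obj M C y)) \<and>
      hat y (contra.el x (R_obj M C y) p) = unfold_L x E (comod.el (L_obj M C x) y (\<one> E))"
    by blast
  from someI_ex[OF this]
  show "adj x y \<in> hom E (ehom (contra_cat M C) x (R_obj M C y))"
    "hat y (contra.el x (R_obj M C y) (adj x y)) = unfold_L x E (comod.el (L_obj M C x) y (\<one> E))"
    unfolding adj_def E_def by blast+
qed

lemma adj_simps [simp]:
  assumes "contramodule M C x" "comodule M C y"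
  shows "adj x y \<in> Arr M" "src M (adj x y) = ehom (comod_cat M C) (L_obj M C x) y"
    "trg M (adj x y) = ehom (contra_cat M C) x (R_obj M C y)"
  using adj(1)[OF assms] by (simp_all add: hom_iff)

text \<open>Extends the defining property from the identity to every \<open>p\<close>, by naturality
  in the parameter: composing with \<open>adj\<close> leaves the balanced map unchanged.\<close>

lemma hat_adj:
  assumes x: "contramodule M C x" and y: "comodule M C y"
    and p: "p \<in> hom Z (ehom (comod_cat M C) (L_obj M C x) y)"
  shows "hat y (contra.el x (R_obj M C y) (adj x y \<cdot> p)) = unfold_L x Z (comod.el (L_obj M C x) y p)"
proof -
  let ?E = "ehom (comod_cat M C) (L_obj M C x) y"
  have "\<one> ?E \<in> hom ?E ?E"
    using x y by (simp add: hom_iff)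
  from unfold_L_comod_el_cmp[OF x y this p] show ?thesis
    using x y p by (simp add: hat_contra_el_cmp adj(2) hom_iff)
qed

text \<open>The inverse arises in the same way from the identity of the other hom object. Both
  composites have the balanced map of an identity, so injectivity of the two correspondences
  finishes.\<close>

lemma adj_iso:
  assumes x: "contramodule M C x" and y: "comodule M C y"
  shows "iso_arrow M (adj x y)"
proof -
  let ?E = "ehom (comod_cat M C) (L_obj M C x) y" and ?F = "ehom (contra_cat M C) x (R_obj M C y)"
  have i: "\<one> ?E \<in> hom ?E ?E" "\<one> ?F \<in> hom ?F ?F" "?E \<in> Obj M" "?F \<in> Obj M"
    using x y by (simp_all add: hom_iff)
  obtain q where q: "q \<in> hom ?F ?E"
    "unfold_L x ?F (comod.el (L_obj M C x) y q) = hat y (contra.el x (R_obj M C y) (\<one> ?F))"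
    using comod_el_L_surj[OF x y i(4) contra_el_R_props[OF x y i(2)]] by blast
  show ?thesis
  proof (rule iso_arrowI[OF adj(1)[OF x y] q(1)])
    show "adj x y \<cdot> q = \<one> ?F"
      by (rule contra_el_R_inj[OF x y _ i(2)])
        (use x y q hat_adj[OF x y q(1)] in \<open>simp_all add: hom_iff\<close>)
    have "unfold_L x ?E (comod.el (L_obj M C x) y (q \<cdot> adj x y))
        = hat y (contra.el x (R_obj M C y) (\<one> ?F)) \<cdot> ((adj x y \<odot> \<one> (fst x)) \<odot> \<one> K)"
      using unfold_L_comod_el_cmp[OF x y q(1) adj(1)[OF x y]] q(2) by simp
    also have "\<dots> = hat y (contra.el x (R_obj M C y) (adj x y))"
      using hat_contra_el_cmp[of x y "\<one> ?F" "adj x y"] x y by simp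
    finally show "q \<cdot> adj x y = \<one> ?E"
      by (intro comod_el_L_inj[OF x y _ i(1)]) (use x y q(1) in \<open>simp_all add: hom_iff adj(2)\<close>)
  qed
qed

text \<open>In both squares the two sides are compared as balanced maps. In the comodule variable
  the action of R is evaluated by \<open>hat_R_hom\<close>, in the contramodule variable the action
  of L by \<open>unfold_L_cmp_L\<close>.\<close>

lemma adj_natural:
  "enriched_hom_natural M (contra_cat M C) (comod_cat M C) (L_functor M C) (R_functor M C) adj"
proof -
  let ?B = "comod_cat M C" and ?A = "contra_cat M C" and ?L = "L_obj M C" and ?R = "R_obj M C"
  have "adj x y' \<cdot> ecmp ?B (?L x) y y' = ecmp ?A x (?R y) (?R y') \<cdot> (R_hom M C y y' \<odot> adj x y)"
    if x: "contramodule M C x" and y: "comodule M C y" and y': "comodule M C y'" for x y y'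
  proof (rule contra_el_R_inj[OF x y', of _ "ehom ?B y y' \<otimes> ehom ?B (?L x) y"])
    let ?W = "ehom ?B y y'" and ?Z = "ehom ?B (?L x) y" and ?q = "L_proj M C x"
    let ?m = "comod.el y y' (\<one> ?W)" and ?h = "comod.el (?L x) y (\<one> ?Z)"
    let ?f = "contra.el (?R y) (?R y') (R_hom M C y y')" and ?g = "contra.el x (?R y) (adj x y)"
    have c: "ecmp ?B (?L x) y y' \<in> hom (?W \<otimes> ?Z) (ehom ?B (?L x) y')"
      using comod.ecmp_props[of "?L x" y y'] x y y' by simp
    have m: "?m \<in> hom (?W \<otimes> fst y) (fst y')" "?h \<in> hom (?Z \<otimes> trg M ?q) (fst y)"
      using comod.el_simps[of y y' "\<one> ?W"] x y y' by (simp_all add: hom_iff)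
    have "hat y' (contra.el x (?R y') (adj x y' \<cdot> ecmp ?B (?L x) y y'))
        = unfold_L x (?W \<otimes> ?Z) (?m \<cdot> (\<one> ?W \<odot> ?h) \<cdot> asc M ?W ?Z (trg M ?q))"
      using x y y' comod.el_ecmp[of "?L x" y y' "\<one> ?W" "\<one> ?Z"] by (simp add: hat_adj[OF x y' c])
    also have "\<dots> = ?m \<cdot> (\<one> ?W \<odot> (?h \<cdot> (\<one> ?Z \<odot> ?q))) \<cdot> asc M ?W ?Z (fst x \<otimes> K) \<cdot> asc M (?W \<otimes> ?Z) (fst x) K"
      using x y y' m by (simp add: unfold_L_def hom_iff asc_nats)
    also have "\<dots> = ?m \<cdot> (\<one> ?W \<odot> unfold_L x ?Z ?h) \<cdot> asc M ?W (?Z \<otimes> fst x) K \<cdot> (asc M ?W ?Z (fst x) \<odot> \<one> K)"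
      using x y y' m by (simp add: pentagon unfold_L_def hom_iff)
    also have "\<dots> = hat y' (?f \<cdot> (\<one> ?W \<odot> ?g)) \<cdot> (asc M ?W ?Z (fst x) \<odot> \<one> K)"
      using x y y' m by (simp add: hat_R_hom adj(2) hom_iff)
    also have "\<dots> = hat y' ((?f \<cdot> (\<one> ?W \<odot> ?g)) \<cdot> asc M ?W ?Z (fst x))"
      using x y y' by (subst hat_cmp) simp_all
    also have "\<dots> = hat y' (contra.el x (?R y') (ecmp ?A x (?R y) (?R y') \<cdot> (R_hom M C y y' \<odot> adj x y)))"
      using x y y' by (simp add: contra.el_ecmp)
    finally show "hat y' (contra.el x (?R y') (adj x y' \<cdot> ecmp ?B (?L x) y y'))
      = hat y' (contra.el x (?R y') (ecmp ?A x (?R y) (?R y') \<cdot> (R_hom M C y y' \<odot> adj x y)))" .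
  qed (use x y y' in \<open>simp_all add: hom_iff\<close>)
  moreover have "adj x' y \<cdot> ecmp ?B (?L x') (?L x) y \<cdot> (\<one> (ehom ?B (?L x) y) \<odot> L_hom M C x' x)
      = ecmp ?A x' x (?R y) \<cdot> (adj x y \<odot> \<one> (ehom ?A x' x))"
    if x: "contramodule M C x" and x': "contramodule M C x'" and y: "comodule M C y" for x x' y
  proof (rule contra_el_R_inj[OF x' y, of _ "ehom ?B (?L x) y \<otimes> ehom ?A x' x"])
    let ?W = "ehom ?B (?L x) y" and ?Z = "ehom ?A x' x"
    let ?p = "ecmp ?B (?L x') (?L x) y \<cdot> (\<one> ?W \<odot> L_hom M C x' x)"
    let ?h = "comod.el (?L x) y (\<one> ?W)" and ?k = "contra.el x' x (\<one> ?Z)"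
    let ?g = "comod.el (?L x') (?L x) (L_hom M C x' x)"
    have p: "?p \<in> hom (?W \<otimes> ?Z) (ehom ?B (?L x') y)"
      using x x' y by (simp add: hom_iff)
    have g: "?g \<in> hom (?Z \<otimes> trg M (L_proj M C x')) (trg M (L_proj M C x))"
      "?h \<in> hom (?W \<otimes> trg M (L_proj M C x)) (fst y)"
      using x x' y by (simp_all add: hom_iff)
    have k: "?k \<in> hom (?Z \<otimes> fst x') (fst x)"
      using contra.el_simps[of x' x "\<one> ?Z"] x x' by (simp add: hom_iff)
    have "hat y (contra.el x' (?R y) (adj x' y \<cdot> ?p))
        = unfold_L x' (?W \<otimes> ?Z) (?h \<cdot> (\<one> ?W \<odot> ?g) \<cdot> asc M ?W ?Z (trg M (L_proj M C x')))"
      using x x' y by (simp add: hat_adj[OF x' y p] comod.el_ecmp)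
    also have "\<dots> = unfold_L x ?W ?h \<cdot> (((\<one> ?W \<odot> ?k) \<cdot> asc M ?W ?Z (fst x')) \<odot> \<one> K)"
      using unfold_L_cmp_L[OF x' x _ _ g(1) k L_hom(2)[OF x' x] g(2)] x x' y by simp
    also have "\<dots> = hat y (contra.el x (?R y) (adj x y) \<cdot> (\<one> ?W \<odot> ?k) \<cdot> asc M ?W ?Z (fst x'))"
      using x x' y k by (subst hat_cmp) (simp_all add: hom_iff adj(2))
    also have "\<dots> = hat y (contra.el x' (?R y) (ecmp ?A x' x (?R y) \<cdot> (adj x y \<odot> \<one> ?Z)))"
      using x x' y by (simp add: contra.el_ecmp)
    finally show "hat y (contra.el x' (?R y) (adj x' y \<cdot> ?p))
      = hat y (contra.el x' (?R y) (ecmp ?A x' x (?R y) \<cdot> (adj x y \<odot> \<one> ?Z)))" .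
  qed (use x x' y in \<open>simp_all add: hom_iff\<close>)
  ultimately show ?thesis
    unfolding enriched_hom_natural_def by (simp add: R_functor_def L_functor_def adj(1))
qed

theorem adjunction:
  "enriched_adjunction M (contra_cat M C) (comod_cat M C) (L_functor M C) (R_functor M C)"
  unfolding enriched_adjunction_def
  using L_enriched_functor R_enriched_functor adj_natural adj_iso by auto

end

theorem theorem1:
  fixes M :: "('o, 'a) closed_symmetric_monoidal" (structure)
    and C :: "('o, 'a) comonoid"
  assumes "closed_symmetric_monoidal_category M"
    and equalisers: "\<And>X Y f g. \<lbrakk>f \<in> hom X Y; g \<in> hom X Y;
        \<exists>h \<in> hom Y X. h \<cdot> f = \<one> X \<and> h \<cdot> g = \<one> X\<rbrakk> \<Longrightarrow> \<exists>e. is_equaliser M f g e"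
    and coequalisers: "\<And>X Y f g. \<lbrakk>f \<in> hom X Y; g \<in> hom X Y;
        \<exists>h \<in> hom Y X. f \<cdot> h = \<one> Y \<and> g \<cdot> h = \<one> Y\<rbrakk> \<Longrightarrow> \<exists>q. is_coequaliser M f g q"
    and "comonoid M C"
  shows "enriched_adjunction M (contra_cat M C) (comod_cat M C) (L_functor M C) (R_functor M C)"
proof -
  interpret comonoid_category M C
    using assms by (intro comonoid_category.intro comonoid_category_axioms.intro) blast+
  show ?thesis
    by (rule adjunction)
qed

end
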